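(* Let $\theta\in\,]0,\frac\pi2[$, $x>0$, and let $(X,Y)$ be an obliquely reflected Brownian motion on $\mathbb R\times\mathbb R_+$ with angle of reflection $\theta$, started at $(x,0)$, i.e. $$dX_t=dB^1_t-\tan(\theta)\,dL_t(Y),\qquad dY_t=dB^2_t+dL_t(Y),$$ with $(B^1,B^2)$ a two-dimensional Brownian motion and $Y\ge 0$. Let $S=\inf\{t\ge0:X_t=0\}$. Then the law of $Y_S^2/x^2$ is a Beta distribution of the second kind of parameters $\big(\frac12-\frac\theta\pi,\frac12+\frac\theta\pi\big)$.
   Context: For a continuous semimartingale $Y$, $L_t(Y)=\lim_{\epsilon\to0}\frac1{2\epsilon}\int_0^t1_{\{|Y_s|\le\epsilon\}}d\langle Y\rangle_s$ denotes its symmetric local time at $0$. The Beta distribution of the second kind with parameters $\alpha,\beta>0$ is the law on $]0,\infty[$ with density $\dfrac{x^{\alpha-1}(1+x)^{-\alpha-\beta}}{B(\alpha,\beta)}$, $B$ being the Beta function. *)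

theory Defs
  imports "HOL-Probability.Probability"
begin

text \<open>
  Processes are functions \<^term>\<open>X :: real \<Rightarrow> 'a \<Rightarrow> 'b\<close> (time first, then the sample point);
  only their values at times \<open>t \<ge> 0\<close> are relevant.
\<close>

context prob_space
begin

text \<open>
  Standard Brownian motion started at the origin. For the type \<open>real \<times> real\<close> this is planar
  Brownian motion: the product density makes the two coordinates of every increment independent.
\<close>

definition brownian_motion :: "(real \<Rightarrow> 'a \<Rightarrow> 'b::euclidean_space) \<Rightarrow> bool" where
  "brownian_motion W \<longleftrightarrow>
     (\<forall>t\<ge>0. random_variable borel (W t)) \<and>
     (AE \<omega> in M. W 0 \<omega> = 0) \<and>
     (\<forall>s t. 0 \<le> s \<and> s < t \<longrightarrow>
        distributed M lborel (\<lambda>\<omega>. W t \<omega> - W s \<omega>)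
          (\<lambda>v. ennreal (\<Prod>b\<in>Basis. normal_density 0 (sqrt (t - s)) (v \<bullet> b)))) \<and>
     (\<forall>(t :: nat \<Rightarrow> real) n. 0 \<le> t 0 \<and> mono t \<longrightarrow>
        indep_vars (\<lambda>_. borel) (\<lambda>i \<omega>. W (t (Suc i)) \<omega> - W (t i) \<omega>) {..<n}) \<and>
     (AE \<omega> in M. continuous_on {0..} (\<lambda>t. W t \<omega>))"

text \<open>
  \<open>A\<close> is (a version of) the quadratic variation of the continuous process \<open>Y\<close>: a continuous
  nondecreasing process such that, for every \<open>t \<ge> 0\<close>, the sums of squared increments along
  partitions \<open>0 = p 0 \<le> \<dots> \<le> p n = t\<close> converge to \<open>A t\<close> in probability as the mesh tends to \<open>0\<close>.
  This determines \<open>A\<close> up to indistinguishability, and every continuous semimartingale has one.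
\<close>

definition quadratic_variation :: "(real \<Rightarrow> 'a \<Rightarrow> real) \<Rightarrow> (real \<Rightarrow> 'a \<Rightarrow> real) \<Rightarrow> bool" where
  "quadratic_variation Y A \<longleftrightarrow>
     (\<forall>t\<ge>0. random_variable borel (Y t) \<and> random_variable borel (A t)) \<and>
     (AE \<omega> in M. continuous_on {0..} (\<lambda>t. Y t \<omega>)) \<and>
     (AE \<omega> in M. A 0 \<omega> = 0 \<and> mono_on {0..} (\<lambda>t. A t \<omega>) \<and> continuous_on {0..} (\<lambda>t. A t \<omega>)) \<and>
     (\<forall>t\<ge>0. \<forall>\<epsilon>>0. \<exists>\<delta>>0. \<forall>n. \<forall>p :: nat \<Rightarrow> real.
        p 0 = 0 \<and> p n = t \<and> (\<forall>i<n. p i \<le> p (Suc i) \<and> p (Suc i) - p i < \<delta>) \<longrightarrow>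
        prob {\<omega> \<in> space M. \<bar>(\<Sum>i<n. (Y (p (Suc i)) \<omega> - Y (p i) \<omega>)\<^sup>2) - A t \<omega>\<bar> > \<epsilon>} < \<epsilon>)"

text \<open>
  \<open>L\<close> is (a version of) the symmetric local time at \<open>0\<close> of \<open>Y\<close>:
  \<open>L t = lim (1 / (2 * \<epsilon>)) \<integral>\<^sub>0\<^sup>t 1{\<bar>Y s\<bar> \<le> \<epsilon>} d\<langle>Y\<rangle> s\<close> as \<open>\<epsilon>\<close> decreases to \<open>0\<close>. The integral is the pathwise
  Lebesgue-Stieltjes integral; since \<^const>\<open>interval_measure\<close> expects a function on all of
  the real line, the path of \<open>\<langle>Y\<rangle>\<close> is extended by its initial value to negative times.
  The formula needs of \<open>Y\<close> only that it is continuous with a quadratic variation, so no filtration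
  with respect to which \<open>Y\<close> is a semimartingale is mentioned.
\<close>

definition symmetric_local_time :: "(real \<Rightarrow> 'a \<Rightarrow> real) \<Rightarrow> (real \<Rightarrow> 'a \<Rightarrow> real) \<Rightarrow> bool" where
  "symmetric_local_time Y L \<longleftrightarrow>
     (\<forall>t\<ge>0. random_variable borel (L t)) \<and>
     (\<exists>A. quadratic_variation Y A \<and>
        (AE \<omega> in M. \<forall>t\<ge>0.
           ((\<lambda>\<epsilon>. 1 / (2 * \<epsilon>) *
                (LINT s:{0..t}|interval_measure (\<lambda>s. A (max 0 s) \<omega>). indicator {s. \<bar>Y s \<omega>\<bar> \<le> \<epsilon>} s))
              \<longlongrightarrow> L t \<omega>) (at_right 0)))"

text \<open>
  Obliquely reflected Brownian motion on \<open>\<real> \<times> \<real>\<^sub>+\<close> with angle of reflection \<open>\<theta>\<close>, started at \<open>(x, y)\<close>: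
  \<open>dX = dB1 - tan \<theta> dL(Y)\<close>, \<open>dY = dB2 + dL(Y)\<close>, in integrated form. Path continuity of \<open>X\<close> and \<open>Y\<close>
  is required everywhere and not just almost surely, because \<open>M\<close> need not be complete and
  otherwise \<open>Y\<close> evaluated at a hitting time of \<open>X\<close> could fail to be measurable.
\<close>

definition oblique_reflected_BM ::
    "real \<Rightarrow> real \<Rightarrow> real \<Rightarrow> (real \<Rightarrow> 'a \<Rightarrow> real) \<Rightarrow> (real \<Rightarrow> 'a \<Rightarrow> real) \<Rightarrow> bool" where
  "oblique_reflected_BM \<theta> x y X Y \<longleftrightarrow>
     (\<forall>t\<ge>0. random_variable borel (X t) \<and> random_variable borel (Y t)) \<and>
     (\<forall>\<omega>\<in>space M. continuous_on {0..} (\<lambda>t. X t \<omega>) \<and> continuous_on {0..} (\<lambda>t. Y t \<omega>)) \<and>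
     (\<exists>B1 B2 L. brownian_motion (\<lambda>t \<omega>. (B1 t \<omega>, B2 t \<omega>)) \<and> symmetric_local_time Y L \<and>
        (AE \<omega> in M. \<forall>t\<ge>0.
           X t \<omega> = x + B1 t \<omega> - tan \<theta> * L t \<omega> \<and>
           Y t \<omega> = y + B2 t \<omega> + L t \<omega> \<and>
           Y t \<omega> \<ge> 0))"

end

definition beta2_density :: "real \<Rightarrow> real \<Rightarrow> real \<Rightarrow> real" where
  "beta2_density \<alpha> \<beta> z =
     (if z > 0 then z powr (\<alpha> - 1) * (1 + z) powr (- \<alpha> - \<beta>) / Beta \<alpha> \<beta> else 0)"

end

theory Submission
  imports Defs
begin

text \<open>
  In complex notation \<open>z = X + i Y\<close>, the function
  \<open>f z = (exp (- i \<theta>) * z powr a + exp (i \<theta>) * cnj z powr a) / 2\<close> is harmonic on the right half-plane and its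
  derivative in the direction of reflection vanishes on the real axis, so that \<open>f (X + i Y)\<close>, stopped
  when \<open>X\<close> vanishes, is a local martingale for every exponent \<open>a\<close>. For \<open>a = i u\<close> it is bounded, and
  optional stopping gives
  \<open>E (Y\<^sub>S powr (i u)) * cos (\<theta> - i u \<pi> / 2) = x powr (i u) * cos \<theta>\<close>, i.e. the characteristic function of
  \<open>ln (Y\<^sub>S\<^sup>2 / x\<^sup>2)\<close>; by the reflection formula of the Gamma function it is that of the logarithm of a
  Beta variable of the second kind. A small negative real \<open>a\<close> shows that the corner is not hit.

  Instead of Ito's formula, the reflected process is approximated by the reflected Gaussian walk
  driven by the Brownian increments along a regular grid. Since \<open>L\<close> is the running maximum of
  \<open>- B2\<close>, the walk converges uniformly on bounded intervals along every path. In one step of the walk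
  the mean of \<open>f\<close> changes by an error of the order of \<open>E |\<xi>|\<^sup>4 + E (\<Delta>L)\<^sup>2\<close>, where \<open>\<xi>\<close> is the increment and
  \<open>\<Delta>L\<close> the push, and these errors sum up to something negligible because \<open>\<Sum> E \<Delta>L = E Y\<close> is bounded.
\<close>

section \<open>The oblique harmonic functions\<close>

text \<open>The hypotheses tie \<open>X\<close> and \<open>Y\<close> to the Brownian motion only
  through the equations. No filtration or adaptedness is given from which stochastic calculus could
  start. The walk avoids this obstacle: it is a function of the Brownian increments alone, so its
  position is independent of the next increment. The expansion is taken to order 3 because an
  isotropic Gaussian step kills the first three powers of the step and of its conjugate in mean;
  with n steps of length T/n the fourth-order remainders sum to order 1/n. The squared push is the
  harder error: bounding it by the squared step leaves a sum of order T, so it is traded for a small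
  multiple of the push itself. Exponents have nonpositive real part so that all bounds are uniform
  on unbounded half-planes. The corner has to be excluded because z powr (i u) has no limit at 0 for
  u nonzero; with a negative exponent f blows up there while its means stay bounded.\<close>

definition falling :: "complex \<Rightarrow> nat \<Rightarrow> complex" where
  "falling a j = (\<Prod>i<j. a - of_nat i)"

definition powr_deriv :: "complex \<Rightarrow> nat \<Rightarrow> complex \<Rightarrow> complex" where
  "powr_deriv a j z = falling a j * z powr (a - of_nat j)"

lemma powr_deriv_0 [simp]: "powr_deriv a 0 z = z powr a"
  by (simp add: powr_deriv_def falling_def)

lemma powr_deriv_has_field_derivative:
  assumes "0 < Re z"
  shows "(powr_deriv a j has_field_derivative powr_deriv a (Suc j) z) (at z within A)"
proof -
  have "z \<notin> \<real>\<^sub>\<le>\<^sub>0"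
    using assms by (auto simp: complex_nonpos_Reals_iff)
  then show ?thesis
    unfolding powr_deriv_def falling_def
    by (auto intro!: derivative_eq_intros simp: algebra_simps)
qed

text \<open>The modulus is |z|^(Re a) * exp (- Im a * Arg z). Since \<open>Re a \<le> 0\<close>, the
  first factor decreases in |z|, so a lower bound on \<open>Re z\<close> controls it on the whole
  unbounded half-plane.\<close>

lemma norm_powr_le:
  assumes "Re a \<le> 0" "0 < \<kappa>" "\<kappa> \<le> Re z"
  shows "norm (z powr a) \<le> \<kappa> powr Re a * exp (\<bar>Im a\<bar> * pi)"
proof -
  have z0: "z \<noteq> 0" using assms by auto
  have "norm (z powr a) = exp (Re a * ln (norm z)) * exp (- (Im a * Im (Ln z)))"
    using z0 by (simp add: powr_def exp_add [symmetric])
  also have "\<dots> \<le> exp (Re a * ln \<kappa>) * exp (\<bar>Im a\<bar> * pi)"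
  proof (intro mult_mono)
    have "ln \<kappa> \<le> ln (norm z)"
      using assms complex_Re_le_cmod[of z] by (subst ln_le_cancel_iff) auto
    then show "exp (Re a * ln (norm z)) \<le> exp (Re a * ln \<kappa>)"
      using assms by (simp add: mult_left_mono_neg)
    have "\<bar>Im (Ln z)\<bar> \<le> pi"
      using mpi_less_Im_Ln[OF z0] Im_Ln_le_pi[OF z0] by linarith
    then have "\<bar>Im a * Im (Ln z)\<bar> \<le> \<bar>Im a\<bar> * pi"
      by (auto simp: abs_mult intro!: mult_left_mono)
    then show "exp (- (Im a * Im (Ln z))) \<le> exp (\<bar>Im a\<bar> * pi)"
      by simp
  qed auto
  finally show ?thesis
    using assms by (simp add: powr_def mult.commute)
qed

lemma norm_powr_deriv_bounded:
  assumes "Re a \<le> 0" "0 < \<kappa>"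
  obtains B where "0 \<le> B" "\<And>z. \<kappa> \<le> Re z \<Longrightarrow> norm (powr_deriv a j z) \<le> B"
proof
  let ?B = "norm (falling a j) * (\<kappa> powr (Re a - j) * exp (\<bar>Im a\<bar> * pi))"
  show "0 \<le> ?B" by auto
  fix z assume "\<kappa> \<le> Re z"
  then show "norm (powr_deriv a j z) \<le> ?B"
    using norm_powr_le[of "a - of_nat j" \<kappa> z] assms
    by (auto simp: powr_deriv_def norm_mult intro!: mult_left_mono)
qed

text \<open>The half-plane is convex and the derivative of order n + 1 is bounded on all of it, its
  exponent again having nonpositive real part. Hence one constant serves all base points and all
  increments, large ones included.\<close>

lemma powr_Taylor:
  assumes "Re a \<le> 0" "0 < \<kappa>"
  obtains B where "0 \<le> B"
    "\<And>z w. \<lbrakk>\<kappa> \<le> Re z; \<kappa> \<le> Re (z + w)\<rbrakk> \<Longrightarrow>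
       norm ((z + w) powr a - (\<Sum>j\<le>n. powr_deriv a j z * w ^ j / fact j)) \<le> B * norm w ^ Suc n"
proof -
  obtain B where B: "0 \<le> B" "\<And>z. \<kappa> \<le> Re z \<Longrightarrow> norm (powr_deriv a (Suc n) z) \<le> B"
    using norm_powr_deriv_bounded[OF assms] by blast
  show ?thesis
  proof
    show "0 \<le> B / fact n" using B by simp
    fix z w assume zw: "\<kappa> \<le> Re z" "\<kappa> \<le> Re (z + w)"
    have "norm (powr_deriv a 0 (z + w) - (\<Sum>j\<le>n. powr_deriv a j z * (z + w - z) ^ j / fact j))
            \<le> B * norm (z + w - z) ^ Suc n / fact n"
    proof (rule complex_Taylor[where S = "{u. \<kappa> \<le> Re u}"])
      show "convex {u. \<kappa> \<le> Re u}"
        using convex_halfspace_Re_ge by simp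
    qed (use zw B assms in \<open>auto intro!: powr_deriv_has_field_derivative\<close>)
    then show "norm ((z + w) powr a - (\<Sum>j\<le>n. powr_deriv a j z * w ^ j / fact j))
                 \<le> B / fact n * norm w ^ Suc n"
      by simp
  qed
qed

text \<open>
  For real \<open>a\<close>, this is \<open>r powr a * cos (a * \<phi> - \<theta>)\<close> in polar coordinates. It is harmonic, and its
  derivative in the direction \<open>(-tan \<theta>, 1)\<close> vanishes on the positive real axis.
\<close>

definition oblique_fun :: "real \<Rightarrow> complex \<Rightarrow> complex \<Rightarrow> complex" where
  "oblique_fun \<theta> a z = (cis (-\<theta>) * z powr a + cis \<theta> * cnj z powr a) / 2"

text \<open>The Taylor polynomial of order 3 of \<open>oblique_fun\<close> without its constant
  term. It contains pure powers of \<open>w\<close> and of \<open>cnj w\<close> but no mixed ones,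
  which is how harmonicity enters: every term has mean zero for an isotropic increment.\<close>

definition oblique_lin :: "real \<Rightarrow> complex \<Rightarrow> complex \<Rightarrow> complex \<Rightarrow> complex" where
  "oblique_lin \<theta> a z w =
     (cis (-\<theta>) * (\<Sum>j\<in>{1..3}. powr_deriv a j z / fact j * w ^ j)
      + cis \<theta> * (\<Sum>j\<in>{1..3}. powr_deriv a j (cnj z) / fact j * cnj w ^ j)) / 2"

text \<open>Cutting off near the line \<open>Re z = 0\<close> keeps the function bounded when the walk overshoots its stopping level.\<close>

definition clamped :: "real \<Rightarrow> real \<Rightarrow> complex \<Rightarrow> complex \<Rightarrow> complex" where
  "clamped \<kappa> \<theta> a z = (if \<kappa> \<le> Re z then oblique_fun \<theta> a z else 0)"

text \<open>
  \<open>push p\<close> is the increment of the local time that brings \<open>p\<close> back to the upper half-plane along the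
  direction of reflection \<open>i - tan \<theta>\<close>.
\<close>

definition push :: "complex \<Rightarrow> real" where
  "push p = max 0 (- Im p)"

definition ostep :: "real \<Rightarrow> complex \<Rightarrow> complex \<Rightarrow> complex" where
  "ostep \<theta> z w = z + w + (\<i> - of_real (tan \<theta>)) * of_real (push (z + w))"

lemma norm_average_le:
  assumes "norm A \<le> c" "norm B \<le> c"
  shows "norm ((cis u * A + cis v * B) / 2) \<le> c"
proof -
  have "norm (cis u * A + cis v * B) \<le> norm A + norm B"
    by (intro norm_triangle_le) (simp add: norm_mult)
  then show ?thesis using assms by (simp add: norm_divide)
qed

lemma norm_clamped_bounded:
  assumes "Re a \<le> 0" "0 < \<kappa>"
  obtains B where "0 \<le> B" "\<And>z. norm (clamped \<kappa> \<theta> a z) \<le> B"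
proof
  let ?B = "\<kappa> powr Re a * exp (\<bar>Im a\<bar> * pi)"
  show "0 \<le> ?B" by auto
  fix z
  show "norm (clamped \<kappa> \<theta> a z) \<le> ?B"
  proof (cases "\<kappa> \<le> Re z")
    case True
    then have "norm (oblique_fun \<theta> a z) \<le> ?B"
      unfolding oblique_fun_def using assms by (intro norm_average_le norm_powr_le) auto
    with True show ?thesis by (simp add: clamped_def)
  qed (simp add: clamped_def)
qed

lemma oblique_fun_Taylor:
  assumes "Re a \<le> 0" "0 < \<kappa>"
  obtains B where "0 \<le> B"
    "\<And>z w. \<lbrakk>\<kappa> \<le> Re z; \<kappa> \<le> Re (z + w)\<rbrakk> \<Longrightarrow>
       norm (oblique_fun \<theta> a (z + w) - oblique_fun \<theta> a z - oblique_lin \<theta> a z w) \<le> B * norm w ^ 4"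
proof -
  obtain B where B: "0 \<le> B"
    "\<And>z w. \<lbrakk>\<kappa> \<le> Re z; \<kappa> \<le> Re (z + w)\<rbrakk> \<Longrightarrow>
       norm ((z + w) powr a - (\<Sum>j\<le>3. powr_deriv a j z * w ^ j / fact j)) \<le> B * norm w ^ Suc 3"
    using powr_Taylor[OF assms, of 3] by blast
  have set3: "{..3} = insert 0 {1..3::nat}" by auto
  show ?thesis
  proof
    show "0 \<le> B" by fact
    fix z w assume zw: "\<kappa> \<le> Re z" "\<kappa> \<le> Re (z + w)"
    define R where "R z w = (z + w) powr a - (\<Sum>j\<le>3. powr_deriv a j z * w ^ j / fact j)" for z w
    have R: "R z w = (z + w) powr a - z powr a - (\<Sum>j\<in>{1..3}. powr_deriv a j z / fact j * w ^ j)" for z w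
      unfolding R_def set3 by (simp add: field_simps)
    have eq: "oblique_fun \<theta> a (z + w) - oblique_fun \<theta> a z - oblique_lin \<theta> a z w
            = (cis (-\<theta>) * R z w + cis \<theta> * R (cnj z) (cnj w)) / 2"
      unfolding R oblique_fun_def oblique_lin_def by (simp add: field_simps)
    \<comment> \<open>Conjugation preserves real parts, so the remainder bound applies equally at
      \<open>cnj z\<close> with increment \<open>cnj w\<close>.\<close>
    show "norm (oblique_fun \<theta> a (z + w) - oblique_fun \<theta> a z - oblique_lin \<theta> a z w) \<le> B * norm w ^ 4"
      unfolding eq
      by (rule norm_average_le)
         (use B(2)[of z w] B(2)[of "cnj z" "cnj w"] zw in \<open>auto simp: R_def\<close>)
  qed
qed

text \<open>The reflection direction \<open>\<i> - tan \<theta>\<close> equals i * cis \<theta> /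
  cos \<theta>, so rotating it by \<open>- \<theta>\<close> makes it purely imaginary. The second
  identity is the conjugate version up to sign; together they give the oblique Neumann
  condition.\<close>

lemma cis_cancel:
  assumes "cos \<theta> \<noteq> 0"
  shows "cis (-\<theta>) * (\<i> - of_real (tan \<theta>)) = (\<i> / of_real (cos \<theta>) :: complex)"
    and "cis \<theta> * (\<i> + of_real (tan \<theta>)) = (\<i> / of_real (cos \<theta>) :: complex)"
proof -
  have *: "cos \<theta> * cos \<theta> + sin \<theta> * sin \<theta> = 1"
    using sin_cos_squared_add3[of \<theta>] by (simp add: power2_eq_square)
  show "cis (-\<theta>) * (\<i> - of_real (tan \<theta>)) = (\<i> / of_real (cos \<theta>) :: complex)"
    using assms * by (auto simp: complex_eq_iff tan_def field_simps Re_divide Im_divide power2_eq_square)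
  show "cis \<theta> * (\<i> + of_real (tan \<theta>)) = (\<i> / of_real (cos \<theta>) :: complex)"
    using assms * by (auto simp: complex_eq_iff tan_def field_simps Re_divide Im_divide power2_eq_square)
qed

text \<open>The expansion is around the real endpoint \<open>q\<close> of the push, not around its
  start. There z and its conjugate coincide, so both first-order terms carry the same derivative,
  and their coefficients cancel by \<open>cis_cancel\<close>; only the quadratic remainder is
  left.\<close>

lemma oblique_fun_push:
  assumes "Re a \<le> 0" "0 < \<kappa>" "cos \<theta> \<noteq> 0"
  obtains B where "0 \<le> B"
    "\<And>q s. \<lbrakk>\<kappa> \<le> q; \<kappa> \<le> q + tan \<theta> * s\<rbrakk> \<Longrightarrow>
       norm (oblique_fun \<theta> a (of_real q - (\<i> - of_real (tan \<theta>)) * of_real s) - oblique_fun \<theta> a (of_real q)) \<le> B * s\<^sup>2"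
proof -
  obtain B where B: "0 \<le> B"
    "\<And>z w. \<lbrakk>\<kappa> \<le> Re z; \<kappa> \<le> Re (z + w)\<rbrakk> \<Longrightarrow>
       norm ((z + w) powr a - (\<Sum>j\<le>1. powr_deriv a j z * w ^ j / fact j)) \<le> B * norm w ^ Suc 1"
    using powr_Taylor[OF assms(1,2), of 1] by blast
  let ?v = "\<i> - of_real (tan \<theta>) :: complex"
  show ?thesis
  proof
    show "0 \<le> B * (norm ?v)\<^sup>2" using B by simp
    fix q s assume qs: "\<kappa> \<le> q" "\<kappa> \<le> q + tan \<theta> * s"
    define R where "R z w = (z + w) powr a - (\<Sum>j\<le>1. powr_deriv a j z * w ^ j / fact j)" for z w
    have R: "R z w = (z + w) powr a - z powr a - powr_deriv a 1 z * w" for z w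
      unfolding R_def by simp
    let ?w = "- ?v * of_real s"
    have c1: "cis (-\<theta>) * ?w = - \<i> / of_real (cos \<theta>) * of_real s"
    proof -
      have "cis (-\<theta>) * ?w = - (cis (-\<theta>) * ?v) * of_real s" by (simp add: algebra_simps)
      then show ?thesis unfolding cis_cancel(1)[OF assms(3)] by simp
    qed
    have c2: "cis \<theta> * cnj ?w = \<i> / of_real (cos \<theta>) * of_real s"
    proof -
      have "cis \<theta> * cnj ?w = (cis \<theta> * (\<i> + of_real (tan \<theta>))) * of_real s" by (simp add: algebra_simps)
      then show ?thesis unfolding cis_cancel(2)[OF assms(3)] .
    qed
    have "cis (-\<theta>) * (powr_deriv a 1 (of_real q) * ?w) + cis \<theta> * (powr_deriv a 1 (of_real q) * cnj ?w)
      = powr_deriv a 1 (of_real q) * (cis (-\<theta>) * ?w + cis \<theta> * cnj ?w)"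
      by (simp add: algebra_simps)
    also have "\<dots> = 0" unfolding c1 c2 by simp
    finally have z0: "cis (-\<theta>) * (powr_deriv a 1 (of_real q) * ?w) + cis \<theta> * (powr_deriv a 1 (of_real q) * cnj ?w) = 0" .
    have "oblique_fun \<theta> a (of_real q + ?w) - oblique_fun \<theta> a (of_real q)
       = (cis (-\<theta>) * R (of_real q) ?w + cis \<theta> * R (of_real q) (cnj ?w)) / 2
         + (cis (-\<theta>) * (powr_deriv a 1 (of_real q) * ?w) + cis \<theta> * (powr_deriv a 1 (of_real q) * cnj ?w)) / 2"
      unfolding R oblique_fun_def complex_cnj_add complex_cnj_complex_of_real
      by (simp add: field_simps)
    then have eq: "oblique_fun \<theta> a (of_real q + ?w) - oblique_fun \<theta> a (of_real q)
       = (cis (-\<theta>) * R (of_real q) ?w + cis \<theta> * R (of_real q) (cnj ?w)) / 2"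
      unfolding z0 by simp
    have "norm (oblique_fun \<theta> a (of_real q + ?w) - oblique_fun \<theta> a (of_real q)) \<le> B * (norm ?w)\<^sup>2"
      unfolding eq
    proof (rule norm_average_le)
      show "norm (R (of_real q) ?w) \<le> B * (norm ?w)\<^sup>2"
        using B(2)[of "of_real q" ?w] qs by (simp add: R_def numeral_2_eq_2)
      have "norm (R (of_real q) (cnj ?w)) \<le> B * (norm (cnj ?w))\<^sup>2"
        using B(2)[of "of_real q" "cnj ?w"] qs by (simp add: R_def numeral_2_eq_2)
      then show "norm (R (of_real q) (cnj ?w)) \<le> B * (norm ?w)\<^sup>2"
        by (simp only: complex_mod_cnj)
    qed
    also have "(norm ?w)\<^sup>2 = (norm ?v)\<^sup>2 * s\<^sup>2"
      by (simp only: norm_mult norm_minus_cancel norm_of_real power_mult_distrib power2_abs)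
    finally show "norm (oblique_fun \<theta> a (of_real q - ?v * of_real s) - oblique_fun \<theta> a (of_real q))
        \<le> B * (norm ?v)\<^sup>2 * s\<^sup>2"
      by (simp add: mult.assoc algebra_simps)
  qed
qed

lemma push_nonneg [simp]: "0 \<le> push p"
  by (simp add: push_def)

lemma Re_ostep: "Re (ostep \<theta> z w) = Re z + Re w - tan \<theta> * push (z + w)"
  by (simp add: ostep_def)

lemma Im_ostep: "Im (ostep \<theta> z w) = Im z + Im w + push (z + w)"
  by (simp add: ostep_def)

lemma Im_ostep_nonneg: "0 \<le> Im (ostep \<theta> z w)"
  by (simp add: Im_ostep push_def)

lemma push_le: "0 \<le> Im z \<Longrightarrow> push (z + w) \<le> norm w"
  using abs_Im_le_cmod[of w] by (simp add: push_def)

text \<open>If the step ends to the right of \<open>\<kappa>\<close>, the errors of the free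
  increment and of the push add up. If it ends to the left, the increment must be long, and then the
  boundedness of all terms suffices, since a constant is at most a multiple of |w|^4.\<close>

lemma ostep_Taylor:
  assumes a: "Re a \<le> 0" and \<kappa>: "0 < \<kappa>" "\<kappa> < \<delta>" and \<theta>: "0 < cos \<theta>" "0 \<le> tan \<theta>"
  obtains K where "0 \<le> K"
    "\<And>z w. \<lbrakk>\<delta> \<le> Re z; 0 \<le> Im z\<rbrakk> \<Longrightarrow>
       norm (clamped \<kappa> \<theta> a (ostep \<theta> z w) - clamped \<kappa> \<theta> a z - oblique_lin \<theta> a z w)
         \<le> K * (norm w ^ 4 + (push (z + w))\<^sup>2)"
proof -
  obtain C where C: "0 \<le> C" "\<And>z. norm (clamped \<kappa> \<theta> a z) \<le> C"
    using norm_clamped_bounded[OF a \<kappa>(1)] by blast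
  obtain B1 where B1: "0 \<le> B1" 
    "\<And>z w. \<lbrakk>\<kappa> \<le> Re z; \<kappa> \<le> Re (z + w)\<rbrakk> \<Longrightarrow>
       norm (oblique_fun \<theta> a (z + w) - oblique_fun \<theta> a z - oblique_lin \<theta> a z w) \<le> B1 * norm w ^ 4"
    using oblique_fun_Taylor[OF a \<kappa>(1)] by blast
  obtain B2 where B2: "0 \<le> B2" 
    "\<And>q s. \<lbrakk>\<kappa> \<le> q; \<kappa> \<le> q + tan \<theta> * s\<rbrakk> \<Longrightarrow>
       norm (oblique_fun \<theta> a (of_real q - (\<i> - of_real (tan \<theta>)) * of_real s) - oblique_fun \<theta> a (of_real q)) \<le> B2 * s\<^sup>2"
    using oblique_fun_push[OF a \<kappa>(1), of \<theta>] \<theta> by auto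
  obtain b where b: "\<And>j. 0 \<le> b j" "\<And>j z. \<kappa> \<le> Re z \<Longrightarrow> norm (powr_deriv a j z) \<le> b j"
  proof -
    have "\<forall>j. \<exists>B. 0 \<le> B \<and> (\<forall>z. \<kappa> \<le> Re z \<longrightarrow> norm (powr_deriv a j z) \<le> B)"
      using norm_powr_deriv_bounded[OF a \<kappa>(1)] by metis
    then show ?thesis using that by metis
  qed
  \<comment> \<open>A lower bound for the length of an increment that leads from
    \<open>Re z \<ge> \<delta>\<close> to below \<open>\<kappa>\<close>: the push is at most |w|, so
    it shifts the real part by at most tan \<theta> * |w|.\<close>
  define r where "r = (\<delta> - \<kappa>) / (1 + tan \<theta>)"
  have r: "0 < r" using \<kappa> \<theta> by (simp add: r_def)
  have lin: "norm (oblique_lin \<theta> a z w) \<le> (\<Sum>j\<in>{1..3}. b j * norm w ^ j)" if "\<kappa> \<le> Re z" for z w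
    unfolding oblique_lin_def
  proof (rule norm_average_le; rule sum_norm_le)
    fix j :: nat
    have *: "norm (powr_deriv a j u / fact j * v ^ j) \<le> b j * norm v ^ j" if "\<kappa> \<le> Re u" for u v
    proof -
      have "norm (powr_deriv a j u / fact j) \<le> norm (powr_deriv a j u)"
        by (simp add: norm_divide divide_le_eq mult_le_cancel_left1)
      also have "\<dots> \<le> b j" using b that by auto
      finally show ?thesis
        unfolding norm_mult norm_power by (intro mult_right_mono) auto
    qed
    show "norm (powr_deriv a j z / fact j * w ^ j) \<le> b j * norm w ^ j"
      using * that by blast
    show "norm (powr_deriv a j (cnj z) / fact j * cnj w ^ j) \<le> b j * norm w ^ j"
      using *[of "cnj z" "cnj w"] that by simp
  qed
  \<comment> \<open>For |w| >= r the power |w|^j is at most |w|^4 / r^(4 - j). The summand with 2 *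
    C pays for the two values of \<open>clamped\<close>, the others for the Taylor terms.\<close>
  define K3 where "K3 = (2 * C) / r ^ 4 + (\<Sum>j\<in>{1..3}. b j / r ^ (4 - j))"
  have K3: "0 \<le> K3" using C b r by (auto simp: K3_def intro!: add_nonneg_nonneg sum_nonneg)
  have pw: "norm w ^ j \<le> norm w ^ 4 / r ^ (4 - j)" if "r \<le> norm w" "j \<le> 4" for w :: complex and j
  proof -
    have "norm w ^ j * r ^ (4 - j) \<le> norm w ^ j * norm w ^ (4 - j)"
      using that r by (intro mult_left_mono power_mono) auto
    also have "\<dots> = norm w ^ 4" using that by (simp add: power_add [symmetric])
    finally show ?thesis using r by (simp add: field_simps)
  qed
  show ?thesis
  proof
    show "0 \<le> K3 + B1 + B2" using K3 B1 B2 by simp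
    fix z w assume z: "\<delta> \<le> Re z" "0 \<le> Im z"
    let ?p = "z + w" and ?s = "push (z + w)"
    let ?E = "clamped \<kappa> \<theta> a (ostep \<theta> z w) - clamped \<kappa> \<theta> a z - oblique_lin \<theta> a z w"
    show "norm ?E \<le> (K3 + B1 + B2) * (norm w ^ 4 + ?s\<^sup>2)"
    proof (cases "\<kappa> \<le> Re (ostep \<theta> z w)")
      case True
      \<comment> \<open>Since \<open>tan \<theta> \<ge> 0\<close> the push goes to the left, so the
        intermediate point before the push also lies in the half-plane where the expansions
        hold.\<close>
      have "Re (ostep \<theta> z w) \<le> Re ?p" using \<theta> by (simp add: Re_ostep)
      with True have p: "\<kappa> \<le> Re ?p" by simp
      have 1: "norm (oblique_fun \<theta> a ?p - oblique_fun \<theta> a z - oblique_lin \<theta> a z w) \<le> B1 * norm w ^ 4"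
        using B1 p z \<kappa> by auto
      have 2: "norm (oblique_fun \<theta> a (ostep \<theta> z w) - oblique_fun \<theta> a ?p) \<le> B2 * ?s\<^sup>2"
      proof (cases "Im ?p < 0")
        case im: True
        define q where "q = Re (ostep \<theta> z w)"
        have o: "ostep \<theta> z w = of_real q"
          using im by (simp add: complex_eq_iff q_def Im_ostep push_def)
        have pq: "?p = of_real q - (\<i> - of_real (tan \<theta>)) * of_real ?s"
          using o by (simp add: ostep_def algebra_simps)
        have "Re ?p = q + tan \<theta> * ?s" by (simp add: q_def Re_ostep)
        then have "norm (oblique_fun \<theta> a ?p - oblique_fun \<theta> a (of_real q)) \<le> B2 * ?s\<^sup>2"
          using B2(2)[of q ?s] True p pq unfolding q_def[symmetric] by metis
        then show ?thesis unfolding o by (metis norm_minus_commute)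
      next
        case False
        then have "?s = 0" by (simp add: push_def)
        then show ?thesis by (simp add: ostep_def)
      qed
      have "?E = (oblique_fun \<theta> a ?p - oblique_fun \<theta> a z - oblique_lin \<theta> a z w)
               + (oblique_fun \<theta> a (ostep \<theta> z w) - oblique_fun \<theta> a ?p)"
        using True z \<kappa> by (simp add: clamped_def)
      then have "norm ?E \<le> B1 * norm w ^ 4 + B2 * ?s\<^sup>2"
        using 1 2 norm_triangle_le by (metis add_mono)
      also have "\<dots> \<le> (K3 + B1 + B2) * norm w ^ 4 + (K3 + B1 + B2) * ?s\<^sup>2"
        using K3 B1 B2 by (intro add_mono mult_right_mono) auto
      finally show ?thesis by (simp add: distrib_left)
    next
      case False
      have "\<delta> - \<kappa> \<le> norm w + tan \<theta> * ?s"
        using False z abs_Re_le_cmod[of w] by (simp add: Re_ostep)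
      also have "\<dots> \<le> norm w + tan \<theta> * norm w"
        using push_le[OF z(2), of w] \<theta> by (intro add_left_mono mult_left_mono) auto
      finally have rw: "r \<le> norm w" using \<theta> by (simp add: r_def field_simps)
      have "norm ?E \<le> norm (clamped \<kappa> \<theta> a (ostep \<theta> z w)) + norm (clamped \<kappa> \<theta> a z) + norm (oblique_lin \<theta> a z w)"
        by (meson add_mono norm_triangle_ineq4 order_refl order_trans)
      also have "\<dots> \<le> (C + C) * norm w ^ 0 + (\<Sum>j\<in>{1..3}. b j * norm w ^ j)"
        using C(2)[of "ostep \<theta> z w"] C(2)[of z] lin[of z w] z \<kappa> by (intro add_mono) auto
      also have "\<dots> \<le> (C + C) * (norm w ^ 4 / r ^ (4 - 0)) + (\<Sum>j\<in>{1..3}. b j * (norm w ^ 4 / r ^ (4 - j)))"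
        using C b rw by (intro add_mono mult_left_mono sum_mono pw) auto
      also have "\<dots> = K3 * norm w ^ 4"
        by (simp add: K3_def distrib_right sum_distrib_right)
      also have "\<dots> \<le> (K3 + B1 + B2) * (norm w ^ 4 + ?s\<^sup>2)"
        using K3 B1 B2 by (intro mult_mono) auto
      finally show ?thesis .
    qed
  qed
qed

section \<open>The stopped reflected walk\<close>

lemma ostep_measurable [measurable]:
  assumes [measurable]: "f \<in> borel_measurable M" "g \<in> borel_measurable M"
  shows "(\<lambda>x. ostep \<theta> (f x) (g x)) \<in> borel_measurable M"
  unfolding ostep_def push_def by measurable

text \<open>The power is continuous on the closed half-plane, which avoids the branch cut; extending
  it by 0 outside gives a Borel function on the plane.\<close>

lemma powr_Re_ge_measurable:
  fixes a :: complex
  assumes "0 < \<kappa>"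
  shows "(\<lambda>z. if z \<in> {z. \<kappa> \<le> Re z} then z powr a else 0) \<in> borel_measurable borel"
proof (rule borel_measurable_continuous_on_if)
  show "{z. \<kappa> \<le> Re z} \<in> sets borel" by measurable
  show "continuous_on {z. \<kappa> \<le> Re z} (\<lambda>z. z powr a)"
    using assms by (intro continuous_intros) (auto simp: complex_nonpos_Reals_iff)
qed auto

lemma clamped_measurable [measurable]:
  assumes "0 < \<kappa>"
  shows "clamped \<kappa> \<theta> a \<in> borel_measurable borel"
proof -
  note [measurable] = powr_Re_ge_measurable[OF assms, of a]
  have "clamped \<kappa> \<theta> a = (\<lambda>z. (cis (-\<theta>) * (if z \<in> {z. \<kappa> \<le> Re z} then z powr a else 0)
     + cis \<theta> * (if cnj z \<in> {z. \<kappa> \<le> Re z} then cnj z powr a else 0)) / 2)"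
    by (auto simp: clamped_def oblique_fun_def)
  also have "\<dots> \<in> borel_measurable borel"
  proof -
    have "(\<lambda>z. if cnj z \<in> {z. \<kappa> \<le> Re z} then cnj z powr a else 0) \<in> borel_measurable borel"
      by (rule measurable_compose[OF _ powr_Re_ge_measurable[OF assms]])
         (auto intro!: borel_measurable_continuous_onI continuous_intros)
    then show ?thesis by measurable
  qed
  finally show ?thesis .
qed

text \<open>Stopping is built into the recursion: the walk freezes once its real part is at most
  \<open>\<delta>\<close>. Thus the means can be followed step by step up to a deterministic number
  of steps, and no separate optional stopping argument is required.\<close>

primrec owalk :: "real \<Rightarrow> real \<Rightarrow> complex \<Rightarrow> (nat \<Rightarrow> complex) \<Rightarrow> nat \<Rightarrow> complex" where
  "owalk \<theta> \<delta> z s 0 = z"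
| "owalk \<theta> \<delta> z s (Suc k) =
     (if \<delta> < Re (owalk \<theta> \<delta> z s k) then ostep \<theta> (owalk \<theta> \<delta> z s k) (s k) else owalk \<theta> \<delta> z s k)"

lemma owalk_cong:
  "(\<And>i. i < k \<Longrightarrow> s i = s' i) \<Longrightarrow> owalk \<theta> \<delta> z s k = owalk \<theta> \<delta> z s' k"
  by (induction k) auto

lemma owalk_measurable:
  assumes "k \<le> N" and [measurable]: "\<And>i. i < N \<Longrightarrow> (\<lambda>\<omega>. s \<omega> i) \<in> borel_measurable M"
  shows "(\<lambda>\<omega>. owalk \<theta> \<delta> z (s \<omega>) k) \<in> borel_measurable M"
  using assms(1)
proof (induction k)
  case (Suc k)
  then have [measurable]: "(\<lambda>\<omega>. owalk \<theta> \<delta> z (s \<omega>) k) \<in> borel_measurable M"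
    and [measurable]: "(\<lambda>\<omega>. s \<omega> k) \<in> borel_measurable M" by auto
  show ?case by simp
qed simp

lemma Im_owalk_nonneg: "0 \<le> Im z \<Longrightarrow> 0 \<le> Im (owalk \<theta> \<delta> z s k)"
  by (induction k) (auto simp: Im_ostep_nonneg)

text \<open>An abstraction of planar Brownian increments over time \<open>h\<close>. Isotropy is
  expressed by the vanishing of the first three complex moments; 8 * h^2 is the exact Gaussian value
  of the fourth absolute moment.\<close>

locale isotropic_steps = prob_space +
  fixes \<xi> :: "nat \<Rightarrow> 'a \<Rightarrow> complex" and N :: nat and h :: real
  assumes h: "0 < h"
    and indep: "indep_vars (\<lambda>_. borel) \<xi> {..<N}"
    and moment4: "\<And>i. i < N \<Longrightarrow> integrable M (\<lambda>\<omega>. norm (\<xi> i \<omega>) ^ 4)"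
      "\<And>i. i < N \<Longrightarrow> expectation (\<lambda>\<omega>. norm (\<xi> i \<omega>) ^ 4) \<le> 8 * h\<^sup>2"
    and moment: "\<And>i j. \<lbrakk>i < N; j \<in> {1..3}\<rbrakk> \<Longrightarrow> expectation (\<lambda>\<omega>. \<xi> i \<omega> ^ j) = 0"
begin

lemma steps_measurable [measurable]: "i < N \<Longrightarrow> \<xi> i \<in> borel_measurable M"
  using indep by (auto simp: indep_vars_def)

lemma integrable_step_power:
  assumes "i < N" "j \<le> 4"
  shows "integrable M (\<lambda>\<omega>. norm (\<xi> i \<omega>) ^ j)" "integrable M (\<lambda>\<omega>. \<xi> i \<omega> ^ j)"
proof -
  have le: "norm w ^ j \<le> 1 + norm w ^ 4" for w :: complex
  proof (cases "norm w \<le> 1")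
    case True
    then have "norm w ^ j \<le> 1" by (simp add: power_le_one)
    moreover have "0 \<le> norm w ^ 4" by simp
    ultimately show ?thesis by linarith
  next
    case False
    then have "norm w ^ j \<le> norm w ^ 4" using assms by (intro power_increasing) auto
    then show ?thesis by simp
  qed
  have [measurable]: "\<xi> i \<in> borel_measurable M" using assms by simp
  have int: "integrable M (\<lambda>\<omega>. 1 + norm (\<xi> i \<omega>) ^ 4)" using moment4(1)[OF assms(1)] by simp
  show "integrable M (\<lambda>\<omega>. norm (\<xi> i \<omega>) ^ j)" "integrable M (\<lambda>\<omega>. \<xi> i \<omega> ^ j)"
    by (rule Bochner_Integration.integrable_bound[OF int], use le in \<open>auto simp: norm_power\<close>)+
qed

text \<open>The position after \<open>k\<close> steps depends only on the steps with index below
  \<open>k\<close>, a block disjoint from \<open>{k}\<close>.\<close>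

lemma indep_walk_step:
  assumes "k < N" and [measurable]: "\<phi> \<in> borel_measurable borel" "\<psi> \<in> borel_measurable borel"
  shows "indep_var borel (\<lambda>\<omega>. \<phi> (owalk \<theta> \<delta> z (\<lambda>i. \<xi> i \<omega>) k)) borel (\<lambda>\<omega>. \<psi> (\<xi> k \<omega>))"
proof -
  have "indep_var (PiM {..<k} (\<lambda>_. borel)) (\<lambda>\<omega>. restrict (\<lambda>i. \<xi> i \<omega>) {..<k})
      (PiM {k} (\<lambda>_. borel)) (\<lambda>\<omega>. restrict (\<lambda>i. \<xi> i \<omega>) {k})"
    by (rule indep_var_restrict[OF indep]) (use assms in auto)
  then have "indep_var borel ((\<lambda>s. \<phi> (owalk \<theta> \<delta> z s k)) \<circ> (\<lambda>\<omega>. restrict (\<lambda>i. \<xi> i \<omega>) {..<k}))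
      borel ((\<lambda>s. \<psi> (s k)) \<circ> (\<lambda>\<omega>. restrict (\<lambda>i. \<xi> i \<omega>) {k}))"
  proof (rule indep_var_compose)
    have [measurable]: "(\<lambda>s. owalk \<theta> \<delta> z s k) \<in> borel_measurable (PiM {..<k} (\<lambda>_. borel))"
      by (rule owalk_measurable[where N = k]) auto
    show "(\<lambda>s. \<phi> (owalk \<theta> \<delta> z s k)) \<in> borel_measurable (PiM {..<k} (\<lambda>_. borel))" by measurable
    show "(\<lambda>s. \<psi> (s k)) \<in> borel_measurable (PiM {k} (\<lambda>_. borel))"
      by (rule measurable_compose[OF measurable_component_singleton]) auto
  qed
  moreover have "owalk \<theta> \<delta> z (restrict (\<lambda>i. \<xi> i \<omega>) {..<k}) k = owalk \<theta> \<delta> z (\<lambda>i. \<xi> i \<omega>) k" for \<omega>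
    by (rule owalk_cong) simp
  ultimately show ?thesis by (simp add: comp_def)
qed

lemma walk_times_step:
  fixes \<phi> \<psi> :: "complex \<Rightarrow> complex"
  assumes "k < N" and [measurable]: "\<phi> \<in> borel_measurable borel" "\<psi> \<in> borel_measurable borel"
    and int: "integrable M (\<lambda>\<omega>. \<phi> (owalk \<theta> \<delta> z (\<lambda>i. \<xi> i \<omega>) k))" "integrable M (\<lambda>\<omega>. \<psi> (\<xi> k \<omega>))"
  shows "integrable M (\<lambda>\<omega>. \<phi> (owalk \<theta> \<delta> z (\<lambda>i. \<xi> i \<omega>) k) * \<psi> (\<xi> k \<omega>))"
    and "expectation (\<lambda>\<omega>. \<phi> (owalk \<theta> \<delta> z (\<lambda>i. \<xi> i \<omega>) k) * \<psi> (\<xi> k \<omega>))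
       = expectation (\<lambda>\<omega>. \<phi> (owalk \<theta> \<delta> z (\<lambda>i. \<xi> i \<omega>) k)) * expectation (\<lambda>\<omega>. \<psi> (\<xi> k \<omega>))"
  using indep_var_integrable[OF indep_walk_step[OF assms(1-3)] int]
    indep_var_lebesgue_integral[OF indep_walk_step[OF assms(1-3)] int] by auto

abbreviation walk :: "real \<Rightarrow> real \<Rightarrow> complex \<Rightarrow> nat \<Rightarrow> 'a \<Rightarrow> complex" where
  "walk \<theta> \<delta> z k \<omega> \<equiv> owalk \<theta> \<delta> z (\<lambda>i. \<xi> i \<omega>) k"

lemma walk_measurable [measurable]: "k \<le> N \<Longrightarrow> walk \<theta> \<delta> z k \<in> borel_measurable M"
  by (rule owalk_measurable[where N = N]) auto

section \<open>Second moment of the ordinate and total expected push\<close>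

text \<open>From |w|^2 <= h + |w|^4 / h and the fourth-moment bound; the 9 is 1 + 8.\<close>

lemma expectation_step_sq: "i < N \<Longrightarrow> expectation (\<lambda>\<omega>. norm (\<xi> i \<omega>) ^ 2) \<le> 9 * h"
proof -
  assume i: "i < N"
  have "norm w ^ 2 \<le> h + norm w ^ 4 / h" for w :: complex
  proof (cases "norm w ^ 2 \<le> h")
    case True
    moreover have "0 \<le> norm w ^ 4 / h" using h by simp
    ultimately show ?thesis by linarith
  next
    case False
    then have "h * norm w ^ 2 \<le> norm w ^ 2 * norm w ^ 2" by (intro mult_right_mono) auto
    also have "\<dots> = norm w ^ 4" by (simp add: power_add [symmetric])
    finally have "norm w ^ 2 \<le> norm w ^ 4 / h" using h by (simp add: field_simps)
    then show ?thesis using h by linarith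
  qed
  then have "expectation (\<lambda>\<omega>. norm (\<xi> i \<omega>) ^ 2) \<le> expectation (\<lambda>\<omega>. h + norm (\<xi> i \<omega>) ^ 4 / h)"
    using i moment4 integrable_step_power(1)[of i 2] by (intro integral_mono) auto
  also have "\<dots> = h + expectation (\<lambda>\<omega>. norm (\<xi> i \<omega>) ^ 4) / h"
    using i moment4 prob_space by simp
  also have "\<dots> \<le> h + 8 * h\<^sup>2 / h" using i moment4 h by (intro add_left_mono divide_right_mono) auto
  also have "\<dots> = 9 * h" using h by (simp add: power2_eq_square)
  finally show ?thesis .
qed

lemma expectation_walk_times_Im_step:
  fixes \<phi> :: "complex \<Rightarrow> real"
  assumes "k < N" and [measurable]: "\<phi> \<in> borel_measurable borel"
    and "integrable M (\<lambda>\<omega>. \<phi> (walk \<theta> \<delta> z k \<omega>))"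
  shows "integrable M (\<lambda>\<omega>. \<phi> (walk \<theta> \<delta> z k \<omega>) * Im (\<xi> k \<omega>))"
    and "expectation (\<lambda>\<omega>. \<phi> (walk \<theta> \<delta> z k \<omega>) * Im (\<xi> k \<omega>)) = 0"
proof -
  let ?f = "\<lambda>\<omega>. of_real (\<phi> (walk \<theta> \<delta> z k \<omega>)) * \<xi> k \<omega>"
  have \<xi>: "integrable M (\<xi> k)" "expectation (\<xi> k) = 0"
    using integrable_step_power(2)[of k 1] moment[of k 1] assms by auto
  have \<phi>: "(\<lambda>z. complex_of_real (\<phi> z)) \<in> borel_measurable borel" by measurable
  have \<phi>': "integrable M (\<lambda>\<omega>. complex_of_real (\<phi> (walk \<theta> \<delta> z k \<omega>)))" using assms(3) by simp
  note * = walk_times_step[OF assms(1) \<phi> measurable_ident_sets[OF refl] \<phi>' \<xi>(1)]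
  have int: "integrable M ?f" by (rule *(1))
  have E: "expectation ?f = 0" using *(2) unfolding \<xi>(2) by (simp only: mult_zero_right)
  show "integrable M (\<lambda>\<omega>. \<phi> (walk \<theta> \<delta> z k \<omega>) * Im (\<xi> k \<omega>))"
    using integrable_Im[OF int] by simp
  show "expectation (\<lambda>\<omega>. \<phi> (walk \<theta> \<delta> z k \<omega>) * Im (\<xi> k \<omega>)) = 0"
    using integral_Im[OF int] E by simp
qed

text \<open>The push replaces the ordinate by its positive part, which cannot increase its square.
  The indicator switches the cross term off once the walk is stopped.\<close>

lemma Im_walk_Suc_sq:
  "(Im (walk \<theta> \<delta> z (Suc k) \<omega>))\<^sup>2 \<le> (Im (walk \<theta> \<delta> z k \<omega>))\<^sup>2
     + 2 * ((indicator {u. \<delta> < Re u} (walk \<theta> \<delta> z k \<omega>) * Im (walk \<theta> \<delta> z k \<omega>)) * Im (\<xi> k \<omega>)) + norm (\<xi> k \<omega>) ^ 2"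
proof -
  have *: "(Im (ostep \<theta> u w))\<^sup>2 \<le> (Im u)\<^sup>2 + 2 * (Im u * Im w) + norm w ^ 2" for u w
  proof -
    have "(Im (ostep \<theta> u w))\<^sup>2 \<le> (Im u + Im w)\<^sup>2"
      by (auto simp: Im_ostep push_def max_def)
    also have "\<dots> = (Im u)\<^sup>2 + 2 * (Im u * Im w) + (Im w)\<^sup>2" by (simp add: power2_sum)
    also have "(Im w)\<^sup>2 \<le> norm w ^ 2" by (simp add: cmod_power2)
    finally show ?thesis by simp
  qed
  show ?thesis using *[of "walk \<theta> \<delta> z k \<omega>" "\<xi> k \<omega>"] by (auto simp: indicator_def)
qed

text \<open>The cross term of \<open>Im_walk_Suc_sq\<close> has mean zero, so each step adds at most
  9 * h.\<close>

lemma walk_Im_sq: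
  assumes "k \<le> N"
  shows "integrable M (\<lambda>\<omega>. (Im (walk \<theta> \<delta> z k \<omega>))\<^sup>2)
    \<and> expectation (\<lambda>\<omega>. (Im (walk \<theta> \<delta> z k \<omega>))\<^sup>2) \<le> (Im z)\<^sup>2 + 9 * h * k"
  using assms
proof (induction k)
  case 0
  then show ?case by (simp add: prob_space)
next
  case (Suc k)
  then have k: "k < N" by simp
  let ?W = "walk \<theta> \<delta> z k"
  let ?\<phi> = "\<lambda>u. indicator {u. \<delta> < Re u} u * Im u :: real"
  have [measurable]: "?W \<in> borel_measurable M" "walk \<theta> \<delta> z (Suc k) \<in> borel_measurable M" "\<xi> k \<in> borel_measurable M"
    using k by (auto simp del: owalk.simps)
  from Suc k have IH: "integrable M (\<lambda>\<omega>. (Im (?W \<omega>))\<^sup>2)"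
    "expectation (\<lambda>\<omega>. (Im (?W \<omega>))\<^sup>2) \<le> (Im z)\<^sup>2 + 9 * h * k" by auto
  have int1: "integrable M (\<lambda>\<omega>. ?\<phi> (?W \<omega>))"
  proof (rule Bochner_Integration.integrable_bound)
    show "integrable M (\<lambda>\<omega>. 1 + (Im (?W \<omega>))\<^sup>2)" using IH by simp
    have "\<bar>y\<bar> \<le> 1 + y\<^sup>2" for y :: real
      using zero_le_power2[of "\<bar>y\<bar> - 1"] zero_le_power2[of y] by (simp add: power2_diff)
    then show "AE \<omega> in M. norm (?\<phi> (?W \<omega>)) \<le> norm (1 + (Im (?W \<omega>))\<^sup>2)"
      by (intro AE_I2) (auto simp: indicator_def)
  qed measurable
  have \<phi>: "?\<phi> \<in> borel_measurable borel" by measurable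
  note cross = expectation_walk_times_Im_step[where \<phi> = ?\<phi>, OF k \<phi> int1]
  have sq: "integrable M (\<lambda>\<omega>. norm (\<xi> k \<omega>) ^ 2)" using integrable_step_power(1)[of k 2] k by simp
  let ?B = "\<lambda>\<omega>. (Im (?W \<omega>))\<^sup>2 + 2 * (?\<phi> (?W \<omega>) * Im (\<xi> k \<omega>)) + norm (\<xi> k \<omega>) ^ 2"
  have intB: "integrable M ?B" 
    by (intro Bochner_Integration.integrable_add integrable_mult_right IH(1) cross(1) sq)
  have int: "integrable M (\<lambda>\<omega>. (Im (walk \<theta> \<delta> z (Suc k) \<omega>))\<^sup>2)"
  proof (rule Bochner_Integration.integrable_bound[OF intB])
    show "AE \<omega> in M. norm ((Im (walk \<theta> \<delta> z (Suc k) \<omega>))\<^sup>2) \<le> norm (?B \<omega>)"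
    proof (intro AE_I2)
      fix \<omega>
      show "norm ((Im (walk \<theta> \<delta> z (Suc k) \<omega>))\<^sup>2) \<le> norm (?B \<omega>)"
        using order_trans[OF Im_walk_Suc_sq abs_ge_self] by (simp del: owalk.simps)
    qed
  qed measurable
  have "expectation (\<lambda>\<omega>. (Im (walk \<theta> \<delta> z (Suc k) \<omega>))\<^sup>2) \<le> expectation ?B"
    by (rule integral_mono[OF int intB Im_walk_Suc_sq])
  also have "\<dots> = expectation (\<lambda>\<omega>. (Im (?W \<omega>))\<^sup>2) + 2 * expectation (\<lambda>\<omega>. ?\<phi> (?W \<omega>) * Im (\<xi> k \<omega>))
       + expectation (\<lambda>\<omega>. norm (\<xi> k \<omega>) ^ 2)"
    using IH(1) cross(1) sq by (simp del: owalk.simps)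
  also have "\<dots> \<le> (Im z)\<^sup>2 + 9 * h * k + 9 * h"
    using IH cross(2) expectation_step_sq[OF k] by simp
  finally show ?case using int by (simp add: algebra_simps del: owalk.simps)
qed

end

context isotropic_steps
begin

text \<open>While the walk runs, the change of its ordinate is the imaginary part of the step plus
  the push, and the former has mean zero.\<close>

lemma expectation_push:
  assumes z: "0 \<le> Im z" and k: "k < N"
  shows "integrable M (\<lambda>\<omega>. indicator {u. \<delta> < Re u} (walk \<theta> \<delta> z k \<omega>) * push (walk \<theta> \<delta> z k \<omega> + \<xi> k \<omega>))"
    and "expectation (\<lambda>\<omega>. indicator {u. \<delta> < Re u} (walk \<theta> \<delta> z k \<omega>) * push (walk \<theta> \<delta> z k \<omega> + \<xi> k \<omega>))
      = expectation (\<lambda>\<omega>. Im (walk \<theta> \<delta> z (Suc k) \<omega>)) - expectation (\<lambda>\<omega>. Im (walk \<theta> \<delta> z k \<omega>))"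
proof -
  let ?I = "\<lambda>u. indicator {u. \<delta> < Re u} u :: real"
  have IM: "integrable M (\<lambda>\<omega>. Im (walk \<theta> \<delta> z j \<omega>))" if "j \<le> N" for j
    by (rule square_integrable_imp_integrable) (use that walk_Im_sq[OF that] in auto)
  have \<phi>: "?I \<in> borel_measurable borel" by measurable
  have [measurable]: "walk \<theta> \<delta> z k \<in> borel_measurable M" using k by simp
  have int1: "integrable M (\<lambda>\<omega>. ?I (walk \<theta> \<delta> z k \<omega>))"
    by (rule integrable_const_bound[where B = 1]) (auto simp: indicator_def)
  note cross = expectation_walk_times_Im_step[where \<phi> = ?I, OF k \<phi> int1]
  have eq: "?I (walk \<theta> \<delta> z k \<omega>) * push (walk \<theta> \<delta> z k \<omega> + \<xi> k \<omega>)
      = Im (walk \<theta> \<delta> z (Suc k) \<omega>) - Im (walk \<theta> \<delta> z k \<omega>) - ?I (walk \<theta> \<delta> z k \<omega>) * Im (\<xi> k \<omega>)" for \<omega>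
    by (simp add: Im_ostep indicator_def)
  have I: "integrable M (\<lambda>\<omega>. Im (walk \<theta> \<delta> z (Suc k) \<omega>))" "integrable M (\<lambda>\<omega>. Im (walk \<theta> \<delta> z k \<omega>))"
    using IM k Suc_leI[OF k] less_imp_le by blast+
  show "integrable M (\<lambda>\<omega>. ?I (walk \<theta> \<delta> z k \<omega>) * push (walk \<theta> \<delta> z k \<omega> + \<xi> k \<omega>))"
    unfolding eq by (intro Bochner_Integration.integrable_diff I cross(1))
  have "expectation (\<lambda>\<omega>. ?I (walk \<theta> \<delta> z k \<omega>) * push (walk \<theta> \<delta> z k \<omega> + \<xi> k \<omega>))
      = expectation (\<lambda>\<omega>. Im (walk \<theta> \<delta> z (Suc k) \<omega>) - Im (walk \<theta> \<delta> z k \<omega>)) - expectation (\<lambda>\<omega>. ?I (walk \<theta> \<delta> z k \<omega>) * Im (\<xi> k \<omega>))"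
    unfolding eq by (intro Bochner_Integration.integral_diff Bochner_Integration.integrable_diff I cross(1))
  also have "\<dots> = expectation (\<lambda>\<omega>. Im (walk \<theta> \<delta> z (Suc k) \<omega>)) - expectation (\<lambda>\<omega>. Im (walk \<theta> \<delta> z k \<omega>))"
    unfolding cross(2) using I by (simp del: owalk.simps)
  finally show "expectation (\<lambda>\<omega>. ?I (walk \<theta> \<delta> z k \<omega>) * push (walk \<theta> \<delta> z k \<omega> + \<xi> k \<omega>))
      = expectation (\<lambda>\<omega>. Im (walk \<theta> \<delta> z (Suc k) \<omega>)) - expectation (\<lambda>\<omega>. Im (walk \<theta> \<delta> z k \<omega>))" .
qed

text \<open>The sum telescopes to the mean final ordinate, which is at most 1 plus the second
  moment. Since h * N is the time horizon, the bound does not deteriorate as the grid is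
  refined.\<close>

lemma sum_expectation_push_le:
  assumes "Im z = 0"
  shows "(\<Sum>k<N. expectation (\<lambda>\<omega>. indicator {u. \<delta> < Re u} (walk \<theta> \<delta> z k \<omega>) * push (walk \<theta> \<delta> z k \<omega> + \<xi> k \<omega>)))
     \<le> 1 + 9 * h * N"
proof -
  have "(\<Sum>k<N. expectation (\<lambda>\<omega>. indicator {u. \<delta> < Re u} (walk \<theta> \<delta> z k \<omega>) * push (walk \<theta> \<delta> z k \<omega> + \<xi> k \<omega>)))
    = (\<Sum>k<N. expectation (\<lambda>\<omega>. Im (walk \<theta> \<delta> z (Suc k) \<omega>)) - expectation (\<lambda>\<omega>. Im (walk \<theta> \<delta> z k \<omega>)))"
    using assms by (intro sum.cong refl expectation_push) auto
  also have "\<dots> = expectation (\<lambda>\<omega>. Im (walk \<theta> \<delta> z N \<omega>)) - expectation (\<lambda>\<omega>. Im (walk \<theta> \<delta> z 0 \<omega>))"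
    by (rule sum_lessThan_telescope)
  also have "\<dots> = expectation (\<lambda>\<omega>. Im (walk \<theta> \<delta> z N \<omega>))" using assms by simp
  also have "\<dots> \<le> expectation (\<lambda>\<omega>. 1 + (Im (walk \<theta> \<delta> z N \<omega>))\<^sup>2)"
  proof (rule integral_mono)
    show "integrable M (\<lambda>\<omega>. Im (walk \<theta> \<delta> z N \<omega>))"
      by (rule square_integrable_imp_integrable) (use walk_Im_sq[of N] in auto)
    show "integrable M (\<lambda>\<omega>. 1 + (Im (walk \<theta> \<delta> z N \<omega>))\<^sup>2)"
      using walk_Im_sq[of N \<theta> \<delta> z] by simp
    fix \<omega>
    show "Im (walk \<theta> \<delta> z N \<omega>) \<le> 1 + (Im (walk \<theta> \<delta> z N \<omega>))\<^sup>2"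
      using sum_squares_bound[of "Im (walk \<theta> \<delta> z N \<omega>)" 1] zero_le_power2[of "Im (walk \<theta> \<delta> z N \<omega>)"]
      by (simp only: power_one mult_1_right)
  qed
  also have "\<dots> = 1 + expectation (\<lambda>\<omega>. (Im (walk \<theta> \<delta> z N \<omega>))\<^sup>2)"
    using walk_Im_sq[of N \<theta> \<delta> z] by (simp add: prob_space)
  also have "\<dots> \<le> 1 + 9 * h * N"
    using walk_Im_sq[of N \<theta> \<delta> z] assms by simp
  finally show ?thesis .
qed

lemma indicator_powr_deriv_measurable:
  assumes "0 < \<delta>"
  shows "(\<lambda>z. indicator {u. \<delta> < Re u} z * powr_deriv a j z) \<in> borel_measurable borel"
    and "(\<lambda>z. indicator {u. \<delta> < Re u} z * powr_deriv a j (cnj z)) \<in> borel_measurable borel"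
proof -
  note m = powr_Re_ge_measurable[OF assms, of "a - of_nat j"]
  have m': "(\<lambda>z. if cnj z \<in> {z. \<delta> \<le> Re z} then cnj z powr (a - of_nat j) else 0) \<in> borel_measurable borel"
    by (rule measurable_compose[OF _ m]) (auto intro!: borel_measurable_continuous_onI continuous_intros)
  note [measurable] = m m'
  have eq: "(\<lambda>z. indicator {u. \<delta> < Re u} z * powr_deriv a j z) =
    (\<lambda>z. indicator {u. \<delta> < Re u} z * (falling a j * (if z \<in> {z. \<delta> \<le> Re z} then z powr (a - of_nat j) else 0)))"
    "(\<lambda>z. indicator {u. \<delta> < Re u} z * powr_deriv a j (cnj z)) =
    (\<lambda>z. indicator {u. \<delta> < Re u} z * (falling a j * (if cnj z \<in> {z. \<delta> \<le> Re z} then cnj z powr (a - of_nat j) else 0)))"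
    by (auto simp: powr_deriv_def indicator_def fun_eq_iff)
  show "(\<lambda>z. indicator {u. \<delta> < Re u} z * powr_deriv a j z) \<in> borel_measurable borel"
    unfolding eq by measurable
  show "(\<lambda>z. indicator {u. \<delta> < Re u} z * powr_deriv a j (cnj z)) \<in> borel_measurable borel"
    unfolding eq by measurable
qed

text \<open>Each summand is a function of the current position times a power of the next step or of
  its conjugate. Independence factors the mean and the moments 1 to 3 vanish; the indicator confines
  the position to a region where the derivatives are bounded.\<close>

lemma expectation_oblique_lin:
  assumes "Re a \<le> 0" "0 < \<delta>" and k: "k < N"
  shows "integrable M (\<lambda>\<omega>. indicator {u. \<delta> < Re u} (walk \<theta> \<delta> z k \<omega>) * oblique_lin \<theta>' a (walk \<theta> \<delta> z k \<omega>) (\<xi> k \<omega>))"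
    and "expectation (\<lambda>\<omega>. indicator {u. \<delta> < Re u} (walk \<theta> \<delta> z k \<omega>) * oblique_lin \<theta>' a (walk \<theta> \<delta> z k \<omega>) (\<xi> k \<omega>)) = 0"
proof -
  let ?W = "walk \<theta> \<delta> z k"
  let ?I = "\<lambda>u. indicator {u. \<delta> < Re u} u :: complex"
  let ?f = "\<lambda>j u. ?I u * powr_deriv a j u"
  let ?g = "\<lambda>j u. ?I u * powr_deriv a j (cnj u)"
  have [measurable]: "?W \<in> borel_measurable M" using k by simp
  have B: "integrable M (\<lambda>\<omega>. ?f j (?W \<omega>)) \<and> integrable M (\<lambda>\<omega>. ?g j (?W \<omega>))" for j
  proof -
    obtain B where B: "0 \<le> B" "\<And>z. \<delta> \<le> Re z \<Longrightarrow> norm (powr_deriv a j z) \<le> B"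
      using norm_powr_deriv_bounded[OF assms(1,2)] by blast
    have "norm (?f j u) \<le> B" "norm (?g j u) \<le> B" for u
      using B(2)[of u] B(2)[of "cnj u"] B(1) by (auto simp: indicator_def norm_mult)
    then show ?thesis
      by (intro conjI integrable_const_bound[where B = B] AE_I2
        measurable_compose[OF _ indicator_powr_deriv_measurable(1)[OF assms(2)]]
        measurable_compose[OF _ indicator_powr_deriv_measurable(2)[OF assms(2)]]) auto
  qed
  have pw: "(\<lambda>w :: complex. w ^ j) \<in> borel_measurable borel" "(\<lambda>w. cnj w ^ j) \<in> borel_measurable borel" for j
    by (auto intro!: borel_measurable_continuous_onI continuous_intros)
  have \<xi>: "integrable M (\<lambda>\<omega>. \<xi> k \<omega> ^ j)" "integrable M (\<lambda>\<omega>. cnj (\<xi> k \<omega>) ^ j)"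
    "expectation (\<lambda>\<omega>. \<xi> k \<omega> ^ j) = 0" "expectation (\<lambda>\<omega>. cnj (\<xi> k \<omega>) ^ j) = 0" if "j \<in> {1..3}" for j
  proof -
    show 1: "integrable M (\<lambda>\<omega>. \<xi> k \<omega> ^ j)" "expectation (\<lambda>\<omega>. \<xi> k \<omega> ^ j) = 0"
      using integrable_step_power(2)[OF k, of j] moment[OF k that] that by auto
    show "integrable M (\<lambda>\<omega>. cnj (\<xi> k \<omega>) ^ j)"
      using 1(1) unfolding complex_cnj_power [symmetric] by (simp only: integrable_cnj)
    show "expectation (\<lambda>\<omega>. cnj (\<xi> k \<omega>) ^ j) = 0"
      using integral_bounded_linear[OF bounded_linear_cnj 1(1)] 1(2) by simp
  qed
  have 1: "integrable M (\<lambda>\<omega>. ?f j (?W \<omega>) * \<xi> k \<omega> ^ j)" "expectation (\<lambda>\<omega>. ?f j (?W \<omega>) * \<xi> k \<omega> ^ j) = 0"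
    if "j \<in> {1..3}" for j
    using walk_times_step[where \<phi> = "?f j" and \<psi> = "\<lambda>w. w ^ j", OF k indicator_powr_deriv_measurable(1)[OF assms(2)] pw(1)
        conjunct1[OF B] \<xi>(1)[OF that]] unfolding \<xi>(3)[OF that] mult_zero_right by blast+
  have 2: "integrable M (\<lambda>\<omega>. ?g j (?W \<omega>) * cnj (\<xi> k \<omega>) ^ j)" "expectation (\<lambda>\<omega>. ?g j (?W \<omega>) * cnj (\<xi> k \<omega>) ^ j) = 0"
    if "j \<in> {1..3}" for j
    using walk_times_step[where \<phi> = "?g j" and \<psi> = "\<lambda>w. cnj w ^ j", OF k indicator_powr_deriv_measurable(2)[OF assms(2)] pw(2)
        conjunct2[OF B] \<xi>(2)[OF that]] unfolding \<xi>(4)[OF that] mult_zero_right by blast+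
  have eq: "?I u * oblique_lin \<theta>' a u w = (\<Sum>j\<in>{1..3}. (cis (-\<theta>') / fact j / 2) * (?f j u * w ^ j))
     + (\<Sum>j\<in>{1..3}. (cis \<theta>' / fact j / 2) * (?g j u * cnj w ^ j))" for u w
    by (simp add: oblique_lin_def sum_distrib_left add_divide_distrib sum_divide_distrib distrib_left mult_ac)
  show "integrable M (\<lambda>\<omega>. ?I (?W \<omega>) * oblique_lin \<theta>' a (?W \<omega>) (\<xi> k \<omega>))"
    unfolding eq by (intro Bochner_Integration.integrable_add Bochner_Integration.integrable_sum integrable_mult_right 1 2)
  have A1: "integrable M (\<lambda>\<omega>. \<Sum>j\<in>{1..3}. (cis (-\<theta>') / fact j / 2) * (?f j (?W \<omega>) * \<xi> k \<omega> ^ j))"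
    by (intro Bochner_Integration.integrable_sum integrable_mult_right 1)
  have A2: "expectation (\<lambda>\<omega>. \<Sum>j\<in>{1..3}. (cis (-\<theta>') / fact j / 2) * (?f j (?W \<omega>) * \<xi> k \<omega> ^ j)) = 0"
    by (subst Bochner_Integration.integral_sum, intro integrable_mult_right 1, assumption,
        rule sum.neutral, rule ballI, subst integral_mult_right_zero, subst 1(2), assumption, rule mult_zero_right)
  have B1: "integrable M (\<lambda>\<omega>. \<Sum>j\<in>{1..3}. (cis \<theta>' / fact j / 2) * (?g j (?W \<omega>) * cnj (\<xi> k \<omega>) ^ j))"
    by (intro Bochner_Integration.integrable_sum integrable_mult_right 2)
  have B2: "expectation (\<lambda>\<omega>. \<Sum>j\<in>{1..3}. (cis \<theta>' / fact j / 2) * (?g j (?W \<omega>) * cnj (\<xi> k \<omega>) ^ j)) = 0"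
    by (subst Bochner_Integration.integral_sum, intro integrable_mult_right 2, assumption,
        rule sum.neutral, rule ballI, subst integral_mult_right_zero, subst 2(2), assumption, rule mult_zero_right)
  show "expectation (\<lambda>\<omega>. ?I (?W \<omega>) * oblique_lin \<theta>' a (?W \<omega>) (\<xi> k \<omega>)) = 0"
    unfolding eq Bochner_Integration.integral_add[OF A1 B1] A2 B2 by simp
qed

text \<open>
  The squared push is bounded by \<open>\<mu> * push + |\<xi>|\<^sup>4 / \<mu>\<^sup>2\<close>, and the expected pushes telescope.
\<close>

lemma expectation_clamped_walk:
  assumes a: "Re a \<le> 0" and \<kappa>: "0 < \<kappa>" "\<kappa> < \<delta>" and z: "Im z = 0" and \<mu>: "0 < \<mu>" and K: "0 \<le> K"
    and T: "\<And>z w. \<lbrakk>\<delta> \<le> Re z; 0 \<le> Im z\<rbrakk> \<Longrightarrow>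
       norm (clamped \<kappa> \<theta> a (ostep \<theta> z w) - clamped \<kappa> \<theta> a z - oblique_lin \<theta> a z w)
         \<le> K * (norm w ^ 4 + (push (z + w))\<^sup>2)"
  shows "norm (expectation (\<lambda>\<omega>. clamped \<kappa> \<theta> a (walk \<theta> \<delta> z N \<omega>)) - clamped \<kappa> \<theta> a z)
     \<le> K * (8 * N * h\<^sup>2 * (1 + 1 / \<mu>\<^sup>2) + \<mu> * (1 + 9 * h * N))"
proof -
  let ?F = "clamped \<kappa> \<theta> a" and ?W = "walk \<theta> \<delta> z"
  let ?I = "\<lambda>u. indicator {u. \<delta> < Re u} u"
  let ?p = "\<lambda>k. expectation (\<lambda>\<omega>. ?I (?W k \<omega>) * push (?W k \<omega> + \<xi> k \<omega>))"
  obtain C where C: "0 \<le> C" "\<And>z. norm (?F z) \<le> C"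
    using norm_clamped_bounded[OF a \<kappa>(1)] by blast
  note [measurable] = clamped_measurable[OF \<kappa>(1)]
  have intF: "integrable M (\<lambda>\<omega>. ?F (?W k \<omega>))" if "k \<le> N" for k
    using C that by (intro integrable_const_bound[where B = C]) (auto intro: measurable_compose[OF walk_measurable])
  have one: "norm (expectation (\<lambda>\<omega>. ?F (?W (Suc k) \<omega>)) - expectation (\<lambda>\<omega>. ?F (?W k \<omega>)))
      \<le> K * (8 * h\<^sup>2 * (1 + 1 / \<mu>\<^sup>2) + \<mu> * ?p k)" if k: "k < N" for k
  proof -
    let ?lin = "\<lambda>\<omega>. ?I (?W k \<omega>) * oblique_lin \<theta> a (?W k \<omega>) (\<xi> k \<omega>)"
    let ?R = "\<lambda>\<omega>. ?F (?W (Suc k) \<omega>) - ?F (?W k \<omega>) - ?lin \<omega>"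
    let ?b = "\<lambda>\<omega>. K * (norm (\<xi> k \<omega>) ^ 4 * (1 + 1 / \<mu>\<^sup>2) + \<mu> * (?I (?W k \<omega>) * push (?W k \<omega> + \<xi> k \<omega>)))"
    have I: "integrable M (\<lambda>\<omega>. ?F (?W (Suc k) \<omega>))" "integrable M (\<lambda>\<omega>. ?F (?W k \<omega>))"
      using intF Suc_leI[OF k] k less_imp_le by blast+
    note lin = expectation_oblique_lin[OF a _ k, of \<delta> \<theta> z \<theta>]
    have lin: "integrable M ?lin" "expectation ?lin = 0" using lin \<kappa> by auto
    have push: "integrable M (\<lambda>\<omega>. ?I (?W k \<omega>) * push (?W k \<omega> + \<xi> k \<omega>))"
      using expectation_push(1)[OF _ k] z by simp
    have intb: "integrable M ?b"
      by (intro integrable_mult_right Bochner_Integration.integrable_add integrable_mult_left push moment4(1) k)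
    have le: "norm (?R \<omega>) \<le> ?b \<omega>" for \<omega>
    proof (cases "\<delta> < Re (?W k \<omega>)")
      \<comment> \<open>The walk is already stopped, so the left-hand side is 0.\<close>
      case False
      then show ?thesis using K \<mu> by (simp add: indicator_def)
    next
      case True
      let ?s = "push (?W k \<omega> + \<xi> k \<omega>)"
      have im: "0 \<le> Im (?W k \<omega>)" using z by (intro Im_owalk_nonneg) simp
      have "?s\<^sup>2 \<le> \<mu> * ?s + norm (\<xi> k \<omega>) ^ 4 / \<mu>\<^sup>2"
      \<comment> \<open>A push beyond \<open>\<mu>\<close> satisfies push^2 <= push^4 / \<mu>^2, and
        the push is at most |\<xi>| because the walk was in the upper half-plane.\<close>
      proof (cases "?s \<le> \<mu>")
        case True
        have "?s\<^sup>2 \<le> \<mu> * ?s" using True by (simp add: power2_eq_square mult_right_mono)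
        moreover have "0 \<le> norm (\<xi> k \<omega>) ^ 4 / \<mu>\<^sup>2" by simp
        ultimately show ?thesis by linarith
      next
        case False
        have "\<mu>\<^sup>2 * ?s\<^sup>2 \<le> ?s\<^sup>2 * ?s\<^sup>2" using False \<mu> by (intro mult_right_mono power_mono) auto
        also have "\<dots> = ?s ^ 4" by (simp add: power_add [symmetric])
        also have "\<dots> \<le> norm (\<xi> k \<omega>) ^ 4" using push_le[OF im] by (intro power_mono) auto
        finally have "?s\<^sup>2 \<le> norm (\<xi> k \<omega>) ^ 4 / \<mu>\<^sup>2" using \<mu> by (simp add: field_simps)
        moreover have "0 \<le> \<mu> * ?s" using \<mu> by simp
        ultimately show ?thesis by linarith
      qed
      then have "K * (norm (\<xi> k \<omega>) ^ 4 + ?s\<^sup>2) \<le> K * (norm (\<xi> k \<omega>) ^ 4 + (\<mu> * ?s + norm (\<xi> k \<omega>) ^ 4 / \<mu>\<^sup>2))"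
        using K by (intro mult_left_mono add_left_mono)
      then have "norm (?F (ostep \<theta> (?W k \<omega>) (\<xi> k \<omega>)) - ?F (?W k \<omega>) - oblique_lin \<theta> a (?W k \<omega>) (\<xi> k \<omega>))
         \<le> K * (norm (\<xi> k \<omega>) ^ 4 + (\<mu> * ?s + norm (\<xi> k \<omega>) ^ 4 / \<mu>\<^sup>2))"
        using T[OF less_imp_le[OF True] im, of "\<xi> k \<omega>"] by linarith
      then show ?thesis using True by (simp add: indicator_def algebra_simps)
    qed
    have "expectation ?R = expectation (\<lambda>\<omega>. ?F (?W (Suc k) \<omega>)) - expectation (\<lambda>\<omega>. ?F (?W k \<omega>)) - expectation ?lin"
      using I lin(1) by (simp del: owalk.simps)
    then have "norm (expectation (\<lambda>\<omega>. ?F (?W (Suc k) \<omega>)) - expectation (\<lambda>\<omega>. ?F (?W k \<omega>))) = norm (expectation ?R)"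
      unfolding lin(2) by simp
    also have "\<dots> \<le> expectation (\<lambda>\<omega>. norm (?R \<omega>))" by (rule integral_norm_bound)
    also have "\<dots> \<le> expectation ?b"
      using I lin(1) le by (intro integral_mono intb integrable_norm Bochner_Integration.integrable_diff)
    also have "\<dots> = K * (expectation (\<lambda>\<omega>. norm (\<xi> k \<omega>) ^ 4) * (1 + 1 / \<mu>\<^sup>2) + \<mu> * ?p k)"
      by (subst integral_mult_right_zero, subst Bochner_Integration.integral_add,
          intro integrable_mult_left moment4(1) k, intro integrable_mult_right push,
          simp only: integral_mult_right_zero integral_mult_left_zero)
    also have "\<dots> \<le> K * (8 * h\<^sup>2 * (1 + 1 / \<mu>\<^sup>2) + \<mu> * ?p k)"
      using moment4(2)[OF k] K by (intro mult_left_mono add_right_mono mult_right_mono) auto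
    finally show ?thesis .
  qed
  have "norm (expectation (\<lambda>\<omega>. ?F (?W N \<omega>)) - ?F z)
     = norm (\<Sum>k<N. expectation (\<lambda>\<omega>. ?F (?W (Suc k) \<omega>)) - expectation (\<lambda>\<omega>. ?F (?W k \<omega>)))"
    by (subst sum_lessThan_telescope) (simp add: prob_space)
  also have "\<dots> \<le> (\<Sum>k<N. K * (8 * h\<^sup>2 * (1 + 1 / \<mu>\<^sup>2) + \<mu> * ?p k))"
    using one by (intro sum_norm_le) auto
  also have "\<dots> = K * (8 * N * h\<^sup>2 * (1 + 1 / \<mu>\<^sup>2) + \<mu> * (\<Sum>k<N. ?p k))"
    by (simp add: sum_distrib_left [symmetric] sum.distrib algebra_simps)
  also have "\<dots> \<le> K * (8 * N * h\<^sup>2 * (1 + 1 / \<mu>\<^sup>2) + \<mu> * (1 + 9 * h * N))"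
    using sum_expectation_push_le[OF z] K \<mu> by (intro mult_left_mono add_left_mono) auto
  finally show ?thesis .
qed

end

section \<open>Brownian increments\<close>

lemma (in prob_space) indep_var_of_distr_pair:
  assumes [measurable]: "U \<in> borel_measurable M" "V \<in> borel_measurable M"
    and D: "prob_space D1" "prob_space D2" "sets D1 = sets borel" "sets D2 = sets borel"
    and eq: "distr M (borel \<Otimes>\<^sub>M borel) (\<lambda>\<omega>. (U \<omega>, V \<omega>)) = D1 \<Otimes>\<^sub>M D2"
  shows "distr M borel U = D1" "distr M borel V = D2" "indep_var borel U borel V"
proof -
  interpret D1: prob_space D1 by fact
  interpret D2: prob_space D2 by fact
  have sp: "space D1 = UNIV" "space D2 = UNIV"
    using D sets_eq_imp_space_eq[OF D(3)] sets_eq_imp_space_eq[OF D(4)] by auto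
  show 1: "distr M borel U = D1"
  proof (rule measure_eqI)
    fix A assume "A \<in> sets (distr M borel U)"
    then have A: "A \<in> sets borel" by simp
    have "emeasure (distr M borel U) A = emeasure (distr M (borel \<Otimes>\<^sub>M borel) (\<lambda>\<omega>. (U \<omega>, V \<omega>))) (A \<times> UNIV)"
      using A by (subst (1 2) emeasure_distr) (auto intro!: arg_cong[where f = "emeasure M"])
    also have "\<dots> = emeasure D1 A"
      unfolding eq using A D sp D2.emeasure_space_1 by (subst D2.emeasure_pair_measure_Times) auto
    finally show "emeasure (distr M borel U) A = emeasure D1 A" .
  qed (simp add: D)
  show 2: "distr M borel V = D2"
  proof (rule measure_eqI)
    fix A assume "A \<in> sets (distr M borel V)"
    then have A: "A \<in> sets borel" by simp
    have "emeasure (distr M borel V) A = emeasure (distr M (borel \<Otimes>\<^sub>M borel) (\<lambda>\<omega>. (U \<omega>, V \<omega>))) (UNIV \<times> A)"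
      using A by (subst (1 2) emeasure_distr) (auto intro!: arg_cong[where f = "emeasure M"])
    also have "\<dots> = emeasure D2 A"
      unfolding eq using A D sp D1.emeasure_space_1 by (subst D2.emeasure_pair_measure_Times) auto
    finally show "emeasure (distr M borel V) A = emeasure D2 A" .
  qed (simp add: D)
  show "indep_var borel U borel V"
    unfolding indep_var_distribution_eq 1 2 eq by simp
qed

text \<open>Written out over the two basis vectors, the density is a product of one-dimensional
  normal densities, so the joint law is a product measure.\<close>

lemma (in prob_space) planar_gaussian_coordinates:
  fixes U V :: "'a \<Rightarrow> real"
  assumes s: "0 < s"
    and D: "distributed M lborel (\<lambda>\<omega>. (U \<omega>, V \<omega>))
          (\<lambda>v. ennreal (\<Prod>b\<in>Basis. normal_density 0 s (v \<bullet> b)))"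
  shows "distributed M lborel U (\<lambda>x. ennreal (normal_density 0 s x))"
    "distributed M lborel V (\<lambda>x. ennreal (normal_density 0 s x))"
    "indep_var borel U borel V"
proof -
  let ?\<phi> = "\<lambda>x. ennreal (normal_density 0 s x)"
  let ?D = "density lborel ?\<phi>"
  interpret N: prob_space ?D by (rule prob_space_normal_density[OF s])
  have pair: "(\<lambda>\<omega>. (U \<omega>, V \<omega>)) \<in> borel_measurable M"
    using distributed_measurable[OF D] by simp
  have [measurable]: "U \<in> borel_measurable M" "V \<in> borel_measurable M"
    using measurable_compose[OF pair, of fst borel] measurable_compose[OF pair, of snd borel]
    by (auto simp: borel_prod [symmetric])
  have bp: "(borel \<Otimes>\<^sub>M borel :: (real \<times> real) measure) = borel" by (rule borel_prod)
  have "distr M (borel \<Otimes>\<^sub>M borel) (\<lambda>\<omega>. (U \<omega>, V \<omega>)) = distr M lborel (\<lambda>\<omega>. (U \<omega>, V \<omega>))"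
    by (rule distr_cong[OF refl]) (unfold bp, simp_all)
  also have "\<dots> = density lborel (\<lambda>v. ennreal (\<Prod>b\<in>Basis. normal_density 0 s (v \<bullet> b)))"
    by (rule distributed_distr_eq_density[OF D])
  also have "(\<lambda>v :: real \<times> real. ennreal (\<Prod>b\<in>Basis. normal_density 0 s (v \<bullet> b)))
      = (\<lambda>(x, y). ?\<phi> x * ?\<phi> y)"
  proof -
    have B: "Basis = {(1, 0), (0, 1) :: real \<times> real}" by (auto simp: Basis_prod_def)
    show ?thesis unfolding B by (auto simp: ennreal_mult'[symmetric] fun_eq_iff)
  qed
  also have "density lborel \<dots> = ?D \<Otimes>\<^sub>M ?D"
    unfolding lborel_prod [symmetric]
    by (rule pair_measure_density [symmetric]) (auto intro: lborel.sigma_finite_measure_axioms N.sigma_finite_measure_axioms)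
  finally have eq: "distr M (borel \<Otimes>\<^sub>M borel) (\<lambda>\<omega>. (U \<omega>, V \<omega>)) = ?D \<Otimes>\<^sub>M ?D" .
  have *: "distr M borel U = ?D" "distr M borel V = ?D" "indep_var borel U borel V"
    using indep_var_of_distr_pair[OF _ _ N.prob_space_axioms N.prob_space_axioms _ _ eq] by auto
  have "distr M lborel f = distr M borel f" for f :: "'a \<Rightarrow> real" by (rule distr_cong) auto
  then show "distributed M lborel U ?\<phi>" "distributed M lborel V ?\<phi>"
    using * by (auto simp: distributed_def)
  show "indep_var borel U borel V" by fact
qed

lemma (in prob_space) normal_moments:
  assumes s: "0 < s" and D: "distributed M lborel U (\<lambda>x. ennreal (normal_density 0 s x))"
  shows "integrable M (\<lambda>\<omega>. U \<omega> ^ j)" "expectation U = 0" "expectation (\<lambda>\<omega>. U \<omega> ^ 2) = s\<^sup>2"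
    "expectation (\<lambda>\<omega>. U \<omega> ^ 3) = 0" "expectation (\<lambda>\<omega>. U \<omega> ^ 4) = 3 * s ^ 4"
proof -
  show "integrable M (\<lambda>\<omega>. U \<omega> ^ j)"
    using distributed_integrable[OF D, of "\<lambda>x. x ^ j"] integrable_normal_moment[OF s, of 0 j] by simp
  have E: "expectation (\<lambda>\<omega>. U \<omega> ^ j) = integral\<^sup>L lborel (\<lambda>x. normal_density 0 s x * x ^ j)" for j
    using distributed_integral[OF D, of "\<lambda>x. x ^ j"] by simp
  show "expectation U = 0" using E[of 1] integral_normal_moment_odd[OF s, of 0 0] by simp
  show "expectation (\<lambda>\<omega>. U \<omega> ^ 3) = 0"
    using E[of 3] integral_normal_moment_odd[OF s, of 0 1] by (simp add: numeral_3_eq_3)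
  have even: "expectation (\<lambda>\<omega>. U \<omega> ^ (2 * k)) = fact (2 * k) / ((2 / s\<^sup>2) ^ k * fact k)" for k
    using E[of "2 * k"] integral_normal_moment_even[OF s, of 0 k] by (simp only: diff_zero)
  show "expectation (\<lambda>\<omega>. U \<omega> ^ 2) = s\<^sup>2"
  proof -
    have "fact (2 * 1) / ((2 / s\<^sup>2) ^ 1 * fact 1) = s\<^sup>2" using s by simp
    then show ?thesis using even[of 1] by (simp del: power2_eq_square)
  qed
  show "expectation (\<lambda>\<omega>. U \<omega> ^ 4) = 3 * s ^ 4"
  proof -
    have "fact (2 * 2) / ((2 / s\<^sup>2) ^ 2 * fact 2) = 3 * s ^ 4"
      using s by (simp add: fact_numeral power_divide flip: power_mult)
    then show ?thesis using even[of 2] by simp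
  qed
qed

text \<open>The square has mean zero because the variances agree, and the odd powers because odd
  Gaussian moments vanish. The 8 is 3 + 2 + 3, from U^4 + 2 U^2 V^2 + V^4.\<close>

lemma (in prob_space) complex_gaussian_moments:
  fixes U V :: "'a \<Rightarrow> real"
  assumes s: "0 < s"
    and D: "distributed M lborel (\<lambda>\<omega>. (U \<omega>, V \<omega>))
          (\<lambda>v. ennreal (\<Prod>b\<in>Basis. normal_density 0 s (v \<bullet> b)))"
  shows "integrable M (\<lambda>\<omega>. norm (Complex (U \<omega>) (V \<omega>)) ^ 4)"
    "expectation (\<lambda>\<omega>. norm (Complex (U \<omega>) (V \<omega>)) ^ 4) = 8 * s ^ 4"
    "j \<in> {1..3} \<Longrightarrow> expectation (\<lambda>\<omega>. Complex (U \<omega>) (V \<omega>) ^ j) = 0"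
proof -
  note UV = planar_gaussian_coordinates[OF s D]
  note mU = normal_moments[OF s UV(1)] and mV = normal_moments[OF s UV(2)]
  have int: "integrable M (\<lambda>\<omega>. U \<omega> ^ i * V \<omega> ^ k)"
    and E: "expectation (\<lambda>\<omega>. U \<omega> ^ i * V \<omega> ^ k) = expectation (\<lambda>\<omega>. U \<omega> ^ i) * expectation (\<lambda>\<omega>. V \<omega> ^ k)" for i k
  proof -
    have "indep_var borel ((\<lambda>x. x ^ i) \<circ> U) borel ((\<lambda>x. x ^ k) \<circ> V)"
      by (rule indep_var_compose[OF UV(3)]) auto
    then have *: "indep_var borel (\<lambda>\<omega>. U \<omega> ^ i) borel (\<lambda>\<omega>. V \<omega> ^ k)" by (simp add: comp_def)
    show "integrable M (\<lambda>\<omega>. U \<omega> ^ i * V \<omega> ^ k)"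
      "expectation (\<lambda>\<omega>. U \<omega> ^ i * V \<omega> ^ k) = expectation (\<lambda>\<omega>. U \<omega> ^ i) * expectation (\<lambda>\<omega>. V \<omega> ^ k)"
      using indep_var_integrable[OF * mU(1) mV(1)] indep_var_lebesgue_integral[OF * mU(1) mV(1)] by auto
  qed
  have n4: "norm (Complex x y) ^ 4 = x ^ 4 + 2 * (x ^ 2 * y ^ 2) + y ^ 4" for x y
  proof -
    have "norm (Complex x y) ^ 4 = (norm (Complex x y) ^ 2) ^ 2" by (simp flip: power_mult)
    also have "\<dots> = (x\<^sup>2 + y\<^sup>2)\<^sup>2" by (simp add: cmod_power2)
    finally show ?thesis by (simp add: power2_sum flip: power_mult)
  qed
  show "integrable M (\<lambda>\<omega>. norm (Complex (U \<omega>) (V \<omega>)) ^ 4)"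
    unfolding n4 by (intro Bochner_Integration.integrable_add integrable_mult_right int mU mV)
  show "expectation (\<lambda>\<omega>. norm (Complex (U \<omega>) (V \<omega>)) ^ 4) = 8 * s ^ 4"
    unfolding n4 using mU mV int[of 2 2] E[of 2 2] by (simp flip: power_add)
  assume "j \<in> {1..3}"
  then consider "j = 1" | "j = 2" | "j = 3" by force
  then show "expectation (\<lambda>\<omega>. Complex (U \<omega>) (V \<omega>) ^ j) = 0"
  proof cases
    case 1
    have "Complex x y ^ 1 = of_real x + \<i> * of_real y" for x y by (simp add: complex_eq_iff)
    then show ?thesis
      using 1 mU(1)[of 1] mV(1)[of 1] mU(2) mV(2) by simp
  next
    case 2
    have "Complex x y ^ 2 = of_real (x ^ 2) - of_real (y ^ 2) + (2 * \<i>) * of_real (x ^ 1 * y ^ 1)" for x y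
      by (simp add: complex_eq_iff power2_eq_square)
    then show ?thesis
      using 2 mU(1)[of 2] mV(1)[of 2] mU mV int[of 1 1] E[of 1 1] by (simp del: of_real_power of_real_mult power_one_right)
  next
    case 3
    have "Complex x y ^ 3 = of_real (x ^ 3) - 3 * of_real (x ^ 1 * y ^ 2) + (3 * \<i>) * of_real (x ^ 2 * y ^ 1) - \<i> * of_real (y ^ 3)" for x y
      by (simp add: complex_eq_iff power2_eq_square power3_eq_cube algebra_simps)
    then show ?thesis
      using 3 mU(1)[of 3] mV(1)[of 3] mU mV int[of 1 2] E[of 1 2] int[of 2 1] E[of 2 1]
      by (simp del: of_real_power of_real_mult power_one_right)
  qed
qed

lemma (in prob_space) brownian_isotropic_steps:
  assumes B: "brownian_motion (\<lambda>t \<omega>. (B1 t \<omega>, B2 t \<omega>))" and h: "0 < h"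
  shows "isotropic_steps M (\<lambda>i \<omega>. Complex (B1 (real (Suc i) * h) \<omega> - B1 (real i * h) \<omega>)
            (B2 (real (Suc i) * h) \<omega> - B2 (real i * h) \<omega>)) N h"
proof -
  let ?U = "\<lambda>i \<omega>. B1 (real (Suc i) * h) \<omega> - B1 (real i * h) \<omega>"
  let ?V = "\<lambda>i \<omega>. B2 (real (Suc i) * h) \<omega> - B2 (real i * h) \<omega>"
  have D: "distributed M lborel (\<lambda>\<omega>. (?U i \<omega>, ?V i \<omega>))
          (\<lambda>v. ennreal (\<Prod>b\<in>Basis. normal_density 0 (sqrt h) (v \<bullet> b)))" for i
  proof -
    have "0 \<le> real i * h \<and> real i * h < real (Suc i) * h" using h by simp
    then have "distributed M lborel (\<lambda>\<omega>. (B1 (real (Suc i) * h) \<omega>, B2 (real (Suc i) * h) \<omega>) - (B1 (real i * h) \<omega>, B2 (real i * h) \<omega>))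
          (\<lambda>v. ennreal (\<Prod>b\<in>Basis. normal_density 0 (sqrt (real (Suc i) * h - real i * h)) (v \<bullet> b)))"
      using B unfolding brownian_motion_def by blast
    moreover have "real (Suc i) * h - real i * h = h" by (simp add: algebra_simps)
    ultimately show ?thesis by simp
  qed
  have s4: "sqrt h ^ 4 = h\<^sup>2"
    using h by (metis numeral_Bit0 power_add power2_eq_square real_sqrt_pow2 less_imp_le)
  note m = complex_gaussian_moments[OF _ D]
  have ind: "indep_vars (\<lambda>_. borel) (\<lambda>i \<omega>. (B1 (real (Suc i) * h) \<omega>, B2 (real (Suc i) * h) \<omega>) - (B1 (real i * h) \<omega>, B2 (real i * h) \<omega>)) {..<N}"
  proof -
    have "mono (\<lambda>i. real i * h)" using h by (auto simp: mono_def mult_right_mono)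
    moreover have "0 \<le> real 0 * h" by simp
    ultimately show ?thesis
      using B[unfolded brownian_motion_def, THEN conjunct2, THEN conjunct2, THEN conjunct2, THEN conjunct1,
        rule_format, of "\<lambda>i. real i * h" N] by blast
  qed
  have "indep_vars (\<lambda>_. borel) (\<lambda>i \<omega>. (\<lambda>v. Complex (fst v) (snd v)) ((B1 (real (Suc i) * h) \<omega>, B2 (real (Suc i) * h) \<omega>) - (B1 (real i * h) \<omega>, B2 (real i * h) \<omega>))) {..<N}"
    by (rule indep_vars_compose2[OF ind])
       (auto simp: Complex_eq intro!: borel_measurable_continuous_onI continuous_intros)
  then have "indep_vars (\<lambda>_. borel) (\<lambda>i \<omega>. Complex (?U i \<omega>) (?V i \<omega>)) {..<N}" by simp
  then show ?thesis
    using m h s4 by unfold_locales auto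
qed

section \<open>Pathwise approximation of the reflected process\<close>

text \<open>These are the properties of local time that enter Skorokhod's lemma. The approximating
  integrals increase with t. On a compact interval where \<open>y\<close> is positive it has a
  positive minimum, and windows narrower than this minimum collect no mass there.\<close>

lemma local_time_path:
  fixes y a l :: "real \<Rightarrow> real"
  assumes y: "continuous_on {0..} y" and a: "mono_on {0..} a" "continuous_on {0..} a"
    and lim: "\<And>t. 0 \<le> t \<Longrightarrow> ((\<lambda>\<epsilon>. 1 / (2 * \<epsilon>) *
                (LINT s:{0..t}|interval_measure (\<lambda>s. a (max 0 s)). indicator {s. \<bar>y s\<bar> \<le> \<epsilon>} s))
              \<longlongrightarrow> l t) (at_right 0)"
  shows "mono_on {0..} l"
    and "\<And>s t. \<lbrakk>0 \<le> s; s \<le> t; \<And>r. \<lbrakk>s \<le> r; r \<le> t\<rbrakk> \<Longrightarrow> 0 < y r\<rbrakk> \<Longrightarrow> l s = l t"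
    and "y 0 \<noteq> 0 \<Longrightarrow> l 0 = 0"
proof -
  define \<nu> where "\<nu> = interval_measure (\<lambda>s. a (max 0 s))"
  define I where "I \<epsilon> t = (LINT s:{0..t}|\<nu>. (indicator {s. \<bar>y s\<bar> \<le> \<epsilon>} s :: real))" for \<epsilon> t
  have lim: "((\<lambda>\<epsilon>. 1 / (2 * \<epsilon>) * I \<epsilon> t) \<longlongrightarrow> l t) (at_right 0)" if "0 \<le> t" for t
    using lim[OF that] by (simp add: I_def \<nu>_def)
  have ac: "continuous_on UNIV (\<lambda>s. a (max 0 s))"
    by (rule continuous_on_compose2[OF a(2)]) (auto intro!: continuous_intros)
  \<comment> \<open>A half-open interval reaching below 0 contains \<open>{0..t}\<close>, and its
    mass is given by the increments of the path of the quadratic variation.\<close>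
  have fin: "emeasure \<nu> {-1<..t} < \<infinity>" if "0 \<le> t" for t
    unfolding \<nu>_def
  proof (subst emeasure_interval_measure_Ioc)
    show "a (max 0 u) \<le> a (max 0 v)" if "u \<le> v" for u v
      using that by (intro mono_onD[OF a(1)]) auto
    show "continuous (at_right u) (\<lambda>s. a (max 0 s))" for u
      using ac by (auto simp: continuous_on_eq_continuous_at intro: continuous_at_imp_continuous_within)
  qed (use that in auto)
  have int: "integrable \<nu> (\<lambda>s. indicator {0..t} s *\<^sub>R (indicator {s. \<bar>y s\<bar> \<le> \<epsilon>} s :: real))" if "0 \<le> t" for t \<epsilon>
  proof -
    have "closed ({0..t} \<inter> (\<lambda>s. \<bar>y s\<bar>) -` {..\<epsilon>})"
      by (rule continuous_closed_preimage) (auto intro!: continuous_intros continuous_on_subset[OF y])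
    then have m: "{0..t} \<inter> (\<lambda>s. \<bar>y s\<bar>) -` {..\<epsilon>} \<in> sets \<nu>" by (simp add: \<nu>_def)
    have "emeasure \<nu> ({0..t} \<inter> (\<lambda>s. \<bar>y s\<bar>) -` {..\<epsilon>}) \<le> emeasure \<nu> {-1<..t}"
      by (rule emeasure_mono) (auto simp: \<nu>_def)
    then have "emeasure \<nu> ({0..t} \<inter> (\<lambda>s. \<bar>y s\<bar>) -` {..\<epsilon>}) < \<infinity>"
      using fin[OF that] by (rule le_less_trans)
    then have "integrable \<nu> (indicator ({0..t} \<inter> (\<lambda>s. \<bar>y s\<bar>) -` {..\<epsilon>}) :: real \<Rightarrow> real)"
      using m by (intro integrable_real_indicator)
    also have "(indicator ({0..t} \<inter> (\<lambda>s. \<bar>y s\<bar>) -` {..\<epsilon>}) :: real \<Rightarrow> real)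
        = (\<lambda>s. indicator {0..t} s *\<^sub>R (indicator {s. \<bar>y s\<bar> \<le> \<epsilon>} s))"
      by (auto simp: indicator_def fun_eq_iff)
    finally show ?thesis .
  qed
  show "mono_on {0..} l"
  proof (rule mono_onI)
    fix s t :: real assume st: "s \<in> {0..}" "t \<in> {0..}" "s \<le> t"
    have "I \<epsilon> s \<le> I \<epsilon> t" for \<epsilon>
      unfolding I_def set_lebesgue_integral_def
      by (rule integral_mono[OF int int]) (use st in \<open>auto simp: indicator_def\<close>)
    then show "l s \<le> l t"
      using st by (intro tendsto_le[OF _ lim lim])
        (auto intro!: eventually_at_right_less[THEN eventually_mono] divide_right_mono)
  qed
  show "l s = l t" if st: "0 \<le> s" "s \<le> t" "\<And>r. \<lbrakk>s \<le> r; r \<le> t\<rbrakk> \<Longrightarrow> 0 < y r" for s t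
  proof -
    have "continuous_on {s..t} y" by (rule continuous_on_subset[OF y]) (use st in auto)
    then obtain m where m: "m \<in> {s..t}" "\<And>r. r \<in> {s..t} \<Longrightarrow> y m \<le> y r"
      using continuous_attains_inf[of "{s..t}" y] st by auto
    have "\<forall>\<^sub>F \<epsilon> in at_right 0. \<epsilon> < y m"
      using st(3)[of m] m(1) by (intro eventually_at_rightI[of 0 "y m"]) auto
    then have "\<forall>\<^sub>F \<epsilon> in at_right 0. 1 / (2 * \<epsilon>) * I \<epsilon> s = 1 / (2 * \<epsilon>) * I \<epsilon> t"
    proof eventually_elim
      case (elim \<epsilon>)
      have "I \<epsilon> s = I \<epsilon> t"
        unfolding I_def set_lebesgue_integral_def
      proof (rule Bochner_Integration.integral_cong[OF refl])
        fix r
        have "\<not> \<bar>y r\<bar> \<le> \<epsilon>" if "s < r" "r \<le> t" using m(2)[of r] elim that by auto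
        then show "indicator {0..s} r *\<^sub>R (indicator {s. \<bar>y s\<bar> \<le> \<epsilon>} r :: real) = indicator {0..t} r *\<^sub>R indicator {s. \<bar>y s\<bar> \<le> \<epsilon>} r"
          using st by (cases "s < r") (auto simp: indicator_def)
      qed
      then show ?case by simp
    qed
    then have "((\<lambda>\<epsilon>. 1 / (2 * \<epsilon>) * I \<epsilon> t) \<longlongrightarrow> l s) (at_right 0)"
      by (rule Lim_transform_eventually[OF lim[OF st(1)]])
    then show ?thesis
      using lim[of t] st by (intro tendsto_unique[OF trivial_limit_at_right_real]) auto
  qed
  show "l 0 = 0" if "y 0 \<noteq> 0"
  proof -
    have "\<forall>\<^sub>F \<epsilon> in at_right 0. \<epsilon> < \<bar>y 0\<bar>"
      using that by (intro eventually_at_rightI[of 0 "\<bar>y 0\<bar>"]) auto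
    then have "\<forall>\<^sub>F \<epsilon> in at_right 0. 1 / (2 * \<epsilon>) * I \<epsilon> 0 = 0"
    proof eventually_elim
      case (elim \<epsilon>)
      have "I \<epsilon> 0 = (LINT s|\<nu>. 0)"
        unfolding I_def set_lebesgue_integral_def
        by (rule Bochner_Integration.integral_cong[OF refl]) (use elim in \<open>auto simp: indicator_def\<close>)
      then show ?case by simp
    qed
    then have "((\<lambda>\<epsilon>. 0) \<longlongrightarrow> l 0) (at_right (0 :: real))"
      by (rule Lim_transform_eventually[OF lim[OF order_refl]])
    then show ?thesis
      using tendsto_unique[OF trivial_limit_at_right_real _ tendsto_const] by blast
  qed
qed

section \<open>The Skorokhod problem on a grid\<close>

primrec grid_max :: "(nat \<Rightarrow> real) \<Rightarrow> nat \<Rightarrow> real" where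
  "grid_max b 0 = - b 0"
| "grid_max b (Suc k) = max (grid_max b k) (- b (Suc k))"

lemma grid_max_ge: "j \<le> k \<Longrightarrow> - b j \<le> grid_max b k"
  by (induction k) (auto simp: le_Suc_eq max_def)

lemma grid_max_le: "(\<And>j. j \<le> k \<Longrightarrow> - b j \<le> c) \<Longrightarrow> grid_max b k \<le> c"
  by (induction k) auto

lemma real_nat_floor_bounds:
  fixes a :: real
  assumes "0 \<le> a"
  shows "real (nat \<lfloor>a\<rfloor>) \<le> a" "a < real (nat \<lfloor>a\<rfloor>) + 1"
  using assms by linarith+

text \<open>
  Skorokhod's lemma on a grid: \<open>l\<close> is within the oscillation of \<open>b\<close> of the running maximum of \<open>- b\<close> over
  the grid points. If \<open>s\<close> is the last zero of \<open>b + l\<close> before time \<open>t\<close>, then \<open>l t = l s = - b s\<close>.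
\<close>

lemma skorokhod_grid:
  fixes b l :: "real \<Rightarrow> real"
  assumes b: "continuous_on {0..} b" "b 0 = 0" and y: "continuous_on {0..} (\<lambda>t. b t + l t)"
    and l: "mono_on {0..} l"
      "\<And>s t. \<lbrakk>0 \<le> s; s \<le> t; \<And>r. \<lbrakk>s \<le> r; r \<le> t\<rbrakk> \<Longrightarrow> 0 < b r + l r\<rbrakk> \<Longrightarrow> l s = l t"
      "b 0 + l 0 = 0" "\<And>t. 0 \<le> t \<Longrightarrow> 0 \<le> b t + l t"
    and h: "0 < h"
    and osc: "\<And>r r'. \<lbrakk>0 \<le> r; r \<le> r'; r' \<le> real k * h; r' \<le> r + h\<rbrakk> \<Longrightarrow> \<bar>b r - b r'\<bar> \<le> \<epsilon>"
  shows "\<bar>l (real k * h) - grid_max (\<lambda>j. b (real j * h)) k\<bar> \<le> \<epsilon>"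
proof -
  let ?t = "real k * h" and ?m = "grid_max (\<lambda>j. b (real j * h)) k"
  have t: "0 \<le> ?t" using h by simp
  \<comment> \<open>This direction is exact: \<open>b + l \<ge> 0\<close> at earlier grid points
    together with the monotonicity of \<open>l\<close>.\<close>
  have lower: "?m \<le> l ?t"
  proof (rule grid_max_le)
    fix j assume "j \<le> k"
    then have "real j * h \<le> ?t" using h by simp
    then have "l (real j * h) \<le> l ?t" using h by (intro mono_onD[OF l(1)]) auto
    moreover have "0 \<le> b (real j * h) + l (real j * h)" using l(4) h by simp
    ultimately show "- b (real j * h) \<le> l ?t" by linarith
  qed
  define Z where "Z = {0..?t} \<inter> (\<lambda>r. b r + l r) -` {0}"
  have "closed Z" unfolding Z_def
    by (rule continuous_closed_preimage) (auto intro!: continuous_on_subset[OF y])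
  moreover have "0 \<in> Z" using l(3) t by (auto simp: Z_def)
  moreover have bdd: "bdd_above Z" by (auto simp: Z_def bdd_above_def)
  ultimately have "Sup Z \<in> Z" using closed_contains_Sup by blast
  then obtain s where s_Sup: "s = Sup Z" and s: "0 \<le> s" "s \<le> ?t" "b s + l s = 0" by (auto simp: Z_def)
  \<comment> \<open>Constancy of \<open>l\<close> is available only on intervals where the path is
    positive, which excludes \<open>s\<close> itself; the continuity of \<open>l\<close>, a
    difference of continuous functions, carries the value over to \<open>s\<close>.\<close>
  have lst: "l ?t \<le> l s"
  proof (cases "s = ?t")
    case False
    then have st: "s < ?t" using s by simp
    have pos: "0 < b r + l r" if "s < r" "r \<le> ?t" for r
    proof -
      have "b r + l r \<noteq> 0"
      proof
        assume "b r + l r = 0"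
        then have "r \<in> Z" using that s(1) by (simp add: Z_def)
        then have "r \<le> s" unfolding s_Sup using bdd by (rule cSup_upper)
        then show False using that by linarith
      qed
      moreover have "0 \<le> b r + l r" using l(4)[of r] that s(1) by linarith
      ultimately show ?thesis by linarith
    qed
    have "continuous_on {0..} (\<lambda>t. b t + l t - b t)" by (intro continuous_intros y b)
    then have "continuous_on {0..} l" by simp
    then have "continuous (at s within {0..}) l" using s by (auto simp: continuous_on_eq_continuous_within)
    then have "(l \<longlongrightarrow> l s) (at s within {0..})" by (simp add: continuous_within)
    then have "(l \<longlongrightarrow> l s) (at s within {s<..})"
      by (rule tendsto_within_subset) (use s in auto)
    moreover have "\<forall>\<^sub>F r in at_right s. l ?t \<le> l r"
    proof (rule eventually_at_rightI[OF _ st])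
      fix r assume "r \<in> {s<..<?t}"
      then have r: "s < r" "r \<le> ?t" by auto
      have "l r = l ?t" by (rule l(2)) (use r s pos in auto)
      then show "l ?t \<le> l r" by simp
    qed
    ultimately show ?thesis by (rule tendsto_lowerbound) simp
  qed simp
  \<comment> \<open>The last grid point not after \<open>s\<close>, hence within one mesh of it, so
    that - b s exceeds the value at this grid point by at most \<open>\<epsilon>\<close>.\<close>
  define j where "j = nat \<lfloor>s / h\<rfloor>"
  have "0 \<le> s / h" using s h by simp
  note j = real_nat_floor_bounds[OF this, folded j_def]
  then have jh: "real j * h \<le> s" "s \<le> real j * h + h" using h by (auto simp: field_simps)
  have "real j * h \<le> real k * h" using jh s by linarith
  then have jk: "j \<le> k" using h by simp
  have "\<bar>b (real j * h) - b s\<bar> \<le> \<epsilon>" using jh s h by (intro osc) auto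
  then have "l ?t \<le> ?m + \<epsilon>"
    using lst s(3) grid_max_ge[OF jk, of "\<lambda>j. b (real j * h)"] by linarith
  then show ?thesis using lower by linarith
qed

definition grid_walk :: "real \<Rightarrow> real \<Rightarrow> (nat \<Rightarrow> real) \<Rightarrow> (nat \<Rightarrow> real) \<Rightarrow> nat \<Rightarrow> complex" where
  "grid_walk \<theta> x b1 b2 k = Complex (x + b1 k - tan \<theta> * grid_max b2 k) (b2 k + grid_max b2 k)"

text \<open>The increase of the running maximum m to a new value -b' is max 0 (- (b' + m)), which is
  exactly the push needed after the free step. Hence the reflected recursion has this closed
  form.\<close>

lemma grid_walk_Suc:
  "grid_walk \<theta> x b1 b2 (Suc k) =
     ostep \<theta> (grid_walk \<theta> x b1 b2 k) (Complex (b1 (Suc k) - b1 k) (b2 (Suc k) - b2 k))"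
  by (auto simp: complex_eq_iff Re_ostep Im_ostep grid_walk_def push_def max_def algebra_simps)

text \<open>The index \<open>j\<close> is the smaller of \<open>n\<close> and the first index at
  which the unstopped walk is at most \<open>\<delta>\<close>.\<close>

lemma owalk_stopped:
  assumes "Z 0 = z" "\<And>k. Z (Suc k) = ostep \<theta> (Z k) (s k)"
  shows "\<exists>j\<le>n. owalk \<theta> \<delta> z s n = Z j \<and> (\<forall>i<j. \<delta> < Re (Z i)) \<and> (j = n \<or> Re (Z j) \<le> \<delta>)"
proof (induction n)
  case 0
  then show ?case using assms by auto
next
  case (Suc n)
  then obtain j where j: "j \<le> n" "owalk \<theta> \<delta> z s n = Z j" "\<forall>i<j. \<delta> < Re (Z i)" "j = n \<or> Re (Z j) \<le> \<delta>" by auto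
  show ?case
  proof (cases "\<delta> < Re (Z j)")
    case True
    then have "j = n" using j by auto
    then show ?thesis using True j assms by (intro exI[of _ "Suc n"]) (auto simp: less_Suc_eq)
  next
    case False
    then show ?thesis using j by (intro exI[of _ j]) auto
  qed
qed

section \<open>Convergence of the stopped walk along one path\<close>

definition stopped_walk ::
    "real \<Rightarrow> real \<Rightarrow> (real \<Rightarrow> real) \<Rightarrow> (real \<Rightarrow> real) \<Rightarrow> real \<Rightarrow> real \<Rightarrow> nat \<Rightarrow> complex" where
  "stopped_walk \<theta> x b1 b2 \<delta> T n = owalk \<theta> \<delta> (of_real x)
     (\<lambda>i. Complex (b1 (real (Suc i) * (T / n)) - b1 (real i * (T / n)))
                  (b2 (real (Suc i) * (T / n)) - b2 (real i * (T / n)))) n"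

text \<open>The deterministic content of one good sample path: a solution of the Skorokhod problem
  for \<open>b2\<close>, with \<open>l\<close> acting obliquely on the first coordinate.\<close>

locale reflected_path =
  fixes \<theta> x :: real and b1 b2 l :: "real \<Rightarrow> real"
  assumes tan_nonneg: "0 \<le> tan \<theta>"
    and b1: "continuous_on {0..} b1" "b1 0 = 0"
    and b2: "continuous_on {0..} b2" "b2 0 = 0"
    and l_cont: "continuous_on {0..} l" and l_mono: "mono_on {0..} l"
    and l_0: "l 0 = 0"
    and l_const: "\<And>s t. \<lbrakk>0 \<le> s; s \<le> t; \<And>r. \<lbrakk>s \<le> r; r \<le> t\<rbrakk> \<Longrightarrow> 0 < b2 r + l r\<rbrakk> \<Longrightarrow> l s = l t"
    and nonneg: "\<And>t. 0 \<le> t \<Longrightarrow> 0 \<le> b2 t + l t"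
begin

definition path :: "real \<Rightarrow> complex" where
  "path t = Complex (x + b1 t - tan \<theta> * l t) (b2 t + l t)"

definition approx :: "real \<Rightarrow> nat \<Rightarrow> complex" where
  "approx h = grid_walk \<theta> x (\<lambda>j. b1 (real j * h)) (\<lambda>j. b2 (real j * h))"

lemma continuous_path: "continuous_on {0..} path"
  unfolding path_def by (intro continuous_on_Complex continuous_intros b1 b2 l_cont)

lemma approx_close:
  assumes T: "0 < T" and \<eta>: "0 < \<eta>"
  shows "\<forall>\<^sub>F n in sequentially. 0 < n
     \<and> (\<forall>k\<le>n. norm (approx (T / n) k - path (real k * (T / n))) \<le> \<eta>)
     \<and> (\<forall>r r'. 0 \<le> r \<longrightarrow> r \<le> r' \<longrightarrow> r' \<le> T \<longrightarrow> r' \<le> r + T / n \<longrightarrow> norm (path r - path r') \<le> \<eta>)"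
proof -
  \<comment> \<open>On the grid, path and approximation differ only through \<open>l\<close> against
    its discrete version, along the vector (tan \<theta>, -1) of norm at most 1 + tan
    \<theta>.\<close>
  define \<epsilon> where "\<epsilon> = \<eta> / (1 + tan \<theta>)"
  have \<epsilon>: "0 < \<epsilon>" using \<eta> tan_nonneg by (simp add: \<epsilon>_def)
  have "uniformly_continuous_on {0..T} b2"
    by (intro compact_uniformly_continuous continuous_on_subset[OF b2(1)]) auto
  then obtain d1 where d1: "0 < d1"
    "\<And>r r'. \<lbrakk>r \<in> {0..T}; r' \<in> {0..T}; dist r' r < d1\<rbrakk> \<Longrightarrow> dist (b2 r') (b2 r) < \<epsilon>"
    using \<epsilon> unfolding uniformly_continuous_on_def by metis
  have "uniformly_continuous_on {0..T} path"
    by (intro compact_uniformly_continuous continuous_on_subset[OF continuous_path]) auto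
  then obtain d2 where d2: "0 < d2"
    "\<And>r r'. \<lbrakk>r \<in> {0..T}; r' \<in> {0..T}; dist r' r < d2\<rbrakk> \<Longrightarrow> dist (path r') (path r) < \<eta>"
    using \<eta> unfolding uniformly_continuous_on_def by metis
  obtain n0 where n0: "T / min d1 d2 < real n0" using reals_Archimedean2 by blast
  show ?thesis
  proof (rule eventually_sequentiallyI[of "Suc n0"])
    fix n assume n: "Suc n0 \<le> n"
    then have "0 < n" by simp
    have "T / min d1 d2 < real n" using n n0 by linarith
    then have "T / real n < min d1 d2"
      using d1(1) d2(1) \<open>0 < n\<close> by (simp add: pos_divide_less_eq mult.commute del: min_less_iff_conj)
    then have h: "0 < T / n" "T / n < d1" "T / n < d2"
      using T \<open>0 < n\<close> by simp_all
    let ?h = "T / n"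
    have "norm (approx ?h k - path (real k * ?h)) \<le> \<eta>" if k: "k \<le> n" for k
    proof -
      have kT: "real k * ?h \<le> T" using k T \<open>0 < n\<close> by (simp add: field_simps)
      have *: "\<bar>l (real k * ?h) - grid_max (\<lambda>j. b2 (real j * ?h)) k\<bar> \<le> \<epsilon>"
      proof (rule skorokhod_grid[OF b2 _ l_mono l_const _ nonneg h(1)])
        show "continuous_on {0..} (\<lambda>t. b2 t + l t)" by (intro continuous_intros b2 l_cont)
        show "b2 0 + l 0 = 0" by (simp add: l_0 b2)
        fix r r' assume r: "0 \<le> r" "r \<le> r'" "r' \<le> real k * ?h" "r' \<le> r + ?h"
        then have "dist (b2 r') (b2 r) < \<epsilon>" using h kT by (intro d1) (auto simp: dist_real_def)
        then show "\<bar>b2 r - b2 r'\<bar> \<le> \<epsilon>" by (simp add: dist_real_def abs_minus_commute)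
      qed
      have "approx ?h k - path (real k * ?h)
          = Complex (tan \<theta>) (-1) * of_real (l (real k * ?h) - grid_max (\<lambda>j. b2 (real j * ?h)) k)"
        by (simp add: approx_def path_def grid_walk_def complex_eq_iff algebra_simps)
      then have "norm (approx ?h k - path (real k * ?h))
          = norm (Complex (tan \<theta>) (-1)) * \<bar>l (real k * ?h) - grid_max (\<lambda>j. b2 (real j * ?h)) k\<bar>"
        by (simp only: norm_mult norm_of_real)
      also have "\<dots> \<le> (1 + tan \<theta>) * \<epsilon>"
        using * cmod_le[of "Complex (tan \<theta>) (-1)"] tan_nonneg by (intro mult_mono) auto
      also have "\<dots> = \<eta>" using tan_nonneg by (simp add: \<epsilon>_def)
      finally show ?thesis .
    qed
    moreover have "norm (path r - path r') \<le> \<eta>" if "0 \<le> r" "r \<le> r'" "r' \<le> T" "r' \<le> r + ?h" for r r'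
    proof -
      have "dist (path r') (path r) < \<eta>" using that h by (intro d2) (auto simp: dist_real_def)
      then show ?thesis by (simp add: dist_norm norm_minus_commute)
    qed
    ultimately show "0 < n \<and> (\<forall>k\<le>n. norm (approx ?h k - path (real k * ?h)) \<le> \<eta>)
     \<and> (\<forall>r r'. 0 \<le> r \<longrightarrow> r \<le> r' \<longrightarrow> r' \<le> T \<longrightarrow> r' \<le> r + ?h \<longrightarrow> norm (path r - path r') \<le> \<eta>)"
      using \<open>0 < n\<close> by blast
  qed
qed

abbreviation stopped :: "real \<Rightarrow> real \<Rightarrow> nat \<Rightarrow> complex" where
  "stopped \<equiv> stopped_walk \<theta> x b1 b2"

lemma stopped_eq_approx:
  "\<exists>j\<le>n. stopped \<delta> T n = approx (T / n) j \<and> (\<forall>i<j. \<delta> < Re (approx (T / n) i)) \<and> (j = n \<or> Re (approx (T / n) j) \<le> \<delta>)"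
  unfolding stopped_walk_def approx_def
  by (rule owalk_stopped) (simp add: grid_walk_def b1 b2 complex_eq_iff, rule grid_walk_Suc)

text \<open>Until shortly before S the path stays well above \<open>\<delta>\<close>, so the walk
  cannot stop there; at S it is at 0, so the walk cannot run past S. The bound \<delta> / 4 holds
  because the preceding grid point was above \<open>\<delta>\<close> and at most three errors of
  size \<delta> / 4 intervene: two approximations and one oscillation. It places the final position
  in the region where \<open>clamped\<close> is not cut off.\<close>

lemma stopped_limit:
  assumes x: "0 < x" and S: "0 \<le> S" "Re (path S) = 0" "\<And>t. \<lbrakk>0 \<le> t; t < S\<rbrakk> \<Longrightarrow> 0 < Re (path t)"
    and \<epsilon>: "0 < \<epsilon>"
  shows "\<exists>\<delta>0>0. \<forall>\<delta>. 0 < \<delta> \<and> \<delta> < \<delta>0 \<longrightarrow> (\<forall>T>S. \<forall>\<^sub>F n in sequentially.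
           norm (stopped \<delta> T n - path S) < \<epsilon> \<and> \<delta> / 4 \<le> Re (stopped \<delta> T n))"
proof -
  have "Re (path 0) = x" by (simp add: path_def b1 b2 l_0)
  then have S0: "0 < S" using S x by (cases "S = 0") auto
  have "continuous (at S within {0..}) path"
    using continuous_path S by (auto simp: continuous_on_eq_continuous_within)
  then obtain d where d: "0 < d" "\<And>t. \<lbrakk>0 \<le> t; dist t S < d\<rbrakk> \<Longrightarrow> dist (path t) (path S) < \<epsilon> / 2"
    using \<epsilon> unfolding continuous_within_eps_delta by (metis atLeast_iff half_gt_zero)
  \<comment> \<open>After \<open>s\<close> the path is already within \<epsilon> / 2 of its value at
    S; up to \<open>s\<close> it is bounded away from the line Re z = 0.\<close>
  define s where "s = max 0 (S - d / 2)"
  have s: "0 \<le> s" "s < S" using S0 d by (auto simp: s_def)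
  have "continuous_on {0..s} (\<lambda>t. Re (path t))"
    by (intro continuous_intros continuous_on_subset[OF continuous_path]) auto
  then obtain m where m: "m \<in> {0..s}" "\<And>t. t \<in> {0..s} \<Longrightarrow> Re (path m) \<le> Re (path t)"
    using continuous_attains_inf[of "{0..s}" "\<lambda>t. Re (path t)"] s by auto
  define c where "c = Re (path m)"
  have c: "0 < c" using S(3)[of m] m s by (simp add: c_def)
  \<comment> \<open>The three bounds forbid stopping before \<open>s\<close>, make the approximation
    error small against \<open>\<epsilon>\<close>, and start the walk above its level.\<close>
  define \<delta>0 where "\<delta>0 = min (c / 2) (min (\<epsilon> / 2) x)"
  have "0 < \<delta>0" using c \<epsilon> x by (simp add: \<delta>0_def)
  moreover have "\<forall>\<^sub>F n in sequentially. norm (stopped \<delta> T n - path S) < \<epsilon> \<and> \<delta> / 4 \<le> Re (stopped \<delta> T n)"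
    if \<delta>: "0 < \<delta>" "\<delta> < \<delta>0" and T: "S < T" for \<delta> T
  proof -
    have \<delta>': "\<delta> < c / 2" "\<delta> < \<epsilon> / 2" "\<delta> < x" using \<delta> by (auto simp: \<delta>0_def)
    have T0: "0 < T" and \<delta>4: "0 < \<delta> / 4" using T S \<delta> by auto
    show ?thesis using approx_close[OF T0 \<delta>4]
    proof eventually_elim
      case (elim n)
      let ?h = "T / n"
      have h: "0 < ?h" using elim T0 by simp
      have grid0: "0 \<le> real k * ?h" for k by (intro mult_nonneg_nonneg less_imp_le[OF h]) simp
      have close: "\<And>k. k \<le> n \<Longrightarrow> norm (approx ?h k - path (real k * ?h)) \<le> \<delta> / 4"
        and osc: "\<And>r r'. \<lbrakk>0 \<le> r; r \<le> r'; r' \<le> T; r' \<le> r + ?h\<rbrakk> \<Longrightarrow> norm (path r - path r') \<le> \<delta> / 4"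
        using elim by auto
      have closeRe: "\<bar>Re (approx ?h k) - Re (path (real k * ?h))\<bar> \<le> \<delta> / 4" if "k \<le> n" for k
        using close[OF that] abs_Re_le_cmod[of "approx ?h k - path (real k * ?h)"] by simp
      have oscRe: "\<bar>Re (path r) - Re (path r')\<bar> \<le> \<delta> / 4" if "0 \<le> r" "r \<le> r'" "r' \<le> T" "r' \<le> r + ?h" for r r'
        using osc[OF that] abs_Re_le_cmod[of "path r - path r'"] by simp
      have gridT: "real k * ?h \<le> T" if "k \<le> n" for k
        using that T0 elim by (simp add: field_simps)
      obtain j where j: "j \<le> n" "stopped \<delta> T n = approx ?h j"
        "\<And>i. i < j \<Longrightarrow> \<delta> < Re (approx ?h i)" "j = n \<or> Re (approx ?h j) \<le> \<delta>"
        using stopped_eq_approx[of n \<delta> T] by blast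
      \<comment> \<open>Otherwise the walk would still run at the last grid point not after S, where
        its real part is at most \<delta> / 4 + \<delta> / 4.\<close>
      have jS: "real j * ?h \<le> S"
      proof (rule ccontr)
        assume "\<not> real j * ?h \<le> S"
        define i where "i = nat \<lfloor>S / ?h\<rfloor>"
        have "0 \<le> S / ?h" by (intro divide_nonneg_pos less_imp_le[OF S0] h)
        note i = real_nat_floor_bounds[OF this, folded i_def]
        have ih: "real i * ?h \<le> S" using i(1) unfolding pos_le_divide_eq[OF h] .
        have ih': "S \<le> real i * ?h + ?h" using i(2) unfolding pos_divide_less_eq[OF h] distrib_right by linarith
        have "real i * ?h < real j * ?h" using ih \<open>\<not> real j * ?h \<le> S\<close> by linarith
        then have "real i < real j" unfolding mult_less_cancel_right_pos[OF h] .
        then have ij: "i < j" by simp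
        have "\<bar>Re (path (real i * ?h)) - Re (path S)\<bar> \<le> \<delta> / 4"
        proof (rule oscRe)
          show "0 \<le> real i * ?h" by (rule grid0)
        qed (use ih ih' T in linarith)+
        then show False
          using closeRe[of i] j(3)[OF ij] ij j(1) S(2) \<delta> by linarith
      qed
      have "j \<noteq> n"
      proof
        assume "j = n"
        then have "real j * ?h = T" using elim by simp
        then show False using jS T by simp
      qed
      then have jd: "Re (approx ?h j) \<le> \<delta>" using j by simp
      then have "Re (path (real j * ?h)) < c"
        using closeRe[OF j(1)] \<delta>' c by linarith
      then have js: "s < real j * ?h"
        using m(2)[of "real j * ?h"] grid0[of j] unfolding c_def atLeastAtMost_iff by linarith
      then have "S - d / 2 < real j * ?h" unfolding s_def max_less_iff_conj by blast
      then have "dist (real j * ?h) S < d"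
        using jS d(1) by (simp only: dist_real_def abs_less_iff) argo
      then have "dist (path (real j * ?h)) (path S) < \<epsilon> / 2" using grid0 by (intro d)
      then have "norm (path (real j * ?h) - path S) < \<epsilon> / 2" by (simp add: dist_norm)
      then have "norm ((approx ?h j - path (real j * ?h)) + (path (real j * ?h) - path S)) < \<epsilon>"
        using close[OF j(1)] \<delta> \<delta>' by (intro norm_triangle_lt) linarith
      moreover have "\<delta> / 4 \<le> Re (approx ?h j)"
      proof (cases j)
        case 0
        then show ?thesis using \<delta> \<delta>' by (simp add: approx_def grid_walk_def b1 b2)
      next
        case (Suc i)
        have "\<bar>Re (path (real i * ?h)) - Re (path (real j * ?h))\<bar> \<le> \<delta> / 4"
        proof (rule oscRe)
          show "real i * ?h \<le> real j * ?h" "real j * ?h \<le> real i * ?h + ?h"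
            unfolding Suc of_nat_Suc distrib_right using h by linarith+
        qed (rule grid0 gridT[OF j(1)])+
        then show ?thesis using closeRe[of i] closeRe[of j] j(3)[of i] Suc j(1) by linarith
      qed
      ultimately show ?case by (simp add: j(2))
    qed
  qed
  ultimately show ?thesis by blast
qed

end

section \<open>The Mellin transform of the Beta distribution of the second kind\<close>

text \<open>Euler's integral rescaled by \<open>c\<close>; complex powers of positive reals are
  written through \<open>exp\<close> and \<open>ln\<close>, so that they combine by the law of
  exponents.\<close>

lemma Gamma_has_bochner_integral:
  assumes s: "0 < Re s" and c: "0 < c"
  shows "has_bochner_integral lborel
    (\<lambda>t. indicator {0<..} t *\<^sub>R (exp ((s - 1) * of_real (ln t)) * of_real (exp (- (c * t)))))
    (Gamma s * exp (- s * of_real (ln c)))"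
proof -
  let ?f = "\<lambda>t. exp ((s - 1) * of_real (ln t)) * of_real (exp (- t)) :: complex"
  let ?g = "\<lambda>t. complex_of_real t powr (s - 1) / of_real (exp t)"
  have eq: "?f t = ?g t" if "t \<in> {0<..}" for t
    using that by (simp add: powr_def Ln_of_real exp_minus field_simps)
  have "(\<lambda>t. complex_of_real t powr (s - 1) / of_real (exp (1 * t))) absolutely_integrable_on {0<..}"
    using s by (intro absolutely_integrable_Gamma_integral) auto
  then have "set_integrable lebesgue {0<..} ?g" by simp
  then have "set_integrable lebesgue {0<..} ?f"
    by (rule set_integrable_cong[THEN iffD2, rotated 3]) (auto simp: eq)
  then have int: "set_integrable lborel {0<..} ?f"
    unfolding set_integrable_def by (subst (asm) integrable_completion) measurable
  have "(?g has_integral Gamma s) {0<..}"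
    by (rule has_integral_spike_set_eq[THEN iffD1, OF _ _ Gamma_integral_complex[OF s]])
       (auto intro: negligible_subset[of "{0}"])
  then have "(?f has_integral Gamma s) {0<..}"
    by (rule has_integral_cong[THEN iffD2, rotated]) (rule eq)
  then have "(LINT t:{0<..}|lborel. ?f t) = Gamma s"
    using set_borel_integral_eq_integral(2)[OF int] by (simp add: integral_unique)
  then have 1: "has_bochner_integral lborel (\<lambda>t. indicator {0<..} t *\<^sub>R ?f t) (Gamma s)"
    using int by (simp add: has_bochner_integral_iff set_integrable_def set_lebesgue_integral_def)
  have "has_bochner_integral lborel (\<lambda>t. indicator {0<..} (0 + c * t) *\<^sub>R ?f (0 + c * t)) (Gamma s /\<^sub>R \<bar>c\<bar>)"
    using 1 c by (subst lborel_has_bochner_integral_real_affine_iff[symmetric]) auto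
  then have 2: "has_bochner_integral lborel
      (\<lambda>t. exp (- ((s - 1) * of_real (ln c))) * (indicator {0<..} (0 + c * t) *\<^sub>R ?f (0 + c * t)))
      (exp (- ((s - 1) * of_real (ln c))) * (Gamma s /\<^sub>R \<bar>c\<bar>))"
    by (rule has_bochner_integral_mult_right)
  also have "(\<lambda>t. exp (- ((s - 1) * of_real (ln c))) * (indicator {0<..} (0 + c * t) *\<^sub>R ?f (0 + c * t)))
     = (\<lambda>t. indicator {0<..} t *\<^sub>R (exp ((s - 1) * of_real (ln t)) * of_real (exp (- (c * t)))))"
    using c by (auto simp: fun_eq_iff indicator_def zero_less_mult_iff ln_mult algebra_simps simp flip: exp_add)
  also have "exp (- ((s - 1) * of_real (ln c))) * (Gamma s /\<^sub>R \<bar>c\<bar>) = Gamma s * exp (- s * of_real (ln c))"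
  proof -
    have "complex_of_real c = exp (of_real (ln c))" using c by (simp add: exp_of_real)
    then have "of_real (inverse \<bar>c\<bar>) = exp (- complex_of_real (ln c))"
      using c by (simp add: exp_minus)
    then show ?thesis
      by (simp add: scaleR_conv_of_real algebra_simps flip: exp_add)
  qed
  finally show ?thesis .
qed

text \<open>Write 1 / (1 + z) as the integral of exp (- w (1 + z)) over w > 0 and exchange the
  integrals. Integrating in z first gives Gamma s * w^(-s), then integrating in w gives Gamma s *
  Gamma (1 - s), and the reflection formula applies.\<close>

lemma powr_over_one_plus_integral:
  assumes s: "0 < Re s" "Re s < 1"
  shows "has_bochner_integral lborel
    (\<lambda>z. indicator {0<..} z *\<^sub>R (exp ((s - 1) * of_real (ln z)) / of_real (1 + z)))
    (of_real pi / sin (of_real pi * s))"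
proof -
  define F :: "complex \<Rightarrow> real \<times> real \<Rightarrow> complex"
    where "F s = (\<lambda>(w, z). indicator {0<..} w *\<^sub>R (indicator {0<..} z *\<^sub>R
     (exp ((s - 1) * of_real (ln z)) * of_real (exp (- (w * (1 + z)))))))" for s
  have F_w: "has_bochner_integral lborel (\<lambda>z. F s (w, z))
      (Gamma s * (indicator {0<..} w *\<^sub>R (exp ((1 - s - 1) * of_real (ln w)) * of_real (exp (- (1 * w))))))"
    if "0 < Re s" for s w
  proof (cases "0 < w")
    case True
    have "has_bochner_integral lborel (\<lambda>z. of_real (exp (- w)) * (indicator {0<..} z *\<^sub>R (exp ((s - 1) * of_real (ln z)) * of_real (exp (- (w * z))))))
       (of_real (exp (- w)) * (Gamma s * exp (- s * of_real (ln w))))"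
      by (rule has_bochner_integral_mult_right) (rule Gamma_has_bochner_integral[OF that True])
    also have "(\<lambda>z. of_real (exp (- w)) * (indicator {0<..} z *\<^sub>R (exp ((s - 1) * of_real (ln z)) * of_real (exp (- (w * z))))))
      = (\<lambda>z. F s (w, z))"
      using True by (auto simp: F_def fun_eq_iff indicator_def distrib_left simp flip: exp_add of_real_mult)
    finally show ?thesis using True by (simp add: indicator_def mult_ac)
  qed (simp add: F_def has_bochner_integral_zero)
  have F_z: "has_bochner_integral lborel (\<lambda>w. F s (w, z))
      (indicator {0<..} z *\<^sub>R (exp ((s - 1) * of_real (ln z)) / of_real (1 + z)))" for s z
  proof (cases "0 < z")
    case True
    then have "has_bochner_integral lborel (\<lambda>w. exp ((s - 1) * of_real (ln z)) * (indicator {0<..} w *\<^sub>R (exp ((1 - 1) * of_real (ln w)) * of_real (exp (- ((1 + z) * w))))))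
      (exp ((s - 1) * of_real (ln z)) * (Gamma 1 * exp (- 1 * of_real (ln (1 + z)))))"
      by (intro has_bochner_integral_mult_right Gamma_has_bochner_integral) auto
    also have "(\<lambda>w. exp ((s - 1) * of_real (ln z)) * (indicator {0<..} w *\<^sub>R (exp ((1 - 1) * of_real (ln w)) * of_real (exp (- ((1 + z) * w))))))
       = (\<lambda>w. F s (w, z))"
      using True by (auto simp: F_def fun_eq_iff indicator_def mult_ac)
    also have "exp (- 1 * complex_of_real (ln (1 + z))) = 1 / of_real (1 + z)"
    proof -
      have "exp (- complex_of_real (ln (1 + z))) = of_real (exp (- ln (1 + z)))"
        by (metis exp_of_real of_real_minus)
      then show ?thesis using True by (simp add: exp_minus field_simps)
    qed
    finally show ?thesis using True by (simp add: indicator_def)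
  qed (simp add: F_def has_bochner_integral_zero)
  have [measurable]: "F s \<in> borel_measurable (lborel \<Otimes>\<^sub>M lborel)" for s
    unfolding F_def by measurable
  \<comment> \<open>The modulus of the integrand is the integrand for the real exponent Re s, so
    absolute integrability follows from the same iterated computation.\<close>
  have nF: "norm (F s (w, z)) = Re (F (of_real (Re s)) (w, z))" for w z
  proof -
    have "exp ((of_real (Re s) - 1) * complex_of_real (ln z)) = of_real (exp ((Re s - 1) * ln z))"
      by (simp flip: exp_of_real)
    moreover have "norm (exp ((s - 1) * complex_of_real (ln z))) = exp ((Re s - 1) * ln z)" by simp
    ultimately show ?thesis by (simp add: F_def norm_mult indicator_def)
  qed
  define \<sigma> where "\<sigma> = complex_of_real (Re s)"
  have \<sigma>: "0 < Re \<sigma>" "Re \<sigma> < 1" using s by (auto simp: \<sigma>_def)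
  let ?G = "\<lambda>s w. indicator {0<..} w *\<^sub>R (exp ((1 - s - 1) * of_real (ln w)) * of_real (exp (- (1 * w)))) :: complex"
  have G: "has_bochner_integral lborel (?G s) (Gamma (1 - s) * exp (- (1 - s) * of_real (ln 1)))" if "Re s < 1" for s
    using that by (intro Gamma_has_bochner_integral) auto
  have int: "integrable (lborel \<Otimes>\<^sub>M lborel) (F s)"
  proof (rule lborel_pair.Fubini_integrable)
    have "(\<lambda>w. LINT z|lborel. norm (F s (w, z))) = (\<lambda>w. Re (Gamma \<sigma> * ?G \<sigma> w))"
    proof
      fix w
      have "(LINT z|lborel. norm (F s (w, z))) = (LINT z|lborel. Re (F \<sigma> (w, z)))"
        by (simp only: nF \<sigma>_def)
      also have "\<dots> = Re (Gamma \<sigma> * ?G \<sigma> w)"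
        using F_w[OF \<sigma>(1), of w] by (simp only: has_bochner_integral_iff integral_Re)
      finally show "(LINT z|lborel. norm (F s (w, z))) = Re (Gamma \<sigma> * ?G \<sigma> w)" .
    qed
    moreover have "integrable lborel (\<lambda>w. Re (Gamma \<sigma> * ?G \<sigma> w))"
      by (intro integrable_Re integrable_mult_right integrable.intros[OF G] \<sigma>)
    ultimately show "integrable lborel (\<lambda>w. LINT z|lborel. norm (F s (w, z)))" by simp
    show "AE w in lborel. integrable lborel (\<lambda>z. F s (w, z))"
      using F_w[OF s(1)] by (auto simp: has_bochner_integral_iff)
  qed measurable
  have sw: "integrable (lborel \<Otimes>\<^sub>M lborel) (\<lambda>(w, z). F s (w, z))" using int by simp
  have I: "integrable lborel (\<lambda>z. LINT w|lborel. F s (w, z))"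
    by (rule lborel_pair.integrable_snd[OF sw])
  have inner: "(\<lambda>z. LINT w|lborel. F s (w, z)) = (\<lambda>z. indicator {0<..} z *\<^sub>R (exp ((s - 1) * of_real (ln z)) / of_real (1 + z)))"
    using F_z by (auto simp: has_bochner_integral_iff)
  have E: "(LINT z|lborel. LINT w|lborel. F s (w, z)) = of_real pi / sin (of_real pi * s)"
  proof -
    have "(LINT z|lborel. LINT w|lborel. F s (w, z)) = (LINT w|lborel. LINT z|lborel. F s (w, z))"
      by (rule lborel_pair.Fubini_integral[OF sw])
    also have "(\<lambda>w. LINT z|lborel. F s (w, z)) = (\<lambda>w. Gamma s * ?G s w)"
      using F_w[OF s(1)] by (auto simp: has_bochner_integral_iff)
    also have "(LINT w|lborel. Gamma s * ?G s w) = Gamma s * Gamma (1 - s)"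
      unfolding integral_mult_right_zero has_bochner_integral_integral_eq[OF G[OF s(2)]] by simp
    finally show ?thesis by (simp add: Gamma_reflection_complex)
  qed
  show ?thesis
    unfolding has_bochner_integral_iff inner [symmetric] using I E by blast
qed

text \<open>As the parameters add up to 1, the factor (1 + z) has exponent -1 and the Beta constant
  is pi / sin (pi * \<alpha>) by reflection.\<close>

lemma beta2_density_eq:
  assumes "0 < \<alpha>" "\<alpha> < 1"
  shows "beta2_density \<alpha> (1 - \<alpha>) z = indicator {0<..} z * (exp ((\<alpha> - 1) * ln z) / (1 + z)) * (sin (pi * \<alpha>) / pi)"
proof -
  have "complex_of_real (Gamma \<alpha> * Gamma (1 - \<alpha>)) = Gamma (of_real \<alpha>) * Gamma (1 - of_real \<alpha>)"
    by (simp only: of_real_mult Gamma_complex_of_real [symmetric] of_real_diff of_real_1)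
  also have "\<dots> = of_real pi / sin (of_real pi * of_real \<alpha>)"
    by (rule Gamma_reflection_complex)
  also have "\<dots> = of_real (pi / sin (pi * \<alpha>))"
    by (simp only: of_real_divide of_real_mult [symmetric] sin_of_real)
  finally have "Gamma \<alpha> * Gamma (1 - \<alpha>) = pi / sin (pi * \<alpha>)"
    unfolding of_real_eq_iff .
  then have "Beta \<alpha> (1 - \<alpha>) = pi / sin (pi * \<alpha>)" by (simp add: Beta_def)
  moreover have "(1 + z) powr - 1 = 1 / (1 + z)" if "0 < z"
    using that by (simp add: powr_minus field_simps)
  ultimately show ?thesis
    by (simp add: beta2_density_def powr_def indicator_def)
qed

text \<open>The factor z^(i t) shifts the exponent \<open>\<alpha>\<close> of the Mellin integral to
  \<alpha> + i t.\<close>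

lemma beta2_density_char:
  assumes \<alpha>: "0 < \<alpha>" "\<alpha> < 1"
  shows "has_bochner_integral lborel (\<lambda>z. beta2_density \<alpha> (1 - \<alpha>) z *\<^sub>R iexp (t * ln z))
      (of_real (sin (pi * \<alpha>)) / sin (of_real pi * (of_real \<alpha> + \<i> * of_real t)))"
proof -
  let ?s = "of_real \<alpha> + \<i> * of_real t :: complex"
  have "has_bochner_integral lborel
    (\<lambda>z. of_real (sin (pi * \<alpha>) / pi) * (indicator {0<..} z *\<^sub>R (exp ((?s - 1) * of_real (ln z)) / of_real (1 + z))))
    (of_real (sin (pi * \<alpha>) / pi) * (of_real pi / sin (of_real pi * ?s)))"
    using \<alpha> by (intro has_bochner_integral_mult_right powr_over_one_plus_integral) auto
  also have "(\<lambda>z. of_real (sin (pi * \<alpha>) / pi) * (indicator {0<..} z *\<^sub>R (exp ((?s - 1) * of_real (ln z)) / of_real (1 + z))))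
     = (\<lambda>z. beta2_density \<alpha> (1 - \<alpha>) z *\<^sub>R iexp (t * ln z))"
  proof
    fix z :: real
    have "exp ((?s - 1) * of_real (ln z)) = of_real (exp ((\<alpha> - 1) * ln z)) * iexp (t * ln z)"
      by (simp add: algebra_simps flip: exp_add exp_of_real)
    then show "of_real (sin (pi * \<alpha>) / pi) * (indicator {0<..} z *\<^sub>R (exp ((?s - 1) * of_real (ln z)) / of_real (1 + z)))
     = beta2_density \<alpha> (1 - \<alpha>) z *\<^sub>R iexp (t * ln z)"
      unfolding beta2_density_eq[OF \<alpha>] by (auto simp: scaleR_conv_of_real indicator_def mult_ac)
  qed
  finally show ?thesis by simp
qed

lemma beta2_density_nonneg: "0 < \<alpha> \<Longrightarrow> \<alpha> < 1 \<Longrightarrow> 0 \<le> beta2_density \<alpha> (1 - \<alpha>) z"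
  using sin_gt_zero[of "pi * \<alpha>"] by (simp add: beta2_density_eq indicator_def)

lemma prob_space_beta2:
  assumes \<alpha>: "0 < \<alpha>" "\<alpha> < 1"
  shows "prob_space (density lborel (\<lambda>z. ennreal (beta2_density \<alpha> (1 - \<alpha>) z)))"
proof
  have "has_bochner_integral lborel (\<lambda>z. complex_of_real (beta2_density \<alpha> (1 - \<alpha>) z)) 1"
    using beta2_density_char[OF \<alpha>, of 0] sin_gt_zero[of "pi * \<alpha>"] \<alpha>
    by (simp add: sin_of_real scaleR_conv_of_real flip: of_real_mult)
  then have 1: "has_bochner_integral lborel (beta2_density \<alpha> (1 - \<alpha>)) 1"
    using has_bochner_integral_Re by fastforce
  have "(\<integral>\<^sup>+z. ennreal (beta2_density \<alpha> (1 - \<alpha>) z) \<partial>lborel) = ennreal 1"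
    using 1 beta2_density_nonneg[OF \<alpha>]
    by (subst nn_integral_eq_integral) (auto simp: has_bochner_integral_iff)
  moreover have [measurable]: "beta2_density \<alpha> (1 - \<alpha>) \<in> borel_measurable borel"
    using 1 by (auto simp: has_bochner_integral_iff dest: borel_measurable_integrable)
  ultimately show "emeasure (density lborel (\<lambda>z. ennreal (beta2_density \<alpha> (1 - \<alpha>) z)))
      (space (density lborel (\<lambda>z. ennreal (beta2_density \<alpha> (1 - \<alpha>) z)))) = 1"
    by (simp add: emeasure_density)
qed

section \<open>Hitting times\<close>

text \<open>By compactness |f| attains its minimum, so arbitrarily small values force a zero;
  conversely grid points come close to any zero. The right-hand side involves countably many values
  of f, which yields the measurability of hitting times.\<close>

lemma zero_in_interval_iff:
  fixes f :: "real \<Rightarrow> real"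
  assumes f: "continuous_on {0..r} f" and r: "0 \<le> r"
  shows "(\<exists>t\<in>{0..r}. f t = 0) \<longleftrightarrow> (\<forall>n. \<exists>m. \<exists>i\<le>Suc m. \<bar>f (r * (real i / real (Suc m)))\<bar> < 1 / real (Suc n))"
proof
  assume "\<exists>t\<in>{0..r}. f t = 0"
  then obtain t where t: "0 \<le> t" "t \<le> r" "f t = 0" by auto
  show "\<forall>n. \<exists>m. \<exists>i\<le>Suc m. \<bar>f (r * (real i / real (Suc m)))\<bar> < 1 / real (Suc n)"
  proof
    fix n
    have "continuous (at t within {0..r}) f"
      using f t by (auto simp: continuous_on_eq_continuous_within)
    then obtain d where d: "0 < d" "\<And>u. \<lbrakk>u \<in> {0..r}; dist u t < d\<rbrakk> \<Longrightarrow> dist (f u) (f t) < 1 / real (Suc n)"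
      unfolding continuous_within_eps_delta by (metis divide_pos_pos of_nat_0_less_iff zero_less_Suc zero_less_one)
    obtain m where m: "r / d < real m" using reals_Archimedean2 by blast
    define i where "i = nat \<lfloor>t / r * real (Suc m)\<rfloor>"
    let ?q = "real i / real (Suc m)"
    have tr: "0 \<le> t / r" "t / r \<le> 1" using t r by (auto simp: divide_le_eq)
    have i: "real i \<le> t / r * real (Suc m)" "t / r * real (Suc m) < real i + 1"
      unfolding i_def using tr by (intro real_nat_floor_bounds mult_nonneg_nonneg; simp)+
    have "t / r * real (Suc m) \<le> 1 * real (Suc m)" using tr by (intro mult_right_mono) auto
    then have "real i \<le> real (Suc m)" using order_trans[OF i(1)] by simp
    then have iS: "i \<le> Suc m" by simp
    have q: "?q \<le> t / r" "t / r < ?q + 1 / real (Suc m)"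
      using i by (auto simp: field_simps)
    \<comment> \<open>For r = 0 both sides are 0, since then also t = 0.\<close>
    have rt: "r * (t / r) = t" using t by auto
    have "r * ?q \<le> t" using mult_left_mono[OF q(1) r] rt by simp
    moreover have "t \<le> r * ?q + r / real (Suc m)"
      using mult_left_mono[OF less_imp_le[OF q(2)] r] rt by (simp add: distrib_left)
    moreover have "r / real (Suc m) < d"
    proof -
      have "r / d < real (Suc m)" using m by simp
      then show ?thesis using d(1) by (simp add: field_simps)
    qed
    moreover have "0 \<le> r * ?q" using r by simp
    ultimately have "\<bar>f (r * ?q)\<bar> < 1 / real (Suc n)"
      using d(2)[of "r * ?q"] t by (simp add: dist_real_def)
    then show "\<exists>m. \<exists>i\<le>Suc m. \<bar>f (r * (real i / real (Suc m)))\<bar> < 1 / real (Suc n)"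
      using iS by blast
  qed
next
  assume *: "\<forall>n. \<exists>m. \<exists>i\<le>Suc m. \<bar>f (r * (real i / real (Suc m)))\<bar> < 1 / real (Suc n)"
  have "continuous_on {0..r} (\<lambda>t. \<bar>f t\<bar>)" by (intro continuous_intros f)
  then obtain t where t: "t \<in> {0..r}" "\<And>u. u \<in> {0..r} \<Longrightarrow> \<bar>f t\<bar> \<le> \<bar>f u\<bar>"
    using continuous_attains_inf[of "{0..r}" "\<lambda>t. \<bar>f t\<bar>"] r by auto
  have "\<bar>f t\<bar> < 1 / real (Suc n)" for n
  proof -
    obtain m i where mi: "i \<le> Suc m" "\<bar>f (r * (real i / real (Suc m)))\<bar> < 1 / real (Suc n)"
      using * by blast
    have "real i / real (Suc m) \<le> 1" using mi by (simp add: divide_le_eq)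
    then have "r * (real i / real (Suc m)) \<in> {0..r}"
      using r mult_left_mono[of "real i / real (Suc m)" 1 r] by simp
    then show ?thesis using t(2) mi(2) by fastforce
  qed
  then have "\<bar>f t\<bar> \<le> 0"
    by (metis less_le_not_le linorder_le_less_linear nat_approx_posE order_less_trans)
  then show "\<exists>t\<in>{0..r}. f t = 0" using t(1) by auto
qed

lemma hitting_time_path:
  fixes f :: "real \<Rightarrow> real"
  assumes f: "continuous_on {0..} f"
  defines "S \<equiv> Inf {ereal t | t. 0 \<le> t \<and> f t = 0}"
  shows "S = \<infinity> \<and> (\<forall>t\<ge>0. f t \<noteq> 0)
     \<or> (\<exists>s\<ge>0. S = ereal s \<and> f s = 0 \<and> (\<forall>t. 0 \<le> t \<and> t < s \<longrightarrow> f t \<noteq> 0))"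
proof (cases "\<exists>t\<ge>0. f t = 0")
  case False
  then have "{ereal t | t. 0 \<le> t \<and> f t = 0} = {}" by auto
  then have "S = \<infinity>" unfolding S_def by (simp only: Inf_empty top_ereal_def)
  then show ?thesis using False by blast
next
  case True
  define Z where "Z = {0..} \<inter> f -` {0}"
  have "closed Z" unfolding Z_def by (rule continuous_closed_preimage[OF f]) auto
  moreover have "Z \<noteq> {}" using True by (auto simp: Z_def)
  moreover have bdd: "bdd_below Z" by (auto simp: Z_def bdd_below_def)
  ultimately have in_Z: "Inf Z \<in> Z" using closed_contains_Inf by blast
  have least: "Inf Z \<le> t" if "0 \<le> t" "f t = 0" for t
    using that by (intro cInf_lower bdd) (simp add: Z_def)
  have "S = ereal (Inf Z)"
    unfolding S_def
  proof (rule Inf_eqI)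
    fix i assume "i \<in> {ereal t | t. 0 \<le> t \<and> f t = 0}"
    then show "ereal (Inf Z) \<le> i" using least by auto
  next
    fix y assume y: "\<And>i. i \<in> {ereal t | t. 0 \<le> t \<and> f t = 0} \<Longrightarrow> y \<le> i"
    show "y \<le> ereal (Inf Z)" using in_Z by (intro y) (auto simp: Z_def)
  qed
  then show ?thesis using in_Z least by (intro disjI2 exI[of _ "Inf Z"]) (force simp: Z_def)
qed

lemma hitting_time_measurable:
  fixes X :: "real \<Rightarrow> 'a \<Rightarrow> real"
  assumes X: "\<And>t. 0 \<le> t \<Longrightarrow> X t \<in> borel_measurable M"
    and cont: "\<And>\<omega>. \<omega> \<in> space M \<Longrightarrow> continuous_on {0..} (\<lambda>t. X t \<omega>)"
  shows "(\<lambda>\<omega>. Inf {ereal t | t. 0 \<le> t \<and> X t \<omega> = 0}) \<in> borel_measurable M"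
proof -
  let ?S = "\<lambda>\<omega>. Inf {ereal t | t. 0 \<le> t \<and> X t \<omega> = 0}"
  have r: "{\<omega> \<in> space M. ?S \<omega> \<le> ereal r} \<in> sets M" for r
  proof (cases "0 \<le> r")
    case True
    have "?S \<omega> \<le> ereal r \<longleftrightarrow> (\<forall>n. \<exists>m. \<exists>i\<le>Suc m. \<bar>X (r * (real i / real (Suc m))) \<omega>\<bar> < 1 / real (Suc n))"
      if \<omega>: "\<omega> \<in> space M" for \<omega>
    proof -
      have "?S \<omega> \<le> ereal r \<longleftrightarrow> (\<exists>t\<in>{0..r}. X t \<omega> = 0)"
        using hitting_time_path[OF cont[OF \<omega>]]
      proof (elim disjE exE conjE)
        fix s assume s: "0 \<le> s" "?S \<omega> = ereal s" "X s \<omega> = 0" "\<forall>t. 0 \<le> t \<and> t < s \<longrightarrow> X t \<omega> \<noteq> 0"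
        show ?thesis unfolding s(2) using s(1,3,4) by (auto simp: not_less[symmetric])
      qed auto
      also have "\<dots> \<longleftrightarrow> (\<forall>n. \<exists>m. \<exists>i\<le>Suc m. \<bar>X (r * (real i / real (Suc m))) \<omega>\<bar> < 1 / real (Suc n))"
        by (rule zero_in_interval_iff[OF continuous_on_subset[OF cont[OF \<omega>]] True]) auto
      finally show ?thesis .
    qed
    then have "{\<omega> \<in> space M. ?S \<omega> \<le> ereal r} =
      {\<omega> \<in> space M. \<forall>n. \<exists>m. \<exists>i\<in>{..Suc m}. \<bar>X (r * (real i / real (Suc m))) \<omega>\<bar> < 1 / real (Suc n)}"
      by (auto simp: Bex_def)
    also have "\<dots> \<in> sets M"
    proof -
      have [measurable]: "X (r * (real i / real (Suc m))) \<in> borel_measurable M" for i m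
        using True by (intro X mult_nonneg_nonneg divide_nonneg_nonneg) auto
      show ?thesis by measurable
    qed
    finally show ?thesis .
  next
    case False
    have "\<not> ?S \<omega> \<le> ereal r" for \<omega>
    proof -
      have "0 \<le> ?S \<omega>" by (rule Inf_greatest) auto
      moreover have "ereal r < 0" using False by simp
      ultimately have "ereal r < ?S \<omega>" by (rule less_le_trans[rotated])
      then show ?thesis unfolding not_le .
    qed
    then show ?thesis by simp
  qed
  show ?thesis
  proof (rule borel_measurable_iff_Iic_ereal[THEN iffD2], intro allI)
    fix a :: ereal
    show "?S -` {..a} \<inter> space M \<in> sets M"
    proof (cases a)
      case (real r)
      have "?S -` {..a} \<inter> space M = {\<omega> \<in> space M. ?S \<omega> \<le> ereal r}" using real by auto
      then show ?thesis using r by simp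
    next
      case PInf
      then have "?S -` {..a} \<inter> space M = space M" by auto
      then show ?thesis by simp
    next
      case MInf
      have "?S \<omega> \<noteq> -\<infinity>" for \<omega>
      proof -
        have "0 \<le> ?S \<omega>" by (rule Inf_greatest) auto
        then show ?thesis by auto
      qed
      then have "?S -` {..a} \<inter> space M = {}" using MInf by auto
      then show ?thesis by (metis sets.empty_sets)
    qed
  qed
qed

text \<open>Rounding \<open>\<tau>\<close> down to a grid leaves countably many possible times;
  continuity of the paths then passes to the limit.\<close>

lemma process_at_time_measurable:
  fixes Y :: "real \<Rightarrow> 'a \<Rightarrow> real"
  assumes Y: "\<And>t. 0 \<le> t \<Longrightarrow> Y t \<in> borel_measurable M"
    and cont: "\<And>\<omega>. \<omega> \<in> space M \<Longrightarrow> continuous_on {0..} (\<lambda>t. Y t \<omega>)"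
    and \<tau>[measurable]: "\<tau> \<in> borel_measurable M" and nonneg: "\<And>\<omega>. \<omega> \<in> space M \<Longrightarrow> (0 :: real) \<le> \<tau> \<omega>"
  shows "(\<lambda>\<omega>. Y (\<tau> \<omega>) \<omega>) \<in> borel_measurable M"
proof (rule borel_measurable_LIMSEQ_metric[where f = "\<lambda>n \<omega>. Y (real (nat \<lfloor>\<tau> \<omega> * real (Suc n)\<rfloor>) / real (Suc n)) \<omega>"])
  let ?g = "\<lambda>n \<omega>. nat \<lfloor>\<tau> \<omega> * real (Suc n)\<rfloor>"
  fix n
  show "(\<lambda>\<omega>. Y (real (?g n \<omega>) / real (Suc n)) \<omega>) \<in> borel_measurable M"
  proof (rule measurable_compose_countable[where f = "\<lambda>i \<omega>. Y (real i / real (Suc n)) \<omega>" and g = "?g n"])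
    show "(\<lambda>\<omega>. Y (real i / real (Suc n)) \<omega>) \<in> borel_measurable M" for i by (rule Y) simp
    show "?g n \<in> measurable M (count_space UNIV)" by measurable
  qed
next
  let ?g = "\<lambda>n \<omega>. nat \<lfloor>\<tau> \<omega> * real (Suc n)\<rfloor>"
  fix \<omega> assume \<omega>: "\<omega> \<in> space M"
  have "(\<lambda>n. real (?g n \<omega>) / real (Suc n)) \<longlonglongrightarrow> \<tau> \<omega>"
  proof (rule tendsto_sandwich)
    have fl: "real (?g n \<omega>) \<le> \<tau> \<omega> * real (Suc n)" "\<tau> \<omega> * real (Suc n) \<le> real (?g n \<omega>) + 1" for n
      using nonneg[OF \<omega>] real_nat_floor_bounds[of "\<tau> \<omega> * real (Suc n)"] by (auto simp del: of_nat_Suc)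
    show "\<forall>\<^sub>F n in sequentially. real (?g n \<omega>) / real (Suc n) \<le> \<tau> \<omega>"
      using fl(1) by (auto simp: divide_le_eq)
    show "\<forall>\<^sub>F n in sequentially. \<tau> \<omega> - 1 / real (Suc n) \<le> real (?g n \<omega>) / real (Suc n)"
    proof (rule always_eventually, rule allI)
      fix n
      have "\<tau> \<omega> \<le> (real (?g n \<omega>) + 1) / real (Suc n)" using fl(2) by (simp add: le_divide_eq)
      then show "\<tau> \<omega> - 1 / real (Suc n) \<le> real (?g n \<omega>) / real (Suc n)" by (simp add: add_divide_distrib)
    qed
    show "(\<lambda>n. \<tau> \<omega> - 1 / real (Suc n)) \<longlonglongrightarrow> \<tau> \<omega>"
      using tendsto_diff[OF tendsto_const LIMSEQ_inverse_real_of_nat] by (simp add: inverse_eq_divide)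
  qed simp
  then show "(\<lambda>n. Y (real (?g n \<omega>) / real (Suc n)) \<omega>) \<longlonglongrightarrow> Y (\<tau> \<omega>) \<omega>"
    by (rule continuous_on_tendsto_compose[OF cont[OF \<omega>]]) (use nonneg[OF \<omega>] in auto)
qed

text \<open>The time steps grow so fast that each increment dominates the position reached before it.\<close>

primrec sparse_time :: "real \<Rightarrow> nat \<Rightarrow> real" where
  "sparse_time x 0 = 0"
| "sparse_time x (Suc n) = sparse_time x n + (x + real (Suc n) * (sqrt (sparse_time x n) + 1))\<^sup>2"

lemma sparse_time_nonneg: "0 \<le> sparse_time x n"
  by (induction n) auto

lemma mono_sparse_time: "mono (sparse_time x)"
  by (rule mono_iff_le_Suc[THEN iffD2]) simp

lemma std_normal_tail: "measure (density lborel std_normal_density) {-1<..} < 1"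
proof -
  interpret N: prob_space "density lborel std_normal_density" by (rule prob_space_normal_density) simp
  have "N.prob {..-1} \<noteq> 0"
  proof
    assume "N.prob {..-1} = 0"
    then have "emeasure (density lborel std_normal_density) {..-1} = 0"
      by (simp add: N.emeasure_eq_measure)
    then have "(\<integral>\<^sup>+x. ennreal (std_normal_density x) * indicator {..-1} x \<partial>lborel) = 0"
      by (simp add: emeasure_density)
    then have "AE x in lborel. ennreal (std_normal_density x) * indicator {..-1} x = 0"
      by (subst (asm) nn_integral_0_iff_AE) auto
    then have "AE x in lborel. x \<notin> {..-1 :: real}"
    proof eventually_elim
      case (elim x)
      then show ?case
        using normal_density_pos[of 1 0 x] by (auto simp: indicator_def ennreal_eq_0_iff split: if_splits)
    qed
    then have "AE x in lborel. x \<notin> {-2..-1 :: real}" by eventually_elim auto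
    then have "{-2..-1 :: real} \<in> null_sets lborel" by (subst AE_iff_null_sets) simp_all
    then have "emeasure lborel {-2..-1 :: real} = 0" by (rule null_setsD1)
    moreover have "emeasure lborel {-2..-1 :: real} = 1" by (subst emeasure_lborel_Icc) auto
    ultimately show False by (metis zero_neq_one)
  qed
  moreover have "N.prob {-1<..} = 1 - N.prob {..-1}"
    using N.prob_compl[of "{..-1}"] by (simp add: Compl_eq_Diff_UNIV[symmetric])
  ultimately show ?thesis using measure_nonneg[of "density lborel std_normal_density" "{..-1}"] by linarith
qed

text \<open>Let \<open>G n\<close> be the event that the path stays above -x at the first sparse
  times. To stay above once more, either \<open>U n\<close> exceeds \<open>- c n\<close>, an event
  of fixed probability q < 1 independent of \<open>G n\<close>, or \<open>V n\<close> is larger than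
  \<open>c n - x\<close>, which is unlikely. In the limit p <= q * p, so p = 0.\<close>

lemma (in prob_space) brownian_hits_level:
  assumes B: "brownian_motion (\<lambda>t \<omega>. (B1 t \<omega> :: real, B2 t \<omega> :: real))" and x: "0 \<le> x"
  shows "AE \<omega> in M. \<exists>t\<ge>0. B1 t \<omega> - B1 0 \<omega> \<le> - x"
proof -
  let ?t = "sparse_time x"
  \<comment> \<open>The standard deviation of the increment \<open>U n\<close>. It exceeds x by n +
    1 times more than the standard deviation of \<open>V n\<close>, so Chebyshev's inequality gives
    1 / (n + 1)^2 below; the summand 1 keeps the first increment nondegenerate, as
    \<open>sparse_time\<close> starts at 0.\<close>
  define c where "c n = x + real (Suc n) * (sqrt (?t n) + 1)" for n
  have c: "0 < c n" "?t (Suc n) = ?t n + (c n)\<^sup>2" for n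
  proof -
    have "0 < real (Suc n) * (sqrt (?t n) + 1)"
      using sparse_time_nonneg[of x n] by (intro mult_pos_pos add_nonneg_pos) auto
    then show "0 < c n" unfolding c_def using x by linarith
    show "?t (Suc n) = ?t n + (c n)\<^sup>2" by (simp add: c_def)
  qed
  define U where "U n \<omega> = B1 (?t (Suc n)) \<omega> - B1 (?t n) \<omega>" for n \<omega>
  define V where "V n \<omega> = B1 (?t n) \<omega> - B1 0 \<omega>" for n \<omega>
  have V: "V n \<omega> = (\<Sum>i<n. U i \<omega>)" for n \<omega>
    unfolding U_def V_def by (subst sum_lessThan_telescope) simp
  have pair: "(\<lambda>\<omega>. (B1 t \<omega>, B2 t \<omega>)) \<in> borel_measurable M" if "0 \<le> t" for t
    using B that by (auto simp: brownian_motion_def)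
  have B1 [measurable]: "B1 t \<in> borel_measurable M" if "0 \<le> t" for t
    using measurable_compose[OF pair[OF that], of fst borel] by (simp add: borel_prod [symmetric])
  have meas [measurable]: "U n \<in> borel_measurable M" "V n \<in> borel_measurable M" for n
    unfolding U_def V_def using sparse_time_nonneg by (auto intro!: borel_measurable_diff B1 simp del: sparse_time.simps(2))
  have gauss: "distributed M lborel (\<lambda>\<omega>. B1 t \<omega> - B1 s \<omega>) (normal_density 0 (sqrt (t - s)))"
    if "0 \<le> s" "s < t" for s t
  proof -
    have "distributed M lborel (\<lambda>\<omega>. (B1 t \<omega>, B2 t \<omega>) - (B1 s \<omega>, B2 s \<omega>))
        (\<lambda>v. ennreal (\<Prod>b\<in>Basis. normal_density 0 (sqrt (t - s)) (v \<bullet> b)))"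
      using B that unfolding brownian_motion_def by blast
    then have "distributed M lborel (\<lambda>\<omega>. (B1 t \<omega> - B1 s \<omega>, B2 t \<omega> - B2 s \<omega>))
        (\<lambda>v. ennreal (\<Prod>b\<in>Basis. normal_density 0 (sqrt (t - s)) (v \<bullet> b)))" by simp
    then show ?thesis using that by (intro planar_gaussian_coordinates(1)) auto
  qed
  define q where "q = measure (density lborel std_normal_density) {-1<..}"
  have q: "q < 1" unfolding q_def by (rule std_normal_tail)
  have PU: "prob {\<omega> \<in> space M. - c n < U n \<omega>} = q" for n
  proof -
    have "distributed M lborel (U n) (normal_density 0 (c n))"
    proof -
      have "?t n < ?t (Suc n)" "sqrt (?t (Suc n) - ?t n) = c n"
        using c(1)[of n] unfolding c(2) by auto
      then show ?thesis
        using gauss[of "?t n" "?t (Suc n)"] sparse_time_nonneg[of x n] unfolding U_def [abs_def] by (simp only:)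
    qed
    then have D: "distributed M lborel (\<lambda>\<omega>. (U n \<omega> - 0) / c n) std_normal_density"
      using c(1) by (subst (asm) normal_standard_normal_convert) auto
    have "q = measure (distr M lborel (\<lambda>\<omega>. (U n \<omega> - 0) / c n)) {-1<..}"
      unfolding q_def distributed_distr_eq_density[OF D] ..
    also have "\<dots> = prob ((\<lambda>\<omega>. (U n \<omega> - 0) / c n) -` {-1<..} \<inter> space M)"
      by (rule measure_distr) auto
    also have "(\<lambda>\<omega>. (U n \<omega> - 0) / c n) -` {-1<..} \<inter> space M = {\<omega> \<in> space M. - c n < U n \<omega>}"
      using c(1)[of n] by (auto simp: field_simps)
    finally show ?thesis by simp
  qed
  have PV: "prob {\<omega> \<in> space M. c n - x < V n \<omega>} \<le> 1 / (real (Suc n))\<^sup>2" for n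
  proof (cases n)
    case 0
    then show ?thesis by simp
  next
    case (Suc m)
    have tn: "0 < ?t n" using c[of m] sparse_time_nonneg[of x m] Suc by (simp add: add_nonneg_pos del: sparse_time.simps)
    have D: "distributed M lborel (V n) (normal_density 0 (sqrt (?t n)))"
      using gauss[of 0 "?t n"] tn by (simp add: V_def [abs_def])
    note m = normal_moments[OF _ D]
    have cx2: "c n - x = real (Suc n) * (sqrt (?t n) + 1)" by (simp add: c_def)
    have cx: "0 < c n - x"
      unfolding cx2 using tn by (intro mult_pos_pos add_pos_pos) auto
    have "prob {\<omega> \<in> space M. c n - x < V n \<omega>} \<le> prob {\<omega> \<in> space M. c n - x \<le> \<bar>V n \<omega> - expectation (V n)\<bar>}"
      using m tn by (intro finite_measure_mono) auto
    also have "\<dots> \<le> variance (V n) / (c n - x)\<^sup>2"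
      using m(1)[of 2] tn cx by (intro Chebyshev_inequality) auto
    also have "\<dots> = ?t n / (c n - x)\<^sup>2" using m(2,3) tn by simp
    also have "\<dots> \<le> (sqrt (?t n) + 1)\<^sup>2 / (c n - x)\<^sup>2"
      using tn by (intro divide_right_mono) (auto simp: power2_sum)
    also have "\<dots> = 1 / (real (Suc n))\<^sup>2"
    proof -
      have "sqrt (?t n) + 1 \<noteq> 0" using tn by (smt (verit) real_sqrt_gt_zero)
      then show ?thesis unfolding cx2 power_mult_distrib by simp
    qed
    finally show ?thesis .
  qed
  have indU: "indep_vars (\<lambda>_. borel) U {..<n}" for n
  proof -
    have "indep_vars (\<lambda>_. borel) (\<lambda>i \<omega>. (B1 (?t (Suc i)) \<omega>, B2 (?t (Suc i)) \<omega>) - (B1 (?t i) \<omega>, B2 (?t i) \<omega>)) {..<n}"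
      using B[unfolded brownian_motion_def, THEN conjunct2, THEN conjunct2, THEN conjunct2, THEN conjunct1,
        rule_format, of ?t n] mono_sparse_time sparse_time_nonneg by blast
    then have "indep_vars (\<lambda>_. borel) (\<lambda>i \<omega>. fst ((B1 (?t (Suc i)) \<omega>, B2 (?t (Suc i)) \<omega>) - (B1 (?t i) \<omega>, B2 (?t i) \<omega>))) {..<n}"
      by (rule indep_vars_compose2) (simp add: borel_prod [symmetric])
    then show ?thesis by (simp add: U_def [abs_def])
  qed
  define G where "G n = {\<omega> \<in> space M. \<forall>k\<in>{..n}. - x < V k \<omega>}" for n
  have G [measurable]: "G n \<in> sets M" for n unfolding G_def by measurable
  have step: "prob (G (Suc n)) \<le> q * prob (G n) + 1 / (real (Suc n))\<^sup>2" for n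
  proof -
    let ?E = "{s. \<forall>k\<in>{..n}. - x < (\<Sum>i<k. s i)} \<inter> space (PiM {..<n} (\<lambda>_. borel :: real measure))"
    have restrict_indep: "indep_var (PiM {..<n} (\<lambda>_. borel)) (\<lambda>\<omega>. restrict (\<lambda>i. U i \<omega>) {..<n})
      (PiM {n} (\<lambda>_. borel)) (\<lambda>\<omega>. restrict (\<lambda>i. U i \<omega>) {n})"
      by (rule indep_var_restrict[OF indU[of "Suc n"]]) auto
    have E: "?E \<in> sets (PiM {..<n} (\<lambda>_. borel))"
    proof -
      have "(\<lambda>s. \<Sum>i<k. s i) \<in> borel_measurable (PiM {..<n} (\<lambda>_. borel :: real measure))" if "k \<in> {..n}" for k
        using that by (intro borel_measurable_sum measurable_component_singleton) auto
      then have "{s \<in> space (PiM {..<n} (\<lambda>_. borel :: real measure)). \<forall>k\<in>{..n}. - x < (\<Sum>i<k. s i)} \<in> sets (PiM {..<n} (\<lambda>_. borel))"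
        by (intro sets.sets_Collect_finite_All borel_measurable_less) auto
      also have "{s \<in> space (PiM {..<n} (\<lambda>_. borel :: real measure)). \<forall>k\<in>{..n}. - x < (\<Sum>i<k. s i)} = ?E" by auto
      finally show ?thesis .
    qed
    let ?A = "\<lambda>\<omega>. indicator ?E (restrict (\<lambda>i. U i \<omega>) {..<n}) :: real"
    have "indep_var borel ((\<lambda>s. indicator ?E s :: real) \<circ> (\<lambda>\<omega>. restrict (\<lambda>i. U i \<omega>) {..<n}))
      borel ((\<lambda>s. s n) \<circ> (\<lambda>\<omega>. restrict (\<lambda>i. U i \<omega>) {n}))"
      using E by (intro indep_var_compose[OF restrict_indep] borel_measurable_indicator) auto
    then have ind: "indep_var borel ?A borel (U n)"
      by (simp add: comp_def)
    have preG: "?A -` {1} \<inter> space M = G n"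
      by (auto simp: G_def V space_PiM indicator_def split: if_splits)
    have "prob (G n \<inter> {\<omega> \<in> space M. - c n < U n \<omega>})
        = prob ((\<lambda>\<omega>. (?A \<omega>, U n \<omega>)) -` ({1} \<times> {- c n<..}) \<inter> space M)"
      unfolding preG [symmetric] by (rule arg_cong[where f = prob]) auto
    also have "\<dots> = prob (?A -` {1} \<inter> space M) * prob (U n -` {- c n<..} \<inter> space M)"
      by (rule indep_varD[OF ind]) simp_all
    also have "U n -` {- c n<..} \<inter> space M = {\<omega> \<in> space M. - c n < U n \<omega>}" by auto
    finally have prod: "prob (G n \<inter> {\<omega> \<in> space M. - c n < U n \<omega>}) = prob (G n) * q"
      unfolding preG PU .
    have "G (Suc n) \<subseteq> (G n \<inter> {\<omega> \<in> space M. - c n < U n \<omega>}) \<union> {\<omega> \<in> space M. c n - x < V n \<omega>}"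
    proof
      fix \<omega> assume \<omega>: "\<omega> \<in> G (Suc n)"
      then have "- x < V (Suc n) \<omega>" "\<omega> \<in> G n" "\<omega> \<in> space M" by (auto simp: G_def)
      moreover have "V (Suc n) \<omega> = V n \<omega> + U n \<omega>" by (simp add: V)
      ultimately show "\<omega> \<in> (G n \<inter> {\<omega> \<in> space M. - c n < U n \<omega>}) \<union> {\<omega> \<in> space M. c n - x < V n \<omega>}"
        by auto
    qed
    then have "prob (G (Suc n)) \<le> prob ((G n \<inter> {\<omega> \<in> space M. - c n < U n \<omega>}) \<union> {\<omega> \<in> space M. c n - x < V n \<omega>})"
      by (intro finite_measure_mono) measurable
    also have "\<dots> \<le> prob (G n \<inter> {\<omega> \<in> space M. - c n < U n \<omega>}) + prob {\<omega> \<in> space M. c n - x < V n \<omega>}"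
      by (rule measure_Un_le) measurable
    finally show ?thesis using PV[of n] unfolding prod by (simp add: mult.commute)
  qed
  have lim: "(\<lambda>n. prob (G n)) \<longlonglongrightarrow> prob (\<Inter>n. G n)"
    by (rule finite_Lim_measure_decseq) (auto simp: decseq_def G_def)
  have "prob (\<Inter>n. G n) \<le> q * prob (\<Inter>n. G n) + 0"
  proof (rule LIMSEQ_le)
    show "(\<lambda>n. prob (G (Suc n))) \<longlonglongrightarrow> prob (\<Inter>n. G n)" using lim by (rule LIMSEQ_Suc)
    have "(\<lambda>n. 1 / (real (Suc n))\<^sup>2) \<longlonglongrightarrow> 0"
      using tendsto_power[OF LIMSEQ_inverse_real_of_nat, of 2] by (simp add: inverse_eq_divide power_divide)
    then show "(\<lambda>n. q * prob (G n) + 1 / (real (Suc n))\<^sup>2) \<longlonglongrightarrow> q * prob (\<Inter>n. G n) + 0"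
      by (intro tendsto_intros lim)
    show "\<exists>N. \<forall>n\<ge>N. prob (G (Suc n)) \<le> q * prob (G n) + 1 / (real (Suc n))\<^sup>2" using step by blast
  qed
  then have "(1 - q) * prob (\<Inter>n. G n) \<le> 0" by (simp add: algebra_simps)
  then have "prob (\<Inter>n. G n) = 0"
    using q measure_nonneg[of M "\<Inter>n. G n"] by (simp add: mult_le_0_iff order.antisym)
  then have "(\<Inter>n. G n) \<in> null_sets M" by (auto simp: emeasure_eq_measure)
  then have "AE \<omega> in M. \<omega> \<notin> (\<Inter>n. G n)" by (rule AE_not_in)
  then show ?thesis
  proof (rule AE_mp, intro AE_I2 impI)
    fix \<omega> assume "\<omega> \<in> space M" "\<omega> \<notin> (\<Inter>n. G n)"
    then obtain k where "V k \<omega> \<le> - x" by (auto simp: G_def not_less)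
    then show "\<exists>t\<ge>0. B1 t \<omega> - B1 0 \<omega> \<le> - x"
      using sparse_time_nonneg[of x k] unfolding V_def by blast
  qed
qed

section \<open>Passage to the limit\<close>

text \<open>Levels and horizons are tied to a single index so that countable limit theorems apply.
  The open condition \<open>Q\<close> covers both uses: continuity of f on the imaginary axis and
  its blow-up at the corner.\<close>

lemma (in reflected_path) stopped_eventually:
  assumes x: "0 < x" and S: "0 \<le> S" "Re (path S) = 0" "\<And>t. \<lbrakk>0 \<le> t; t < S\<rbrakk> \<Longrightarrow> 0 < Re (path t)"
    and Q: "\<forall>\<^sub>F z in nhds (path S). Q z"
  shows "\<forall>\<^sub>F m in sequentially. \<forall>\<^sub>F n in sequentially.
     Q (stopped (x / real (m + 2)) (real (m + 1)) n) \<and> x / real (m + 2) / 4 \<le> Re (stopped (x / real (m + 2)) (real (m + 1)) n)"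
proof -
  obtain \<epsilon> where \<epsilon>: "0 < \<epsilon>" "\<And>z. dist z (path S) < \<epsilon> \<Longrightarrow> Q z"
    using Q by (auto simp: eventually_nhds_metric)
  obtain \<delta>0 where \<delta>0: "0 < \<delta>0" "\<And>\<delta> T. \<lbrakk>0 < \<delta>; \<delta> < \<delta>0; S < T\<rbrakk> \<Longrightarrow> \<forall>\<^sub>F n in sequentially.
           norm (stopped \<delta> T n - path S) < \<epsilon> \<and> \<delta> / 4 \<le> Re (stopped \<delta> T n)"
    using stopped_limit[OF x S \<epsilon>(1)] by blast
  obtain m0 where m0: "max S (x / \<delta>0) < real m0" using reals_Archimedean2 by blast
  show ?thesis
  proof (rule eventually_sequentiallyI[of m0])
    fix m assume m: "m0 \<le> m"
    then have "real m0 \<le> real m" by simp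
    then have mm: "S < real m" "x / \<delta>0 < real m" using m0 by auto
    have "x < real m * \<delta>0" using mm(2) \<delta>0(1) by (simp add: pos_divide_less_eq)
    also have "\<dots> \<le> \<delta>0 * real (m + 2)" using \<delta>0(1) by (simp add: algebra_simps)
    finally have "x / real (m + 2) < \<delta>0" by (simp add: pos_divide_less_eq)
    then have "\<forall>\<^sub>F n in sequentially. norm (stopped (x / real (m + 2)) (real (m + 1)) n - path S) < \<epsilon>
        \<and> x / real (m + 2) / 4 \<le> Re (stopped (x / real (m + 2)) (real (m + 1)) n)"
      using x mm by (intro \<delta>0(2)) auto
    then show "\<forall>\<^sub>F n in sequentially.
     Q (stopped (x / real (m + 2)) (real (m + 1)) n) \<and> x / real (m + 2) / 4 \<le> Re (stopped (x / real (m + 2)) (real (m + 1)) n)"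
      by (rule eventually_mono) (use \<epsilon>(2) in \<open>unfold dist_norm, blast\<close>)
  qed
qed

text \<open>For an imaginary exponent the factor |z|^(Re a) is 1, so the bound is independent of
  \<open>\<kappa>\<close>. This is what allows domination while the stopping level tends to
  0.\<close>

lemma norm_clamped_imag_le:
  assumes "0 < \<kappa>"
  shows "norm (clamped \<kappa> \<theta>' (\<i> * of_real u) z) \<le> exp (\<bar>u\<bar> * pi)"
proof (cases "\<kappa> \<le> Re z")
  case True
  have "norm (oblique_fun \<theta>' (\<i> * of_real u) z) \<le> exp (\<bar>u\<bar> * pi)"
    unfolding oblique_fun_def
    using norm_powr_le[of "\<i> * of_real u" \<kappa> z] norm_powr_le[of "\<i> * of_real u" \<kappa> "cnj z"] True assms
    by (intro norm_average_le) auto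
  then show ?thesis using True by (simp add: clamped_def)
qed (simp add: clamped_def)

lemma limsup_const_bound:
  fixes r :: real
  assumes "\<And>r'. r' < r \<Longrightarrow> \<forall>\<^sub>F n in sequentially. ennreal r' \<le> u n"
  shows "ennreal r \<le> limsup u"
proof (rule dense_le)
  fix y assume "y < ennreal r"
  then obtain r' where r': "y \<le> ennreal r'" "r' < r"
    by (cases y) (auto simp: ennreal_less_iff top_unique intro: that)
  have "ennreal r' \<le> limsup u" by (rule le_Limsup[OF sequentially_bot assms[OF r'(2)]])
  with r'(1) show "y \<le> limsup u" by (rule order_trans)
qed

lemma continuous_oblique_fun_imag_axis:
  assumes "0 < y"
  shows "isCont (oblique_fun \<theta>' a) (Complex 0 y)"
proof -
  have "Complex 0 y \<notin> \<real>\<^sub>\<le>\<^sub>0" "cnj (Complex 0 y) \<notin> \<real>\<^sub>\<le>\<^sub>0"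
    using assms by (auto simp: complex_nonpos_Reals_iff)
  then show ?thesis
    unfolding oblique_fun_def [abs_def] by (intro continuous_intros) auto
qed

text \<open>\<open>\<tau>\<close> is the hitting time of \<open>0\<close> by \<open>X\<close>, and \<open>Y\<^sub>\<tau>\<close> the value of \<open>Y\<close> at that time.\<close>

locale oblique_process = prob_space +
  fixes \<theta> x :: real and B1 B2 L :: "real \<Rightarrow> 'a \<Rightarrow> real" and \<tau> Y\<^sub>\<tau> :: "'a \<Rightarrow> real"
  assumes \<theta>: "0 < \<theta>" "\<theta> < pi / 2" and x: "0 < x"
    and B: "brownian_motion (\<lambda>t \<omega>. (B1 t \<omega>, B2 t \<omega>))"
    and refl: "AE \<omega> in M. reflected_path \<theta> (\<lambda>t. B1 t \<omega>) (\<lambda>t. B2 t \<omega>) (\<lambda>t. L t \<omega>)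
       \<and> 0 \<le> \<tau> \<omega> \<and> reflected_path.path \<theta> x (\<lambda>t. B1 t \<omega>) (\<lambda>t. B2 t \<omega>) (\<lambda>t. L t \<omega>) (\<tau> \<omega>) = Complex 0 (Y\<^sub>\<tau> \<omega>)
       \<and> (\<forall>t. 0 \<le> t \<and> t < \<tau> \<omega> \<longrightarrow> 0 < Re (reflected_path.path \<theta> x (\<lambda>t. B1 t \<omega>) (\<lambda>t. B2 t \<omega>) (\<lambda>t. L t \<omega>) t))
       \<and> 0 \<le> Y\<^sub>\<tau> \<omega>"
    and Y\<tau>_measurable [measurable]: "Y\<^sub>\<tau> \<in> borel_measurable M"
begin

lemma cos_tan: "0 < cos \<theta>" "0 \<le> tan \<theta>"
  using \<theta> by (auto intro!: cos_gt_zero less_imp_le[OF tan_gt_zero])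

definition W :: "real \<Rightarrow> real \<Rightarrow> nat \<Rightarrow> 'a \<Rightarrow> complex" where
  "W \<delta> T n \<omega> = stopped_walk \<theta> x (\<lambda>t. B1 t \<omega>) (\<lambda>t. B2 t \<omega>) \<delta> T n"

lemma steps: "0 < T \<Longrightarrow> 0 < n \<Longrightarrow> isotropic_steps M (\<lambda>i \<omega>. Complex (B1 (real (Suc i) * (T / real n)) \<omega> - B1 (real i * (T / real n)) \<omega>)
            (B2 (real (Suc i) * (T / real n)) \<omega> - B2 (real i * (T / real n)) \<omega>)) n (T / real n)"
  by (rule brownian_isotropic_steps[OF B]) simp

lemma W_measurable [measurable]:
  assumes "0 < T"
  shows "W \<delta> T n \<in> borel_measurable M"
proof (cases "n = 0")
  case True
  then show ?thesis by (simp add: W_def [abs_def] stopped_walk_def)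
next
  case False
  interpret I: isotropic_steps M "\<lambda>i \<omega>. Complex (B1 (real (Suc i) * (T / real n)) \<omega> - B1 (real i * (T / real n)) \<omega>)
            (B2 (real (Suc i) * (T / real n)) \<omega> - B2 (real i * (T / real n)) \<omega>)" n "T / real n"
    by (rule steps) (use assms False in auto)
  show ?thesis
    unfolding W_def [abs_def] stopped_walk_def by (rule I.walk_measurable) simp
qed

lemma Im_W_nonneg: "0 \<le> Im (W \<delta> T n \<omega>)"
  unfolding W_def stopped_walk_def by (rule Im_owalk_nonneg) simp

text \<open>With N = n and h = T / n the bound of \<open>expectation_clamped_walk\<close> has a part
  of order 1 / n with a constant depending on \<open>\<mu>\<close>, and a part proportional to
  \<open>\<mu>\<close>. So \<open>\<mu>\<close> is fixed first and n chosen afterwards.\<close>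

lemma expectation_clamped_W_tendsto:
  assumes a: "Re a \<le> 0" and \<delta>: "0 < \<delta>" "\<delta> < x" and T: "0 < T"
  shows "(\<lambda>n. expectation (\<lambda>\<omega>. clamped (\<delta> / 4) \<theta> a (W \<delta> T n \<omega>))) \<longlonglongrightarrow> oblique_fun \<theta> a (of_real x)"
proof (rule LIMSEQ_I)
  fix e :: real assume e: "0 < e"
  have \<kappa>: "0 < \<delta> / 4" "\<delta> / 4 < \<delta>" using \<delta> by auto
  obtain K where K: "0 \<le> K"
    "\<And>z w. \<lbrakk>\<delta> \<le> Re z; 0 \<le> Im z\<rbrakk> \<Longrightarrow>
       norm (clamped (\<delta> / 4) \<theta> a (ostep \<theta> z w) - clamped (\<delta> / 4) \<theta> a z - oblique_lin \<theta> a z w)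
         \<le> K * (norm w ^ 4 + (push (z + w))\<^sup>2)"
    using ostep_Taylor[OF a \<kappa> cos_tan] by blast
  \<comment> \<open>The summand 1 keeps \<open>D\<close> positive when K = 0 and makes the estimate
    by e / 2 strict.\<close>
  define D where "D = K * (1 + 9 * T) + 1"
  define \<mu> where "\<mu> = e / (2 * D)"
  have D: "0 < D" using K T by (simp add: D_def add_nonneg_pos)
  have \<mu>: "0 < \<mu>" using e D by (simp add: \<mu>_def)
  have K\<mu>: "K * (\<mu> * (1 + 9 * T)) < e / 2"
  proof -
    have "K * (\<mu> * (1 + 9 * T)) = \<mu> * (K * (1 + 9 * T))" by simp
    also have "\<dots> < \<mu> * D" using \<mu> by (simp add: D_def)
    also have "\<dots> = e / 2" using D by (simp add: \<mu>_def)
    finally show ?thesis .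
  qed
  define A where "A = K * (8 * T\<^sup>2 * (1 + 1 / \<mu>\<^sup>2))"
  obtain n0 where n0: "A / (e / 2) < real n0" using reals_Archimedean2 by blast
  show "\<exists>no. \<forall>n\<ge>no. norm (expectation (\<lambda>\<omega>. clamped (\<delta> / 4) \<theta> a (W \<delta> T n \<omega>)) - oblique_fun \<theta> a (of_real x)) < e"
  proof (intro exI allI impI)
    fix n assume n: "Suc n0 \<le> n"
    then have npos: "0 < n" by simp
    interpret I: isotropic_steps M "\<lambda>i \<omega>. Complex (B1 (real (Suc i) * (T / real n)) \<omega> - B1 (real i * (T / real n)) \<omega>)
            (B2 (real (Suc i) * (T / real n)) \<omega> - B2 (real i * (T / real n)) \<omega>)" n "T / real n"
      by (rule steps[OF T npos])
    have "norm (expectation (\<lambda>\<omega>. clamped (\<delta> / 4) \<theta> a (W \<delta> T n \<omega>)) - clamped (\<delta> / 4) \<theta> a (of_real x))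
       \<le> K * (8 * n * (T / n)\<^sup>2 * (1 + 1 / \<mu>\<^sup>2) + \<mu> * (1 + 9 * (T / n) * n))"
      unfolding W_def stopped_walk_def
      by (rule I.expectation_clamped_walk[OF a \<kappa> _ \<mu> K]) simp
    also have "8 * n * (T / n)\<^sup>2 = 8 * T\<^sup>2 / n" using npos by (simp add: power2_eq_square)
    also have "9 * (T / n) * n = 9 * T" using npos by simp
    also have "K * (8 * T\<^sup>2 / n * (1 + 1 / \<mu>\<^sup>2) + \<mu> * (1 + 9 * T)) = A / n + K * (\<mu> * (1 + 9 * T))"
      by (simp add: A_def distrib_left add_divide_distrib mult.commute)
    also have "\<dots> < e / 2 + e / 2"
    proof (rule add_strict_mono[OF _ K\<mu>])
      have "A / (e / 2) < real n" using n n0 by (meson less_le_trans of_nat_le_iff Suc_leD)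
      then have "A < real n * (e / 2)" using e by (simp add: pos_divide_less_eq)
      then show "A / n < e / 2" using npos by (simp add: pos_divide_less_eq mult.commute)
    qed
    finally show "norm (expectation (\<lambda>\<omega>. clamped (\<delta> / 4) \<theta> a (W \<delta> T n \<omega>)) - oblique_fun \<theta> a (of_real x)) < e"
      using \<delta> by (simp add: clamped_def)
  qed
qed

text \<open>The quantifier over \<open>Q\<close> stands inside the almost-sure statement:
  \<open>Q\<close> may depend on the sample point, as neighbourhoods of the hitting point
  do.\<close>

lemma W_eventually:
  "AE \<omega> in M. \<forall>Q. (\<forall>\<^sub>F z in nhds (Complex 0 (Y\<^sub>\<tau> \<omega>)). Q z) \<longrightarrow>
     (\<forall>\<^sub>F m in sequentially. \<forall>\<^sub>F n in sequentially.
        Q (W (x / real (m + 2)) (real (m + 1)) n \<omega>) \<and> x / real (m + 2) / 4 \<le> Re (W (x / real (m + 2)) (real (m + 1)) n \<omega>))"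
  using refl
proof eventually_elim
  case (elim \<omega>)
  then interpret R: reflected_path \<theta> x "\<lambda>t. B1 t \<omega>" "\<lambda>t. B2 t \<omega>" "\<lambda>t. L t \<omega>" by blast
  have p: "R.path (\<tau> \<omega>) = Complex 0 (Y\<^sub>\<tau> \<omega>)" using elim by blast
  have "0 \<le> \<tau> \<omega>" "Re (R.path (\<tau> \<omega>)) = 0" "\<And>t. \<lbrakk>0 \<le> t; t < \<tau> \<omega>\<rbrakk> \<Longrightarrow> 0 < Re (R.path t)"
    using elim by (auto simp: p)
  note * = R.stopped_eventually[OF x this]
  show ?case unfolding W_def using * unfolding p by blast
qed

lemma level_bounds:
  "0 < x / real (m + 2)" "x / real (m + 2) < x" "0 < real (m + 1)" "0 < x / real (m + 2) / 4"
  using x by (auto simp: divide_less_eq)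

text \<open>For the exponent - \<epsilon>, f dominates c * |z|^(- \<epsilon>) on the quadrant, so it
  explodes along walks that end near the corner. The bound on \<open>clamped\<close> now depends on
  the level, so there is no domination; positivity and Fatou's lemma, first in n and then in m,
  still give a finite mean for the iterated liminf.\<close>

lemma Y\<tau>_pos: "AE \<omega> in M. 0 < Y\<^sub>\<tau> \<omega>"
proof -
  \<comment> \<open>With this choice the angle \<epsilon> * \<phi> + \<theta>, for \<phi> between 0
    and pi / 2, is at most the midpoint of \<theta> and pi / 2, so its cosine is bounded below by a
    positive constant.\<close>
  define \<epsilon> where "\<epsilon> = 1 / 2 - \<theta> / pi"
  have \<epsilon>: "0 < \<epsilon>" using \<theta> by (simp add: \<epsilon>_def field_simps)
  define c where "c = cos (\<epsilon> * (pi / 2) + \<theta>)"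
  have angle: "\<epsilon> * (pi / 2) + \<theta> = pi / 4 + \<theta> / 2" by (simp add: \<epsilon>_def field_simps)
  have c: "0 < c" unfolding c_def angle using \<theta> by (intro cos_gt_zero) auto
  let ?a = "- of_real \<epsilon> :: complex"
  have low: "norm z powr (- \<epsilon>) * c \<le> Re (oblique_fun \<theta> ?a z)" if z: "0 < Re z" "0 \<le> Im z" for z
  proof -
    define \<phi> where "\<phi> = Im (Ln z)"
    have z0: "z \<noteq> 0" "z \<notin> \<real>\<^sub>\<le>\<^sub>0" using z by (auto simp: complex_nonpos_Reals_iff)
    have \<phi>: "\<bar>\<phi>\<bar> < pi / 2" "0 \<le> \<phi>"
      using Re_Ln_pos_lt[OF z0(1)] Im_Ln_pos_le[OF z0(1)] z unfolding \<phi>_def by auto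
    have Ln: "Ln z = Complex (ln (norm z)) \<phi>" using z0 by (simp add: complex_eq_iff \<phi>_def)
    have Lnc: "Ln (cnj z) = Complex (ln (norm z)) (- \<phi>)"
      using cnj_Ln[OF z0(2)] unfolding Ln by (simp add: complex_eq_iff)
    have p1: "z powr ?a = of_real (norm z powr (- \<epsilon>)) * cis (- (\<epsilon> * \<phi>))"
      using z0 by (simp add: powr_def Ln exp_eq_polar)
    have p2: "cnj z powr ?a = of_real (norm z powr (- \<epsilon>)) * cis (\<epsilon> * \<phi>)"
      using z0 by (simp add: powr_def Lnc exp_eq_polar)
    have "oblique_fun \<theta> ?a z = of_real (norm z powr (- \<epsilon>)) * ((cis (-\<theta>) * cis (- (\<epsilon> * \<phi>)) + cis \<theta> * cis (\<epsilon> * \<phi>)) / 2)"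
      unfolding oblique_fun_def p1 p2 by (simp add: algebra_simps)
    also have "\<dots> = of_real (norm z powr (- \<epsilon>)) * of_real (cos (\<epsilon> * \<phi> + \<theta>))"
    proof -
      have "cis (-\<theta>) * cis (- (\<epsilon> * \<phi>)) = cis (- (\<epsilon> * \<phi> + \<theta>))" "cis \<theta> * cis (\<epsilon> * \<phi>) = cis (\<epsilon> * \<phi> + \<theta>)"
        by (simp_all add: cis_mult add.commute)
      moreover have "(cis (- s) + cis s) / 2 = of_real (cos s)" for s by (simp add: complex_eq_iff)
      ultimately show ?thesis by (simp only:)
    qed
    finally have eq: "Re (oblique_fun \<theta> ?a z) = norm z powr (- \<epsilon>) * cos (\<epsilon> * \<phi> + \<theta>)" by simp
    have "\<epsilon> * \<phi> \<le> \<epsilon> * (pi / 2)" using \<phi> \<epsilon> by (intro mult_left_mono) auto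
    then have "c \<le> cos (\<epsilon> * \<phi> + \<theta>)"
      unfolding c_def
    proof (intro cos_monotone_0_pi_le)
      show "0 \<le> \<epsilon> * \<phi> + \<theta>" using \<phi> \<epsilon> \<theta> by simp
      show "\<epsilon> * (pi / 2) + \<theta> \<le> pi" unfolding angle using \<theta> by simp
    qed simp
    then show ?thesis unfolding eq by (intro mult_left_mono) auto
  qed
  define u where "u m n \<omega> = ennreal (Re (clamped (x / real (m + 2) / 4) \<theta> ?a (W (x / real (m + 2)) (real (m + 1)) n \<omega>)))" for m n \<omega>
  have cl_nonneg: "0 \<le> Re (clamped (x / real (m + 2) / 4) \<theta> ?a (W (x / real (m + 2)) (real (m + 1)) n \<omega>))" for m n \<omega>
  proof (cases "x / real (m + 2) / 4 \<le> Re (W (x / real (m + 2)) (real (m + 1)) n \<omega>)")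
    case True
    then have "0 < Re (W (x / real (m + 2)) (real (m + 1)) n \<omega>)" using level_bounds(4)[of m] by linarith
    from low[OF this Im_W_nonneg] c show ?thesis
      using True by (auto simp: clamped_def intro: order_trans[rotated])
  qed (simp add: clamped_def)
  have u_meas [measurable]: "u m n \<in> borel_measurable M" for m n
  proof -
    note [measurable] = clamped_measurable[OF level_bounds(4)[of m]] W_measurable[OF level_bounds(3)[of m]]
    show ?thesis unfolding u_def [abs_def] by measurable
  qed
  let ?C = "ennreal (Re (oblique_fun \<theta> ?a (of_real x)))"
  have int_u: "(\<lambda>n. \<integral>\<^sup>+\<omega>. u m n \<omega> \<partial>M) \<longlonglongrightarrow> ?C" for m
  proof -
    note [measurable] = clamped_measurable[OF level_bounds(4)[of m]] W_measurable[OF level_bounds(3)[of m]]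
    have a: "Re ?a \<le> 0" using \<epsilon> by simp
    obtain D where D: "\<And>z. norm (clamped (x / real (m + 2) / 4) \<theta> ?a z) \<le> D"
      using norm_clamped_bounded[OF a level_bounds(4)[of m], of \<theta>] by metis
    have int: "integrable M (\<lambda>\<omega>. clamped (x / real (m + 2) / 4) \<theta> ?a (W (x / real (m + 2)) (real (m + 1)) n \<omega>))" for n
      by (rule integrable_const_bound[where B = D], rule AE_I2, rule D, measurable)
    have "(\<integral>\<^sup>+\<omega>. u m n \<omega> \<partial>M) = ennreal (Re (expectation (\<lambda>\<omega>. clamped (x / real (m + 2) / 4) \<theta> ?a (W (x / real (m + 2)) (real (m + 1)) n \<omega>))))" for n
      unfolding u_def integral_Re[OF int, symmetric] using cl_nonneg
      by (intro nn_integral_eq_integral integrable_Re int) auto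
    then show ?thesis
      using expectation_clamped_W_tendsto[OF a level_bounds(1-3)[of m]]
      by (simp only:) (intro tendsto_ennrealI tendsto_Re)
  qed
  define G where "G m \<omega> = liminf (\<lambda>n. u m n \<omega>)" for m \<omega>
  have G_meas [measurable]: "G m \<in> borel_measurable M" for m unfolding G_def [abs_def] by measurable
  have "(\<integral>\<^sup>+\<omega>. G m \<omega> \<partial>M) \<le> ?C" for m
  proof -
    have "(\<integral>\<^sup>+\<omega>. G m \<omega> \<partial>M) \<le> liminf (\<lambda>n. \<integral>\<^sup>+\<omega>. u m n \<omega> \<partial>M)"
      unfolding G_def by (rule nn_integral_liminf) measurable
    also have "\<dots> = ?C" using int_u[of m] by (rule lim_imp_Liminf[OF sequentially_bot])
    finally show ?thesis .
  qed
  then have "liminf (\<lambda>m. \<integral>\<^sup>+\<omega>. G m \<omega> \<partial>M) \<le> ?C"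
    by (intro order_trans[OF Liminf_le_Limsup[OF sequentially_bot]] Limsup_bounded) auto
  then have "(\<integral>\<^sup>+\<omega>. liminf (\<lambda>m. G m \<omega>) \<partial>M) \<le> ?C"
    by (intro order_trans[OF nn_integral_liminf]) auto
  then have "(\<integral>\<^sup>+\<omega>. liminf (\<lambda>m. G m \<omega>) \<partial>M) \<noteq> \<infinity>" by (auto simp: top_unique)
  then have fin: "AE \<omega> in M. liminf (\<lambda>m. G m \<omega>) \<noteq> \<infinity>"
    by (intro nn_integral_PInf_AE) auto
  show ?thesis using fin W_eventually refl
  proof eventually_elim
    case (elim \<omega>)
    have "Y\<^sub>\<tau> \<omega> \<noteq> 0"
    proof
      assume Y0: "Y\<^sub>\<tau> \<omega> = 0"
      have "ennreal R \<le> liminf (\<lambda>m. G m \<omega>)" if R: "0 < R" for R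
      proof -
        \<comment> \<open>The radius at which c * |z|^(- \<epsilon>) equals R; closer to the corner
          f is at least R.\<close>
        define \<rho> where "\<rho> = (R / c) powr (- (1 / \<epsilon>))"
        have \<rho>: "0 < \<rho>" "\<rho> powr (- \<epsilon>) = R / c"
          using R c \<epsilon> by (auto simp: \<rho>_def powr_powr)
        have "\<forall>\<^sub>F z in nhds (Complex 0 (Y\<^sub>\<tau> \<omega>)). norm z < \<rho>"
          using \<rho> Y0 by (auto simp: eventually_nhds_metric dist_norm Complex_eq intro!: exI[of _ \<rho>])
        then have "\<forall>\<^sub>F m in sequentially. \<forall>\<^sub>F n in sequentially.
           norm (W (x / real (m + 2)) (real (m + 1)) n \<omega>) < \<rho> \<and> x / real (m + 2) / 4 \<le> Re (W (x / real (m + 2)) (real (m + 1)) n \<omega>)"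
          using elim(2) by blast
        then have "\<forall>\<^sub>F m in sequentially. ennreal R \<le> G m \<omega>"
        proof eventually_elim
          case (elim m)
          then have "\<forall>\<^sub>F n in sequentially. ennreal R \<le> u m n \<omega>"
          proof eventually_elim
            case (elim n)
            let ?w = "W (x / real (m + 2)) (real (m + 1)) n \<omega>"
            have re: "0 < Re ?w" using elim level_bounds(4)[of m] by linarith
            then have "0 < norm ?w" by auto
            then have "\<rho> powr (- \<epsilon>) \<le> norm ?w powr (- \<epsilon>)"
              using elim \<epsilon> by (intro powr_mono2') auto
            then have "R \<le> norm ?w powr (- \<epsilon>) * c" unfolding \<rho>(2) using c by (simp add: pos_divide_le_eq)
            also have "\<dots> \<le> Re (oblique_fun \<theta> ?a ?w)" using low[OF re Im_W_nonneg] .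
            finally show ?case unfolding u_def using elim by (intro ennreal_leI) (simp add: clamped_def)
          qed
          then show ?case unfolding G_def by (rule Liminf_bounded)
        qed
        then show ?thesis by (rule Liminf_bounded)
      qed
      then have "liminf (\<lambda>m. G m \<omega>) = \<infinity>"
      proof (cases "liminf (\<lambda>m. G m \<omega>)")
        case (real r)
        assume *: "\<And>R. 0 < R \<Longrightarrow> ennreal R \<le> liminf (\<lambda>m. G m \<omega>)"
        from *[of "r + 1"] real show ?thesis by (simp add: ennreal_le_iff)
      qed simp
      then show False using elim(1) by contradiction
    qed
    then show ?case using elim(3) by auto
  qed
qed

text \<open>
  The number of grid steps tends to infinity first, for a fixed stopping level \<open>x / (m + 2)\<close> and horizon
  \<open>m + 1\<close>; these are relaxed afterwards, which avoids any regularity of the hitting times of positive levels.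
\<close>

lemma expectation_imag_power:
  "expectation (\<lambda>\<omega>. iexp (u * ln (Y\<^sub>\<tau> \<omega>))) * cos (of_real \<theta> - \<i> * of_real (u * pi / 2))
     = iexp (u * ln x) * of_real (cos \<theta>)"
proof -
  let ?a = "\<i> * of_real u :: complex"
  let ?cc = "cos (of_real \<theta> - \<i> * of_real (u * pi / 2)) :: complex"
  define f where "f \<omega> = iexp (u * ln (Y\<^sub>\<tau> \<omega>)) * ?cc" for \<omega>
  \<comment> \<open>On the positive imaginary axis z and its conjugate have arguments pi / 2 and -
    pi / 2, so the powers contribute exp (- u pi / 2) and exp (u pi / 2), which merge with the
    factors cis (- \<theta>) and cis \<theta> into a complex cosine.\<close>
  have oc: "oblique_fun \<theta> ?a (Complex 0 y) = iexp (u * ln y) * ?cc" if y: "0 < y" for y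
  proof -
    have L: "Ln (Complex 0 y) = Complex (ln y) (pi / 2)"
      using y Ln_times_ii[of "of_real y"] by (simp add: Complex_eq Ln_of_real mult.commute)
    have Lc: "Ln (Complex 0 (- y)) = Complex (ln y) (- (pi / 2))"
    proof -
      have "Complex 0 y \<notin> \<real>\<^sub>\<le>\<^sub>0" using y by (auto simp: complex_nonpos_Reals_iff)
      then show ?thesis using cnj_Ln[of "Complex 0 y"] unfolding L by (simp add: complex_cnj)
    qed
    have n0: "Complex 0 y \<noteq> 0" "Complex 0 (- y) \<noteq> 0" using y by (auto simp: complex_eq_iff)
    have p1: "Complex 0 y powr ?a = iexp (u * ln y) * exp (- of_real (u * pi / 2))"
    proof -
      have "?a * Complex (ln y) (pi / 2) = \<i> * of_real (u * ln y) + - of_real (u * pi / 2)"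
        by (simp add: complex_eq_iff)
      then show ?thesis using n0 unfolding powr_def L exp_add [symmetric] by simp
    qed
    have p2: "cnj (Complex 0 y) powr ?a = iexp (u * ln y) * exp (of_real (u * pi / 2))"
    proof -
      have "?a * Complex (ln y) (- (pi / 2)) = \<i> * of_real (u * ln y) + of_real (u * pi / 2)"
        by (simp add: complex_eq_iff)
      moreover have "cnj (Complex 0 y) = Complex 0 (- y)" by (simp add: complex_eq_iff)
      ultimately show ?thesis using n0 unfolding powr_def exp_add [symmetric] by (simp only: Lc) simp
    qed
    have "oblique_fun \<theta> ?a (Complex 0 y)
      = iexp (u * ln y) * ((cis (-\<theta>) * exp (- of_real (u * pi / 2)) + cis \<theta> * exp (of_real (u * pi / 2))) / 2)"
      unfolding oblique_fun_def p1 p2 by (simp add: algebra_simps)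
    also have "(cis (-\<theta>) * exp (- of_real (u * pi / 2)) + cis \<theta> * exp (of_real (u * pi / 2))) / 2 = ?cc"
      unfolding cos_exp_eq cis_conv_exp
      by (simp add: algebra_simps flip: exp_add)
    finally show ?thesis .
  qed
  have ox: "oblique_fun \<theta> ?a (of_real x) = iexp (u * ln x) * of_real (cos \<theta>)"
  proof -
    have "of_real x powr ?a = iexp (u * ln x)"
      using x by (simp add: powr_def Ln_of_real mult_ac)
    moreover have "(cis (-\<theta>) + cis \<theta>) / 2 = of_real (cos \<theta>)" by (simp add: complex_eq_iff)
    ultimately show ?thesis
      unfolding oblique_fun_def by (simp add: distrib_right [symmetric])
  qed
  define C where "C = norm ?cc + exp (\<bar>u\<bar> * pi)"
  have C: "0 \<le> C" by (simp add: C_def)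
  have f_le: "norm (f \<omega>) \<le> norm ?cc" for \<omega> by (simp add: f_def norm_mult)
  have [measurable]: "f \<in> borel_measurable M" unfolding f_def [abs_def] by measurable
  have int_f: "integrable M f" using f_le by (intro integrable_const_bound[where B = "norm ?cc"]) auto
  define cl where "cl m n \<omega> = clamped (x / real (m + 2) / 4) \<theta> ?a (W (x / real (m + 2)) (real (m + 1)) n \<omega>)" for m n \<omega>
  have cl_meas [measurable]: "cl m n \<in> borel_measurable M" for m n
  proof -
    note [measurable] = clamped_measurable[OF level_bounds(4)[of m]] W_measurable[OF level_bounds(3)[of m]]
    show ?thesis unfolding cl_def [abs_def] by measurable
  qed
  have cl_le: "norm (cl m n \<omega>) \<le> exp (\<bar>u\<bar> * pi)" for m n \<omega>
    unfolding cl_def by (rule norm_clamped_imag_le[OF level_bounds(4)])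
  have int_cl: "integrable M (cl m n)" for m n
    using cl_le by (intro integrable_const_bound[where B = "exp (\<bar>u\<bar> * pi)"]) auto
  have diff_le: "norm (f \<omega> - cl m n \<omega>) \<le> C" for m n \<omega>
    using norm_triangle_ineq4[of "f \<omega>" "cl m n \<omega>"] f_le[of \<omega>] cl_le[of m n \<omega>] by (simp add: C_def)
  \<comment> \<open>The pathwise statement for fixed m bounds the error eventually in n without
    asserting a limit, hence the limsup.\<close>
  define G where "G m \<omega> = limsup (\<lambda>n. ennreal (norm (f \<omega> - cl m n \<omega>)))" for m \<omega>
  have G_meas [measurable]: "G m \<in> borel_measurable M" for m unfolding G_def [abs_def] by measurable
  have G_le: "G m \<omega> \<le> ennreal C" for m \<omega>
    unfolding G_def by (rule Limsup_bounded) (intro always_eventually allI ennreal_leI diff_le)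
  define r where "r = norm (expectation f - oblique_fun \<theta> ?a (of_real x))"
  \<comment> \<open>For fixed m the means converge in n, and the reverse Fatou lemma with the
    constant bound \<open>C\<close> moves the limsup inside the integral.\<close>
  have r_le: "ennreal r \<le> (\<integral>\<^sup>+\<omega>. G m \<omega> \<partial>M)" for m
  proof -
    have "ennreal r \<le> limsup (\<lambda>n. \<integral>\<^sup>+\<omega>. ennreal (norm (f \<omega> - cl m n \<omega>)) \<partial>M)"
    proof (rule limsup_const_bound)
      fix r' assume r': "r' < r"
      have "(\<lambda>n. norm (expectation f - expectation (cl m n))) \<longlonglongrightarrow> r"
        unfolding r_def cl_def using level_bounds[of m]
        by (intro tendsto_intros expectation_clamped_W_tendsto) auto
      then have "\<forall>\<^sub>F n in sequentially. r' < norm (expectation f - expectation (cl m n))"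
        using r' by (rule order_tendstoD(1))
      then show "\<forall>\<^sub>F n in sequentially. ennreal r' \<le> (\<integral>\<^sup>+\<omega>. ennreal (norm (f \<omega> - cl m n \<omega>)) \<partial>M)"
      proof eventually_elim
        case (elim n)
        have "norm (expectation f - expectation (cl m n)) = norm (expectation (\<lambda>\<omega>. f \<omega> - cl m n \<omega>))"
          using int_f int_cl by simp
        also have "\<dots> \<le> expectation (\<lambda>\<omega>. norm (f \<omega> - cl m n \<omega>))" by (rule integral_norm_bound)
        finally have "ennreal r' \<le> ennreal (expectation (\<lambda>\<omega>. norm (f \<omega> - cl m n \<omega>)))"
          using elim by (intro ennreal_leI) linarith
        also have "\<dots> = (\<integral>\<^sup>+\<omega>. ennreal (norm (f \<omega> - cl m n \<omega>)) \<partial>M)"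
          using int_f int_cl by (intro nn_integral_eq_integral[symmetric]) auto
        finally show ?case .
      qed
    qed
    also have "\<dots> \<le> (\<integral>\<^sup>+\<omega>. G m \<omega> \<partial>M)"
      unfolding G_def
    proof (rule nn_integral_limsup[where w = "\<lambda>_. ennreal C"])
      show "AE \<omega> in M. ennreal (norm (f \<omega> - cl m n \<omega>)) \<le> ennreal C" for n
        by (intro AE_I2 ennreal_leI diff_le)
      show "(\<integral>\<^sup>+\<omega>. ennreal C \<partial>M) < \<infinity>" by (simp add: emeasure_space_1)
    qed measurable
    finally show ?thesis .
  qed
  have "(\<lambda>m. \<integral>\<^sup>+\<omega>. G m \<omega> \<partial>M) \<longlonglongrightarrow> (\<integral>\<^sup>+\<omega>. 0 \<partial>M)"
  proof (rule nn_integral_dominated_convergence[where w = "\<lambda>_. ennreal C"])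
    show "AE \<omega> in M. G m \<omega> \<le> ennreal C" for m using G_le by (intro AE_I2)
    show "(\<integral>\<^sup>+\<omega>. ennreal C \<partial>M) < \<infinity>" by (simp add: emeasure_space_1)
    show "AE \<omega> in M. (\<lambda>m. G m \<omega>) \<longlonglongrightarrow> 0"
      using W_eventually Y\<tau>_pos
    proof eventually_elim
      case (elim \<omega>)
      show ?case
      proof (rule order_tendstoI)
        fix e :: ennreal assume "0 < e"
        then obtain y where y: "0 < y" "y < e" using dense by blast
        then obtain e' where e': "0 < e'" "ennreal e' < e" by (cases y) auto
        \<comment> \<open>Here the corner matters: f is continuous at the hitting point because its
          ordinate is positive.\<close>
        have "\<forall>\<^sub>F z in nhds (Complex 0 (Y\<^sub>\<tau> \<omega>)). dist (oblique_fun \<theta> ?a z) (oblique_fun \<theta> ?a (Complex 0 (Y\<^sub>\<tau> \<omega>))) < e'"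
          using continuous_oblique_fun_imag_axis[OF elim(2), of \<theta> ?a] e'(1)
          unfolding isCont_def tendsto_at_iff_tendsto_nhds by (rule tendstoD)
        then have "\<forall>\<^sub>F m in sequentially. \<forall>\<^sub>F n in sequentially.
            dist (oblique_fun \<theta> ?a (W (x / real (m + 2)) (real (m + 1)) n \<omega>)) (oblique_fun \<theta> ?a (Complex 0 (Y\<^sub>\<tau> \<omega>))) < e'
            \<and> x / real (m + 2) / 4 \<le> Re (W (x / real (m + 2)) (real (m + 1)) n \<omega>)"
          by (rule elim(1)[rule_format])
        then show "\<forall>\<^sub>F m in sequentially. G m \<omega> < e"
        proof eventually_elim
          case (elim m)
          then have "\<forall>\<^sub>F n in sequentially. ennreal (norm (f \<omega> - cl m n \<omega>)) \<le> ennreal e'"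
          proof eventually_elim
            case (elim n)
            then show ?case
              unfolding f_def oc[OF \<open>0 < Y\<^sub>\<tau> \<omega>\<close>, symmetric]
              by (intro ennreal_leI) (simp add: cl_def clamped_def dist_norm norm_minus_commute)
          qed
          then have "G m \<omega> \<le> ennreal e'" unfolding G_def by (rule Limsup_bounded)
          then show ?case using e'(2) by (rule le_less_trans)
        qed
      qed simp
    qed
  qed measurable
  then have "ennreal r \<le> 0"
    using r_le by (intro tendsto_lowerbound[of "\<lambda>m. \<integral>\<^sup>+\<omega>. G m \<omega> \<partial>M"]) auto
  then have "r = 0" by (simp add: r_def)
  then have "expectation f = oblique_fun \<theta> ?a (of_real x)" by (simp add: r_def)
  moreover have "expectation f = expectation (\<lambda>\<omega>. iexp (u * ln (Y\<^sub>\<tau> \<omega>))) * ?cc"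
    unfolding f_def by simp
  ultimately show ?thesis unfolding ox by simp
qed

end

section \<open>The law of the hitting point\<close>

text \<open>Levy's uniqueness theorem identifies the laws of the logarithms; applying
  \<open>exp\<close> recovers the laws themselves, as both are concentrated on the positive
  axis.\<close>

lemma distributed_of_char_ln:
  fixes R :: "'a \<Rightarrow> real"
  assumes M: "prob_space M" and \<alpha>: "0 < \<alpha>" "\<alpha> < 1"
    and R [measurable]: "R \<in> borel_measurable M" and pos: "AE \<omega> in M. 0 < R \<omega>"
    and char: "\<And>t. (CLINT \<omega>|M. iexp (t * ln (R \<omega>)))
      = of_real (sin (pi * \<alpha>)) / sin (of_real pi * (of_real \<alpha> + \<i> * of_real t))"
  shows "distributed M lborel R (\<lambda>z. ennreal (beta2_density \<alpha> (1 - \<alpha>) z))"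
proof -
  interpret M: prob_space M by fact
  let ?f = "beta2_density \<alpha> (1 - \<alpha>)"
  define D where "D = density lborel (\<lambda>z. ennreal (?f z))"
  interpret D: prob_space D unfolding D_def by (rule prob_space_beta2[OF \<alpha>])
  have sets_D [measurable_cong, simp]: "sets D = sets borel" by (simp add: D_def)
  have f [measurable]: "?f \<in> borel_measurable borel"
    unfolding beta2_density_eq[OF \<alpha>, abs_def] by measurable
  have "distr M borel (\<lambda>\<omega>. ln (R \<omega>)) = distr D borel ln"
  proof (rule Levy_uniqueness)
    show "real_distribution (distr M borel (\<lambda>\<omega>. ln (R \<omega>)))" by (rule M.real_distribution_distr) measurable
    show "real_distribution (distr D borel ln)" by (rule D.real_distribution_distr) measurable
    show "char (distr M borel (\<lambda>\<omega>. ln (R \<omega>))) = char (distr D borel ln)"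
    proof
      fix t
      have "char (distr D borel ln) t = (CLINT z|D. iexp (t * ln z))"
        unfolding char_def by (rule integral_distr) measurable
      also have "\<dots> = (CLINT z|lborel. ?f z *\<^sub>R iexp (t * ln z))"
        unfolding D_def using beta2_density_nonneg[OF \<alpha>] by (intro integral_density) auto
      also have "\<dots> = of_real (sin (pi * \<alpha>)) / sin (of_real pi * (of_real \<alpha> + \<i> * of_real t))"
        by (rule has_bochner_integral_integral_eq[OF beta2_density_char[OF \<alpha>]])
      also have "\<dots> = (CLINT \<omega>|M. iexp (t * ln (R \<omega>)))" by (rule char[symmetric])
      also have "\<dots> = char (distr M borel (\<lambda>\<omega>. ln (R \<omega>))) t"
        unfolding char_def by (rule integral_distr[symmetric]) measurable
      finally show "char (distr M borel (\<lambda>\<omega>. ln (R \<omega>))) t = char (distr D borel ln) t" ..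
    qed
  qed
  then have "distr (distr M borel (\<lambda>\<omega>. ln (R \<omega>))) borel exp = distr (distr D borel ln) borel exp"
    by (rule arg_cong)
  then have eq: "distr M borel (\<lambda>\<omega>. exp (ln (R \<omega>))) = distr D borel (\<lambda>z. exp (ln z))"
    by (simp add: distr_distr comp_def)
  have "distr M lborel R = distr M borel (\<lambda>\<omega>. exp (ln (R \<omega>)))"
    by (rule distr_cong_AE) (use pos in auto)
  also note eq
  also have "distr D borel (\<lambda>z. exp (ln z)) = distr D D (\<lambda>z. z)"
  proof (rule distr_cong_AE)
    \<comment> \<open>The density vanishes for z <= 0, so the convention for \<open>ln\<close> there
      has no effect.\<close>
    show "AE z in D. exp (ln z) = z"
      unfolding D_def by (subst AE_density) (auto simp: beta2_density_def)
  qed auto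
  also have "\<dots> = density lborel (\<lambda>z. ennreal (?f z))" unfolding D_def by (rule distr_id2) simp
  finally show ?thesis by (simp add: distributed_def)
qed

text \<open>With u = 2 * t the formula of \<open>expectation_imag_power\<close> is the
  characteristic function of the logarithm, since pi * \<alpha> = pi / 2 - \<theta> turns the
  cosines into the sines of \<open>beta2_density_char\<close>.\<close>

lemma (in oblique_process) distributed_ratio:
  "distributed M lborel (\<lambda>\<omega>. (Y\<^sub>\<tau> \<omega>)\<^sup>2 / x\<^sup>2)
     (\<lambda>z. ennreal (beta2_density (1 / 2 - \<theta> / pi) (1 / 2 + \<theta> / pi) z))"
proof -
  define \<alpha> where "\<alpha> = 1 / 2 - \<theta> / pi"
  have \<alpha>: "0 < \<alpha>" "\<alpha> < 1" using \<theta> by (auto simp: \<alpha>_def field_simps)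
  have 1: "1 / 2 + \<theta> / pi = 1 - \<alpha>" by (simp add: \<alpha>_def)
  have pa: "pi * \<alpha> = pi / 2 - \<theta>" by (simp add: \<alpha>_def field_simps)
  show ?thesis
    unfolding 1 \<alpha>_def[symmetric]
  proof (rule distributed_of_char_ln[OF prob_space_axioms \<alpha>])
    show "AE \<omega> in M. 0 < (Y\<^sub>\<tau> \<omega>)\<^sup>2 / x\<^sup>2" using Y\<tau>_pos x by auto
    fix t :: real
    let ?I = "CLINT \<omega>|M. iexp (2 * t * ln (Y\<^sub>\<tau> \<omega>))"
    let ?c = "cos (of_real \<theta> - \<i> * of_real (2 * t * pi / 2)) :: complex"
    have E: "?I * ?c = iexp (2 * t * ln x) * of_real (cos \<theta>)" by (rule expectation_imag_power)
    \<comment> \<open>The right-hand side of \<open>E\<close> is nonzero, so the cosine on the left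
      cannot vanish.\<close>
    have c0: "?c \<noteq> 0" using E cos_tan by auto
    have sin1: "sin (pi * \<alpha>) = cos \<theta>" unfolding pa by (simp add: sin_diff)
    have sin2: "sin (of_real pi * (of_real \<alpha> + \<i> * of_real t)) = ?c"
    proof -
      have "of_real pi * (of_real \<alpha> + \<i> * of_real t) = of_real (pi * \<alpha>) + \<i> * of_real (pi * t)"
        by (simp add: algebra_simps)
      also have "\<dots> = of_real pi / 2 - (of_real \<theta> - \<i> * of_real (2 * t * pi / 2))"
        unfolding pa by (simp add: algebra_simps)
      finally show ?thesis by (simp add: cos_sin_eq)
    qed
    have "(CLINT \<omega>|M. iexp (t * ln ((Y\<^sub>\<tau> \<omega>)\<^sup>2 / x\<^sup>2)))
        = (CLINT \<omega>|M. iexp (2 * t * ln (Y\<^sub>\<tau> \<omega>)) * iexp (- (2 * t * ln x)))"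
    proof (rule integral_cong_AE)
      show "AE \<omega> in M. iexp (t * ln ((Y\<^sub>\<tau> \<omega>)\<^sup>2 / x\<^sup>2)) = iexp (2 * t * ln (Y\<^sub>\<tau> \<omega>)) * iexp (- (2 * t * ln x))"
        using Y\<tau>_pos
      proof eventually_elim
        case (elim \<omega>)
        have "ln ((Y\<^sub>\<tau> \<omega>)\<^sup>2 / x\<^sup>2) = 2 * ln (Y\<^sub>\<tau> \<omega>) - 2 * ln x"
          using elim x by (simp add: ln_div ln_realpow)
        then have *: "t * ln ((Y\<^sub>\<tau> \<omega>)\<^sup>2 / x\<^sup>2) = 2 * t * ln (Y\<^sub>\<tau> \<omega>) - 2 * t * ln x"
          by (simp only: right_diff_distrib)
        show ?case unfolding * by (simp add: algebra_simps flip: exp_add)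
      qed
    qed measurable
    also have "\<dots> = ?I * iexp (- (2 * t * ln x))" by simp
    also have "?I = iexp (2 * t * ln x) * of_real (cos \<theta>) / ?c" using E c0 by (simp add: field_simps)
    also have "iexp (2 * t * ln x) * of_real (cos \<theta>) / ?c * iexp (- (2 * t * ln x)) = of_real (cos \<theta>) / ?c"
    proof -
      have inv: "iexp (2 * t * ln x) * iexp (- (2 * t * ln x)) = 1" by (simp flip: exp_add)
      have "a * b / c * d = (a * d) * b / c" for a b c d :: complex by simp
      then show ?thesis by (simp only: inv mult_1_left)
    qed
    finally show "(CLINT \<omega>|M. iexp (t * ln ((Y\<^sub>\<tau> \<omega>)\<^sup>2 / x\<^sup>2)))
      = of_real (sin (pi * \<alpha>)) / sin (of_real pi * (of_real \<alpha> + \<i> * of_real t))"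
      unfolding sin1 sin2 .
  qed measurable
qed

text \<open>By the intermediate value theorem every nonpositive value is preceded by a zero or is
  one itself, so none occurs before the first zero.\<close>

lemma first_zero_of_path:
  fixes f :: "real \<Rightarrow> real"
  assumes f: "continuous_on {0..} f" and pos: "0 < f 0" and t0: "0 \<le> t0" "f t0 \<le> 0"
  defines "S \<equiv> Inf {ereal t | t. 0 \<le> t \<and> f t = 0}"
  shows "S < \<infinity>" "0 \<le> real_of_ereal S" "f (real_of_ereal S) = 0"
    "\<And>t. \<lbrakk>0 \<le> t; t < real_of_ereal S\<rbrakk> \<Longrightarrow> 0 < f t"
proof -
  have zero: "\<exists>z\<ge>0. z \<le> t \<and> f z = 0" if "0 \<le> t" "f t \<le> 0" for t
    using IVT2'[of f t 0 0] pos that continuous_on_subset[OF f, of "{0..t}"] by auto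
  then obtain s where s: "0 \<le> s" "S = ereal s" "f s = 0" "\<forall>t. 0 \<le> t \<and> t < s \<longrightarrow> f t \<noteq> 0"
    using hitting_time_path[OF f] t0 unfolding S_def by blast
  then show "S < \<infinity>" "0 \<le> real_of_ereal S" "f (real_of_ereal S) = 0" by simp_all
  fix t assume "0 \<le> t" "t < real_of_ereal S"
  then have t: "0 \<le> t" "t < s" using s by auto
  show "0 < f t"
  proof (rule ccontr)
    assume "\<not> 0 < f t"
    then obtain z where "0 \<le> z" "z \<le> t" "f z = 0" using zero[of t] t by auto
    then show False using s(4) t by auto
  qed
qed

theorem proposition2p12:
  fixes M :: "'a measure"
    and X Y :: "real \<Rightarrow> 'a \<Rightarrow> real"
    and S :: "'a \<Rightarrow> ereal"
    and \<theta> x :: real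
  assumes "prob_space M"
    and "0 < \<theta>" and "\<theta> < pi / 2" and "x > 0"
    and "prob_space.oblique_reflected_BM M \<theta> x 0 X Y"
    and S_def: "\<And>\<omega>. S \<omega> = Inf {ereal t | t. 0 \<le> t \<and> X t \<omega> = 0}"
  shows "(AE \<omega> in M. S \<omega> < \<infinity>) \<and>
         distributed M lborel (\<lambda>\<omega>. (Y (real_of_ereal (S \<omega>)) \<omega>)\<^sup>2 / x\<^sup>2)
           (\<lambda>z. ennreal (beta2_density (1 / 2 - \<theta> / pi) (1 / 2 + \<theta> / pi) z))"
proof -
  interpret prob_space M by fact
  note \<theta> = \<open>0 < \<theta>\<close> \<open>\<theta> < pi / 2\<close> and x = \<open>x > 0\<close>
  have tan: "0 \<le> tan \<theta>" using \<theta> by (intro less_imp_le[OF tan_gt_zero])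
  note O = assms(5)[unfolded oblique_reflected_BM_def]
  have meas: "X t \<in> borel_measurable M" "Y t \<in> borel_measurable M" if "0 \<le> t" for t
    using O that by auto
  have cont: "continuous_on {0..} (\<lambda>t. X t \<omega>)" "continuous_on {0..} (\<lambda>t. Y t \<omega>)" if "\<omega> \<in> space M" for \<omega>
    using O that by auto
  obtain B1 B2 L where B: "brownian_motion (\<lambda>t \<omega>. (B1 t \<omega>, B2 t \<omega>))"
    and L: "symmetric_local_time Y L"
    and XY: "AE \<omega> in M. \<forall>t\<ge>0. X t \<omega> = x + B1 t \<omega> - tan \<theta> * L t \<omega> \<and> Y t \<omega> = 0 + B2 t \<omega> + L t \<omega> \<and> Y t \<omega> \<ge> 0"
    using O by blast
  obtain A where A: "quadratic_variation Y A"
    and lim: "AE \<omega> in M. \<forall>t\<ge>0.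
           ((\<lambda>\<epsilon>. 1 / (2 * \<epsilon>) *
                (LINT s:{0..t}|interval_measure (\<lambda>s. A (max 0 s) \<omega>). indicator {s. \<bar>Y s \<omega>\<bar> \<le> \<epsilon>} s))
              \<longlongrightarrow> L t \<omega>) (at_right 0)"
    using L unfolding symmetric_local_time_def by blast
  have A_path: "AE \<omega> in M. A 0 \<omega> = 0 \<and> mono_on {0..} (\<lambda>t. A t \<omega>) \<and> continuous_on {0..} (\<lambda>t. A t \<omega>)"
    using A unfolding quadratic_variation_def by blast
  have B0: "AE \<omega> in M. (B1 0 \<omega>, B2 0 \<omega>) = 0" and Bc: "AE \<omega> in M. continuous_on {0..} (\<lambda>t. (B1 t \<omega>, B2 t \<omega>))"
    using B unfolding brownian_motion_def by auto
  \<comment> \<open>Since \<open>real_of_ereal\<close> sends infinity to 0, this is a nonnegative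
    real at every sample point, also where \<open>X\<close> never vanishes.\<close>
  define \<tau> where "\<tau> \<omega> = real_of_ereal (S \<omega>)" for \<omega>
  define Y\<tau> where "Y\<tau> \<omega> = Y (\<tau> \<omega>) \<omega>" for \<omega>
  have "S = (\<lambda>\<omega>. Inf {ereal t | t. 0 \<le> t \<and> X t \<omega> = 0})" using S_def by auto
  then have S_meas [measurable]: "S \<in> borel_measurable M"
    using hitting_time_measurable[OF meas(1) cont(1)] by simp
  have \<tau>_nonneg: "0 \<le> \<tau> \<omega>" for \<omega>
    unfolding \<tau>_def S_def by (intro real_of_ereal_pos Inf_greatest) auto
  have Y\<tau>_meas: "Y\<tau> \<in> borel_measurable M"
    unfolding Y\<tau>_def [abs_def]
    by (rule process_at_time_measurable[OF meas(2) cont(2) _ \<tau>_nonneg]) (simp_all add: \<tau>_def [abs_def])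
  have path: "AE \<omega> in M. S \<omega> < \<infinity> \<and> reflected_path \<theta> (\<lambda>t. B1 t \<omega>) (\<lambda>t. B2 t \<omega>) (\<lambda>t. L t \<omega>)
       \<and> 0 \<le> \<tau> \<omega> \<and> reflected_path.path \<theta> x (\<lambda>t. B1 t \<omega>) (\<lambda>t. B2 t \<omega>) (\<lambda>t. L t \<omega>) (\<tau> \<omega>) = Complex 0 (Y\<tau> \<omega>)
       \<and> (\<forall>t. 0 \<le> t \<and> t < \<tau> \<omega> \<longrightarrow> 0 < Re (reflected_path.path \<theta> x (\<lambda>t. B1 t \<omega>) (\<lambda>t. B2 t \<omega>) (\<lambda>t. L t \<omega>) t))
       \<and> 0 \<le> Y\<tau> \<omega>"
    using XY lim A_path B0 Bc brownian_hits_level[OF B less_imp_le[OF x]] AE_space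
  proof eventually_elim
    case (elim \<omega>)
    note eq = elim(1)[rule_format] and cX = cont(1)[OF elim(7)] and cY = cont(2)[OF elim(7)]
    have b0: "B1 0 \<omega> = 0" "B2 0 \<omega> = 0" using elim(4) by (auto simp: zero_prod_def)
    have bc: "continuous_on {0..} (\<lambda>t. B1 t \<omega>)" "continuous_on {0..} (\<lambda>t. B2 t \<omega>)"
      using continuous_on_fst[OF elim(5)] continuous_on_snd[OF elim(5)] by auto
    have lp: "mono_on {0..} (\<lambda>t. L t \<omega>)"
      "\<And>s t. \<lbrakk>0 \<le> s; s \<le> t; \<And>r. \<lbrakk>s \<le> r; r \<le> t\<rbrakk> \<Longrightarrow> 0 < Y r \<omega>\<rbrakk> \<Longrightarrow> L s \<omega> = L t \<omega>"
      "Y 0 \<omega> \<noteq> 0 \<Longrightarrow> L 0 \<omega> = 0"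
      using local_time_path[OF cY, of "\<lambda>t. A t \<omega>" "\<lambda>t. L t \<omega>"] elim(2,3) by blast+
    \<comment> \<open>If \<open>Y 0 \<omega> = 0\<close>, the equation for \<open>Y\<close> together
      with \<open>B2 0 \<omega> = 0\<close> gives the claim; otherwise the local time itself
      vanishes at 0.\<close>
    have l0: "L 0 \<omega> = 0" using lp(3) eq[of 0] b0 by auto
    \<comment> \<open>The local time is given only by pointwise limits in time; its continuity comes
      from the equation \<open>L = Y - B2\<close>.\<close>
    have "continuous_on {0..} (\<lambda>t. Y t \<omega> - B2 t \<omega>)" by (intro continuous_intros cY bc)
    then have lc: "continuous_on {0..} (\<lambda>t. L t \<omega>)"
      by (rule continuous_on_cong[THEN iffD1, rotated 2]) (use eq in auto)
    have R: "reflected_path \<theta> (\<lambda>t. B1 t \<omega>) (\<lambda>t. B2 t \<omega>) (\<lambda>t. L t \<omega>)"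
    proof
      fix s t assume st: "0 \<le> s" "s \<le> t" and r: "\<And>r. \<lbrakk>s \<le> r; r \<le> t\<rbrakk> \<Longrightarrow> 0 < B2 r \<omega> + L r \<omega>"
      show "L s \<omega> = L t \<omega>"
      proof (rule lp(2)[OF st])
        fix u assume u: "s \<le> u" "u \<le> t"
        show "0 < Y u \<omega>" using eq[of u] r[OF u] u st by linarith
      qed
    next
      fix t :: real assume "0 \<le> t"
      then show "0 \<le> B2 t \<omega> + L t \<omega>" using eq[of t] by linarith
    qed (fact tan b0 bc l0 lc lp(1))+
    have path: "reflected_path.path \<theta> x (\<lambda>t. B1 t \<omega>) (\<lambda>t. B2 t \<omega>) (\<lambda>t. L t \<omega>) t = Complex (X t \<omega>) (Y t \<omega>)"
      if "0 \<le> t" for t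
      unfolding reflected_path.path_def[OF R] using eq[OF that] by simp
    obtain t0 where t0: "0 \<le> t0" "B1 t0 \<omega> - B1 0 \<omega> \<le> - x" using elim(6) by blast
    \<comment> \<open>As \<open>L\<close> and \<open>tan \<theta>\<close> are nonnegative,
      \<open>X\<close> lies below x + \<open>B1\<close>, so it is nonpositive when \<open>B1\<close>
      has dropped by x.\<close>
    have "0 \<le> L t0 \<omega>" using mono_onD[OF lp(1), of 0 t0] t0 l0 by simp
    then have "0 \<le> tan \<theta> * L t0 \<omega>" by (intro mult_nonneg_nonneg tan)
    then have "X t0 \<omega> \<le> 0" using eq[OF t0(1)] t0(2) b0 by linarith
    moreover have "0 < X 0 \<omega>" using eq[of 0] b0 l0 x by simp
    ultimately have fz: "S \<omega> < \<infinity>" "0 \<le> \<tau> \<omega>" "X (\<tau> \<omega>) \<omega> = 0" "\<And>t. \<lbrakk>0 \<le> t; t < \<tau> \<omega>\<rbrakk> \<Longrightarrow> 0 < X t \<omega>"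
      using first_zero_of_path[OF cX _ t0(1)] unfolding \<tau>_def S_def by blast+
    show ?case
      using R fz eq[OF fz(2)] by (auto simp: path Y\<tau>_def)
  qed
  interpret P: oblique_process M \<theta> x B1 B2 L \<tau> Y\<tau>
  proof
    show "AE \<omega> in M. reflected_path \<theta> (\<lambda>t. B1 t \<omega>) (\<lambda>t. B2 t \<omega>) (\<lambda>t. L t \<omega>)
       \<and> 0 \<le> \<tau> \<omega> \<and> reflected_path.path \<theta> x (\<lambda>t. B1 t \<omega>) (\<lambda>t. B2 t \<omega>) (\<lambda>t. L t \<omega>) (\<tau> \<omega>) = Complex 0 (Y\<tau> \<omega>)
       \<and> (\<forall>t. 0 \<le> t \<and> t < \<tau> \<omega> \<longrightarrow> 0 < Re (reflected_path.path \<theta> x (\<lambda>t. B1 t \<omega>) (\<lambda>t. B2 t \<omega>) (\<lambda>t. L t \<omega>) t))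
       \<and> 0 \<le> Y\<tau> \<omega>"
      using path by eventually_elim blast
  qed (use \<theta> x B Y\<tau>_meas in auto)
  have "AE \<omega> in M. S \<omega> < \<infinity>" using path by eventually_elim blast
  then show ?thesis using P.distributed_ratio unfolding Y\<tau>_def \<tau>_def by blast
qed

end
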